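(* Let $\mathcal H\subset\mathbb R^n$ be a PSR manifold with cubic polynomial $h$ and denote by $$\mathrm{Aut}(\mathcal H):=\{A\in\mathrm{GL}(n,\mathbb R)\mid A\mathcal H=\mathcal H\}\subset\mathrm{Aut}(h):=\{A\in\mathrm{GL}(n,\mathbb R)\mid A^*h=h\}$$ its group of automorphisms. Then $\mathrm{Aut}(\mathcal H)$ acts by isometries on the corresponding tree-level q-map space $(\overline N,g_{\overline N})$. Moreover, this action normalizes the $(3n+6)$-dimensional connected Lie group $G$ of isometries of $(\overline N,g_{\overline N})$ generated by the $L$-action and S-duality, such that we have a semi-direct product $$\mathrm{Aut}(\mathcal H)\ltimes G\subset\mathrm{Iso}(\overline N,g_{\overline N}).$$
   Context: Conventions: indices $a,b,c,\dots$ run from $1$ to $n$, indices $i,j,k,\dots$ from $0$ to $n$; repeated indices are summed. PSR manifold: let $h(t)=\frac16 k_{abc}t^at^bt^c$ ($k_{abc}\in\mathbb R$ symmetric) be a homogeneous cubic polynomial on $\mathbb R^n$. A projective special real (PSR) manifold is a hypersurface $\mathcal H\subset\{t\in\mathbb R^n\mid h(t)=1\}$ such that $g_{\mathcal H}=-\partial^2h|_{T\mathcal H\times T\mathcal H}$ is a Riemannian metric. Tree-level q-map space: put $U=\mathbb R_{>0}\cdot\mathcal H\subset\mathbb R^n$, $\overline M=\mathbb R^n+iU\subset\mathbb C^n$ with coordinates $z^a=b^a+it^a$, $z^0:=1$, $K(t)=8h(t)$, $\mathcal K=-\log K$, and $g_{\overline M}=\frac{\partial^2\mathcal K}{\partial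 z^a\partial\overline z^b}dz^ad\overline z^b=-\frac14\frac{\partial^2\log h}{\partial t^a\partial t^b}(db^adb^b+dt^adt^b)$. Let $\mathfrak F(X)=-h(X^1,\dots,X^n)/X^0$, $\tau_{ij}=\frac{\partial^2\mathfrak F}{\partial X^i\partial X^j}$ evaluated at $X=(1,z)$, $N_{ij}=-2\,\mathrm{Im}(\tau_{ij})$, $(N^{ij})=(N_{ij})^{-1}$, $W_i=d\widetilde\zeta_i-\tau_{ij}d\zeta^j$; then $K=N_{ij}z^i\overline z^j$. The tree-level q-map space is $\overline N=\overline M\times\mathbb R_{>0}\times\mathbb R^{2n+2}\times\mathbb R$ with global ("type IIA") coordinates $(z^a,\rho,\widetilde\zeta_i,\zeta^i,\sigma)$ and metric $$g_{\overline N}=g_{\overline M}+\frac{d\rho^2}{4\rho^2}-\frac1{4\rho}\Big(N^{ij}-\frac2Kz^i\overline z^j\Big)W_i\overline W_j+\frac1{64\rho^2}\big(d\sigma+\widetilde\zeta_id\zeta^i-\zeta^id\widetilde\zeta_i\big)^2 .$$ Action of $A\in\mathrm{Aut}(\mathcal H)$ on $\overline N$: with $z=(z^a),\zeta=(\zeta^a),\widetilde\zeta=(\widetilde\zeta_a)^\top$, $(\rho,z,\zeta^0,\zeta,\widetilde\zeta_0,\widetilde\zeta,\sigma)\mapsto(\rho,Az,\zeta^0,A\zeta,\widetilde\zeta_0,(A^\top)^{-1}\widetilde\zeta,\sigma)$. Group $G$: the connected Lie group of isometries whose Lie algebra is spanned by the Killing fields $D=\rho\partial_\rho+\frac12\widetilde\zeta_i\partial_{\widetilde\zeta_i}+\frac12\zeta^i\partial_{\zeta^i}+\sigma\partial_\sigma$,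 $P_i=\partial_{\zeta^i}+\widetilde\zeta_i\partial_\sigma$, $X^i=\partial_{\widetilde\zeta_i}-\zeta^i\partial_\sigma$, $Z=\partial_\sigma$, $V_a=\partial_{b^a}+\zeta^0\partial_{\zeta^a}-\widetilde\zeta_a\partial_{\widetilde\zeta_0}-k_{abc}\zeta^c\partial_{\widetilde\zeta_b}$ (which, together with $D_1=D-X_h$, generate the $L$-action) and $X_e=P_0$, $X_f$, $X_h$ (which generate S-duality). Here $X_e,X_f,X_h$ are the fundamental vector fields of the S-duality action for $e=\begin{pmatrix}0&1\\ 0&0\end{pmatrix}$, $f=\begin{pmatrix}0&0\\ 1&0\end{pmatrix}$, $\begin{pmatrix}1&0\\ 0&-1\end{pmatrix}$. S-duality: "type IIB" global coordinates $(b^a+it^a,\tau_1+i\tau_2,c^a,c_a,c_0,\psi)$ on $\overline N$ (with $b^a+it^a\in\overline M$, $\tau_2>0$, the others real) are defined by $\rho=\frac{\tau_2^2}{2}h(t)$, $z^a=b^a+it^a$, $\zeta^0=\tau_1$, $\zeta^a=-(c^a-\tau_1b^a)$, $\widetilde\zeta_a=c_a+\frac{k_{abc}}2b^b(c^c-\tau_1b^c)$, $\widetilde\zeta_0=c_0-\frac{k_{abc}}6b^ab^b(c^c-\tau_1b^c)$, $\sigma=-2(\psi+\frac12\tau_1c_0)+c_a(c^a-\tau_1b^a)-\frac{k_{abc}}6b^ac^b(c^c-\tau_1b^c)$. The S-duality action of $\begin{pmatrix}a&b\\ c&d\end{pmatrix}\in\mathrm{SL}(2,\mathbb R)$ is,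 with $\tau=\tau_1+i\tau_2$, $$\tau\mapsto\frac{a\tau+b}{c\tau+d},\quad t^a\mapsto|c\tau+d|t^a,\quad c_a\mapsto c_a,\quad\begin{pmatrix}c^a\\ b^a\end{pmatrix}\mapsto\begin{pmatrix}a&b\\ c&d\end{pmatrix}\begin{pmatrix}c^a\\ b^a\end{pmatrix},\quad\begin{pmatrix}c_0\\ \psi\end{pmatrix}\mapsto\begin{pmatrix}d&-c\\ -b&a\end{pmatrix}\begin{pmatrix}c_0\\ \psi\end{pmatrix}.$$ *)

theory Defs
  imports
    "HOL-Analysis.Analysis"
    "HOL-Algebra.Bij"
    "HOL-Algebra.Generated_Groups"
    "HOL-Library.Function_Algebras"
begin

section \<open>Smooth maps between open subsets of normed spaces\<close>

text \<open>Only meant for open \<open>S\<close> in finite-dimensional spaces: there a map has \<open>m + 1\<close> continuous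
  derivatives iff it is differentiable and all its directional derivatives, as functions of the
  base point, have \<open>m\<close> continuous derivatives.\<close>

primrec Ck_on :: "nat \<Rightarrow> ('a::real_normed_vector \<Rightarrow> 'b::real_normed_vector) \<Rightarrow> 'a set \<Rightarrow> bool" where
  "Ck_on 0 f S \<longleftrightarrow> continuous_on S f"
| "Ck_on (Suc m) f S \<longleftrightarrow> (\<forall>x\<in>S. f differentiable (at x)) \<and>
     (\<forall>v. Ck_on m (\<lambda>x. frechet_derivative f (at x) v) S)"

definition smooth_on :: "('a::real_normed_vector \<Rightarrow> 'b::real_normed_vector) \<Rightarrow> 'a set \<Rightarrow> bool" where
  "smooth_on f S \<longleftrightarrow> (\<forall>m. Ck_on m f S)"

text \<open>The \<open>i\<close>-th partial derivative; real for \<open>'a = real\<close>, holomorphic for \<open>'a = complex\<close>.\<close>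

definition partial :: "'i::finite \<Rightarrow> ('a::real_normed_field ^ 'i \<Rightarrow> 'a) \<Rightarrow> 'a ^ 'i \<Rightarrow> 'a" where
  "partial i f x = deriv (\<lambda>s. f (x + axis i s)) 0"


section \<open>Projective special real manifolds\<close>

definition symmetric3 :: "('n \<Rightarrow> 'n \<Rightarrow> 'n \<Rightarrow> real) \<Rightarrow> bool" where
  "symmetric3 k \<longleftrightarrow> (\<forall>a b c. k a b c = k b a c \<and> k a b c = k a c b)"

text \<open>The polynomial \<open>h\<close>, both on real and on complex vectors.\<close>

definition cubic :: "('n::finite \<Rightarrow> 'n \<Rightarrow> 'n \<Rightarrow> real) \<Rightarrow> 'a::real_normed_field ^ 'n \<Rightarrow> 'a" where
  "cubic k t = (1/6) * (\<Sum>a\<in>UNIV. \<Sum>b\<in>UNIV. \<Sum>c\<in>UNIV. of_real (k a b c) * t$a * t$b * t$c)"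

definition smooth_hypersurface :: "(real ^ 'n::finite) set \<Rightarrow> bool" where
  "smooth_hypersurface M \<longleftrightarrow>
     (\<forall>p\<in>M. \<exists>V. \<exists>f::real ^ 'n \<Rightarrow> real. open V \<and> p \<in> V \<and> smooth_on f V \<and>
        (\<forall>x\<in>V. \<exists>v. frechet_derivative f (at x) v \<noteq> 0) \<and> M \<inter> V = {x\<in>V. f x = 0})"

definition tangent_space :: "(real ^ 'n::finite) set \<Rightarrow> real ^ 'n \<Rightarrow> (real ^ 'n) set" where
  "tangent_space M p =
     {v. \<exists>\<gamma>::real \<Rightarrow> real ^ 'n. \<exists>\<epsilon>>0. smooth_on \<gamma> {-\<epsilon><..<\<epsilon>} \<and> \<gamma> ` {-\<epsilon><..<\<epsilon>} \<subseteq> M \<and>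
        \<gamma> 0 = p \<and> (\<gamma> has_vector_derivative v) (at 0)}"

definition psr_manifold :: "('n::finite \<Rightarrow> 'n \<Rightarrow> 'n \<Rightarrow> real) \<Rightarrow> (real ^ 'n) set \<Rightarrow> bool" where
  "psr_manifold k M \<longleftrightarrow> symmetric3 k \<and> M \<noteq> {} \<and> smooth_hypersurface M \<and> M \<subseteq> {t. cubic k t = 1} \<and>
     (\<forall>p\<in>M. \<forall>v\<in>tangent_space M p. v \<noteq> 0 \<longrightarrow>
        0 < (\<Sum>a\<in>UNIV. \<Sum>b\<in>UNIV. - partial a (partial b (cubic k)) p * v$a * v$b))"

definition Aut_H :: "(real ^ 'n::finite) set \<Rightarrow> (real ^ 'n ^ 'n) set" where
  "Aut_H M = {A. invertible A \<and> (\<lambda>t. A *v t) ` M = M}"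

definition Aut_h :: "('n::finite \<Rightarrow> 'n \<Rightarrow> 'n \<Rightarrow> real) \<Rightarrow> (real ^ 'n ^ 'n) set" where
  "Aut_h k = {A. invertible A \<and> (\<forall>t::real ^ 'n. cubic k (A *v t) = cubic k t)}"

definition Aut_H_group :: "(real ^ 'n::finite) set \<Rightarrow> (real ^ 'n ^ 'n) monoid" where
  "Aut_H_group M = \<lparr>carrier = Aut_H M, mult = (**), one = mat 1\<rparr>"


section \<open>The tree-level q-map space\<close>

text \<open>Points (and tangent vectors) are tuples \<open>(z, \<rho>, \<zeta>', \<zeta>, \<sigma>)\<close> of type IIA coordinates, where
  \<open>\<zeta>'\<close> stands for \<open>\<zeta>\<close> with a tilde. Indices running from \<open>0\<close> to \<open>n\<close> have type \<open>'n option\<close>, with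
  \<open>None\<close> in the role of \<open>0\<close>.\<close>

type_synonym 'n iia =
  "(complex ^ 'n) \<times> real \<times> (real ^ ('n option)) \<times> (real ^ ('n option)) \<times> real"

definition re_vec :: "complex ^ 'n \<Rightarrow> real ^ 'n::finite" where
  "re_vec z = (\<chi> a. Re (z$a))"

definition im_vec :: "complex ^ 'n \<Rightarrow> real ^ 'n::finite" where
  "im_vec z = (\<chi> a. Im (z$a))"

definition ext :: "'a \<Rightarrow> 'a ^ 'n \<Rightarrow> 'a ^ ('n::finite option)" where
  "ext x0 x = (\<chi> i. case i of None \<Rightarrow> x0 | Some a \<Rightarrow> x$a)"

definition low :: "'a ^ ('n::finite option) \<Rightarrow> 'a ^ 'n" where
  "low x = (\<chi> a. x $ Some a)"

definition cone :: "(real ^ 'n::finite) set \<Rightarrow> (real ^ 'n) set" where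
  "cone M = {r *\<^sub>R t | r t. 0 < r \<and> t \<in> M}"

definition M_bar :: "(real ^ 'n::finite) set \<Rightarrow> (complex ^ 'n) set" where
  "M_bar M = {z. im_vec z \<in> cone M}"

definition N_bar :: "(real ^ 'n::finite) set \<Rightarrow> 'n iia set" where
  "N_bar M = M_bar M \<times> {0<..} \<times> UNIV \<times> UNIV \<times> UNIV"

definition prepotential ::
  "('n::finite \<Rightarrow> 'n \<Rightarrow> 'n \<Rightarrow> real) \<Rightarrow> complex ^ ('n option) \<Rightarrow> complex" where
  "prepotential k X = - cubic k (low X) / X $ None"

definition tau ::
  "('n::finite \<Rightarrow> 'n \<Rightarrow> 'n \<Rightarrow> real) \<Rightarrow> complex ^ 'n \<Rightarrow> complex ^ ('n option) ^ ('n option)" where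
  "tau k z = (\<chi> i j. partial i (partial j (prepotential k)) (ext 1 z))"

definition N_mat ::
  "('n::finite \<Rightarrow> 'n \<Rightarrow> 'n \<Rightarrow> real) \<Rightarrow> complex ^ 'n \<Rightarrow> real ^ ('n option) ^ ('n option)" where
  "N_mat k z = (\<chi> i j. - 2 * Im (tau k z $ i $ j))"

definition metric_M ::
  "('n::finite \<Rightarrow> 'n \<Rightarrow> 'n \<Rightarrow> real) \<Rightarrow> complex ^ 'n \<Rightarrow> complex ^ 'n \<Rightarrow> complex ^ 'n \<Rightarrow> real" where
  "metric_M k z v w = - (1/4) * (\<Sum>a\<in>UNIV. \<Sum>b\<in>UNIV.
     partial a (partial b (\<lambda>t. ln (cubic k t))) (im_vec z) *
     (Re (v$a) * Re (w$b) + Im (v$a) * Im (w$b)))"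

text \<open>The \<open>i\<close>-th one-form \<open>W\<close>, evaluated on a tangent vector with \<open>\<zeta>'\<close>- and \<open>\<zeta>\<close>-components
  \<open>d\<zeta>'\<close> and \<open>d\<zeta>\<close>.\<close>

definition W_form :: "('n::finite \<Rightarrow> 'n \<Rightarrow> 'n \<Rightarrow> real) \<Rightarrow> complex ^ 'n \<Rightarrow>
    real ^ ('n option) \<Rightarrow> real ^ ('n option) \<Rightarrow> 'n option \<Rightarrow> complex" where
  "W_form k z d\<zeta>' d\<zeta> i = of_real (d\<zeta>'$i) - (\<Sum>j\<in>UNIV. tau k z $ i $ j * of_real (d\<zeta>$j))"

text \<open>The metric is given as a bilinear form. The coefficient matrix of the \<open>W\<close>-term is Hermitian,
  so the symmetric product of the one-forms there amounts to taking the real part.\<close>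

fun q_metric :: "('n::finite \<Rightarrow> 'n \<Rightarrow> 'n \<Rightarrow> real) \<Rightarrow> 'n iia \<Rightarrow> 'n iia \<Rightarrow> 'n iia \<Rightarrow> real" where
  "q_metric k (z, \<rho>, \<zeta>', \<zeta>, \<sigma>) (v, v\<rho>, v\<zeta>', v\<zeta>, v\<sigma>) (w, w\<rho>, w\<zeta>', w\<zeta>, w\<sigma>) =
     metric_M k z v w
     + v\<rho> * w\<rho> / (4 * \<rho>\<^sup>2)
     - 1 / (4 * \<rho>) * Re (\<Sum>i\<in>UNIV. \<Sum>j\<in>UNIV.
         (of_real (matrix_inv (N_mat k z) $ i $ j)
            - of_real (2 / (8 * cubic k (im_vec z))) * ext 1 z $ i * cnj (ext 1 z $ j))
         * W_form k z v\<zeta>' v\<zeta> i * cnj (W_form k z w\<zeta>' w\<zeta> j))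
     + 1 / (64 * \<rho>\<^sup>2)
         * (v\<sigma> + (\<Sum>i\<in>UNIV. \<zeta>'$i * v\<zeta>$i - \<zeta>$i * v\<zeta>'$i))
         * (w\<sigma> + (\<Sum>i\<in>UNIV. \<zeta>'$i * w\<zeta>$i - \<zeta>$i * w\<zeta>'$i))"


section \<open>Isometries, and the action of the automorphism group\<close>

definition isometries ::
  "'e::real_normed_vector set \<Rightarrow> ('e \<Rightarrow> 'e \<Rightarrow> 'e \<Rightarrow> real) \<Rightarrow> ('e \<Rightarrow> 'e) set" where
  "isometries S g = {f \<in> Bij S. smooth_on f S \<and> smooth_on (inv_into S f) S \<and>
     (\<forall>p\<in>S. \<forall>v w. g (f p) (frechet_derivative f (at p) v) (frechet_derivative f (at p) w) = g p v w)}"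

definition Iso_group ::
  "'e::real_normed_vector set \<Rightarrow> ('e \<Rightarrow> 'e \<Rightarrow> 'e \<Rightarrow> real) \<Rightarrow> ('e \<Rightarrow> 'e) monoid" where
  "Iso_group S g = BijGroup S \<lparr>carrier := isometries S g\<rparr>"

definition q_iso :: "('n::finite \<Rightarrow> 'n \<Rightarrow> 'n \<Rightarrow> real) \<Rightarrow> (real ^ 'n) set \<Rightarrow> ('n iia \<Rightarrow> 'n iia) monoid" where
  "q_iso k M = Iso_group (N_bar M) (q_metric k)"

definition Aut_act :: "(real ^ 'n::finite) set \<Rightarrow> real ^ 'n ^ 'n \<Rightarrow> 'n iia \<Rightarrow> 'n iia" where
  "Aut_act M A = (\<lambda>(z, \<rho>, \<zeta>', \<zeta>, \<sigma>)\<in>N_bar M.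
     ((\<chi> a. \<Sum>b\<in>UNIV. of_real (A$a$b) * z$b), \<rho>,
      ext (\<zeta>' $ None) (matrix_inv (transpose A) *v low \<zeta>'),
      ext (\<zeta> $ None) (A *v low \<zeta>), \<sigma>))"


section \<open>S-duality\<close>

text \<open>Points in type IIB coordinates are tuples \<open>(b + i t, \<tau>, c, c', c0, \<psi>)\<close>, where \<open>c\<close> has
  components with upper and \<open>c'\<close> with lower indices.\<close>

type_synonym 'n iib =
  "(complex ^ 'n) \<times> complex \<times> (real ^ 'n) \<times> (real ^ 'n) \<times> real \<times> real"

definition N_iib :: "(real ^ 'n::finite) set \<Rightarrow> 'n iib set" where
  "N_iib M = M_bar M \<times> {\<tau>. 0 < Im \<tau>} \<times> UNIV \<times> UNIV \<times> UNIV \<times> UNIV"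

fun iib_to_iia :: "('n::finite \<Rightarrow> 'n \<Rightarrow> 'n \<Rightarrow> real) \<Rightarrow> 'n iib \<Rightarrow> 'n iia" where
  "iib_to_iia k (z, \<tau>, c, c', c0, \<psi>) =
     (let b = re_vec z; e = c - Re \<tau> *\<^sub>R b in
       (z,
        (Im \<tau>)\<^sup>2 / 2 * cubic k (im_vec z),
        ext (c0 - (\<Sum>a\<in>UNIV. \<Sum>b'\<in>UNIV. \<Sum>d\<in>UNIV. k a b' d / 6 * b$a * b$b' * e$d))
            (\<chi> a. c'$a + (\<Sum>b'\<in>UNIV. \<Sum>d\<in>UNIV. k a b' d / 2 * b$b' * e$d)),
        ext (Re \<tau>) (- e),
        - 2 * (\<psi> + 1/2 * Re \<tau> * c0) + (\<Sum>a\<in>UNIV. c'$a * e$a)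
          - (\<Sum>a\<in>UNIV. \<Sum>b'\<in>UNIV. \<Sum>d\<in>UNIV. k a b' d / 6 * b$a * c$b' * e$d)))"

fun sl2_act_iib :: "real ^ 2 ^ 2 \<Rightarrow> 'n::finite iib \<Rightarrow> 'n iib" where
  "sl2_act_iib m (z, \<tau>, c, c', c0, \<psi>) =
     (let j = of_real (m$2$1) * \<tau> + of_real (m$2$2) in
       ((\<chi> a. Complex (m$2$1 * c$a + m$2$2 * Re (z$a)) (cmod j * Im (z$a))),
        (of_real (m$1$1) * \<tau> + of_real (m$1$2)) / j,
        (\<chi> a. m$1$1 * c$a + m$1$2 * Re (z$a)),
        c',
        m$2$2 * c0 - m$2$1 * \<psi>,
        - m$1$2 * c0 + m$1$1 * \<psi>))"

definition s_duality :: "('n::finite \<Rightarrow> 'n \<Rightarrow> 'n \<Rightarrow> real) \<Rightarrow> (real ^ 'n) set \<Rightarrow>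
    real ^ 2 ^ 2 \<Rightarrow> 'n iia \<Rightarrow> 'n iia" where
  "s_duality k M m p = iib_to_iia k (sl2_act_iib m (the_inv_into (N_iib M) (iib_to_iia k) p))"

text \<open>The one-parameter subgroups of \<open>SL(2,\<real>)\<close> generated by the three standard basis matrices
  of its Lie algebra, i.e. their matrix exponentials.\<close>

definition exp_e :: "real \<Rightarrow> real ^ 2 ^ 2" where
  "exp_e s = vector [vector [1, s], vector [0, 1]]"

definition exp_f :: "real \<Rightarrow> real ^ 2 ^ 2" where
  "exp_f s = vector [vector [1, 0], vector [s, 1]]"

definition exp_h :: "real \<Rightarrow> real ^ 2 ^ 2" where
  "exp_h s = vector [vector [exp s, 0], vector [0, exp (- s)]]"

definition s_fundamental :: "('n::finite \<Rightarrow> 'n \<Rightarrow> 'n \<Rightarrow> real) \<Rightarrow> (real ^ 'n) set \<Rightarrow>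
    (real \<Rightarrow> real ^ 2 ^ 2) \<Rightarrow> 'n iia \<Rightarrow> 'n iia" where
  "s_fundamental k M \<gamma> p = vector_derivative (\<lambda>s. s_duality k M (\<gamma> s) p) (at 0)"


section \<open>The group generated by the L-action and S-duality\<close>

fun field_D :: "'n::finite iia \<Rightarrow> 'n iia" where
  "field_D (z, \<rho>, \<zeta>', \<zeta>, \<sigma>) = (0, \<rho>, (1/2) *\<^sub>R \<zeta>', (1/2) *\<^sub>R \<zeta>, \<sigma>)"

fun field_P :: "'n option \<Rightarrow> 'n::finite iia \<Rightarrow> 'n iia" where
  "field_P i (z, \<rho>, \<zeta>', \<zeta>, \<sigma>) = (0, 0, 0, axis i 1, \<zeta>'$i)"

fun field_X :: "'n option \<Rightarrow> 'n::finite iia \<Rightarrow> 'n iia" where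
  "field_X i (z, \<rho>, \<zeta>', \<zeta>, \<sigma>) = (0, 0, axis i 1, 0, - \<zeta>$i)"

fun field_Z :: "'n::finite iia \<Rightarrow> 'n iia" where
  "field_Z (z, \<rho>, \<zeta>', \<zeta>, \<sigma>) = (0, 0, 0, 0, 1)"

fun field_V :: "('n::finite \<Rightarrow> 'n \<Rightarrow> 'n \<Rightarrow> real) \<Rightarrow> 'n \<Rightarrow> 'n iia \<Rightarrow> 'n iia" where
  "field_V k a (z, \<rho>, \<zeta>', \<zeta>, \<sigma>) =
     (axis a 1, 0,
      ext (- \<zeta>' $ Some a) (\<chi> b. - (\<Sum>c\<in>UNIV. k a b c * \<zeta> $ Some c)),
      ext 0 (axis a (\<zeta> $ None)), 0)"

text \<open>Vector fields on an open set \<open>S\<close> are extended by zero, so that equality of functions is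
  equality of vector fields.\<close>

definition field_on :: "'e set \<Rightarrow> ('e \<Rightarrow> 'e::zero) \<Rightarrow> 'e \<Rightarrow> 'e" where
  "field_on S X = (\<lambda>p. if p \<in> S then X p else 0)"

definition lie_bracket ::
  "'e::real_normed_vector set \<Rightarrow> ('e \<Rightarrow> 'e) \<Rightarrow> ('e \<Rightarrow> 'e) \<Rightarrow> 'e \<Rightarrow> 'e" where
  "lie_bracket S X Y = field_on S
     (\<lambda>p. frechet_derivative Y (at p) (X p) - frechet_derivative X (at p) (Y p))"

definition is_flow :: "'e::real_normed_vector set \<Rightarrow> ('e \<Rightarrow> 'e) \<Rightarrow> (real \<Rightarrow> 'e \<Rightarrow> 'e) \<Rightarrow> bool" where
  "is_flow S X \<Phi> \<longleftrightarrow> (\<forall>p\<in>S. \<Phi> 0 p = p \<and>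
     (\<forall>s. \<Phi> s p \<in> S \<and> ((\<lambda>r. \<Phi> r p) has_vector_derivative X (\<Phi> s p)) (at s)))"

definition complete_field :: "'e::real_normed_vector set \<Rightarrow> ('e \<Rightarrow> 'e) \<Rightarrow> bool" where
  "complete_field S X \<longleftrightarrow> (\<exists>\<Phi>. is_flow S X \<Phi>)"

definition G_fields ::
  "('n::finite \<Rightarrow> 'n \<Rightarrow> 'n \<Rightarrow> real) \<Rightarrow> (real ^ 'n) set \<Rightarrow> ('n iia \<Rightarrow> 'n iia) set" where
  "G_fields k M = field_on (N_bar M) `
     ({field_D, field_Z} \<union> range field_P \<union> range field_X \<union> range (field_V k) \<union>
      {s_fundamental k M exp_e, s_fundamental k M exp_f, s_fundamental k M exp_h})"

definition scale_field :: "real \<Rightarrow> ('e \<Rightarrow> 'e::real_vector) \<Rightarrow> 'e \<Rightarrow> 'e" where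
  "scale_field r X = (\<lambda>p. r *\<^sub>R X p)"

definition G_lie_algebra ::
  "('n::finite \<Rightarrow> 'n \<Rightarrow> 'n \<Rightarrow> real) \<Rightarrow> (real ^ 'n) set \<Rightarrow> ('n iia \<Rightarrow> 'n iia) set" where
  "G_lie_algebra k M = module.span scale_field (G_fields k M)"

text \<open>The connected Lie group with a given finite-dimensional Lie algebra of vector fields is the
  group generated by the flows of any set of complete vector fields spanning that Lie algebra.
  A field without a global flow would contribute nothing here.\<close>

definition G_set ::
  "('n::finite \<Rightarrow> 'n \<Rightarrow> 'n \<Rightarrow> real) \<Rightarrow> (real ^ 'n) set \<Rightarrow> ('n iia \<Rightarrow> 'n iia) set" where
  "G_set k M = generate (BijGroup (N_bar M))
     {restrict (\<Phi> s) (N_bar M) | \<Phi> s. \<exists>X\<in>G_fields k M. is_flow (N_bar M) X \<Phi>}"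

definition G_group ::
  "('n::finite \<Rightarrow> 'n \<Rightarrow> 'n \<Rightarrow> real) \<Rightarrow> (real ^ 'n) set \<Rightarrow> ('n iia \<Rightarrow> 'n iia) monoid" where
  "G_group k M = q_iso k M \<lparr>carrier := G_set k M\<rparr>"


section \<open>Semi-direct products\<close>

definition semidirect :: "('a, 'c) monoid_scheme \<Rightarrow> ('b, 'd) monoid_scheme \<Rightarrow> ('a \<Rightarrow> 'b \<Rightarrow> 'b) \<Rightarrow>
    ('a \<times> 'b) monoid" where
  "semidirect K G \<alpha> =
     \<lparr>carrier = carrier K \<times> carrier G,
      mult = (\<lambda>(a, g) (b, h). (a \<otimes>\<^bsub>K\<^esub> b, g \<otimes>\<^bsub>G\<^esub> \<alpha> a h)),
      one = (\<one>\<^bsub>K\<^esub>, \<one>\<^bsub>G\<^esub>)\<rparr>"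

definition conj_act :: "('n::finite \<Rightarrow> 'n \<Rightarrow> 'n \<Rightarrow> real) \<Rightarrow> (real ^ 'n) set \<Rightarrow> real ^ 'n ^ 'n \<Rightarrow>
    ('n iia \<Rightarrow> 'n iia) \<Rightarrow> ('n iia \<Rightarrow> 'n iia)" where
  "conj_act k M A = (\<lambda>g\<in>G_set k M.
     Aut_act M A \<otimes>\<^bsub>q_iso k M\<^esub> g \<otimes>\<^bsub>q_iso k M\<^esub> inv\<^bsub>q_iso k M\<^esub> (Aut_act M A))"

end

theory Submission
  imports Defs
begin

text \<open>
  In the real coordinates \<open>b\<close>, \<open>t\<close>, \<open>\<rho>\<close>, \<open>\<zeta>'\<close>, \<open>\<zeta>\<close>, \<open>\<sigma>\<close> the matrix \<open>N\<close> is block diagonal up to a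
  shift by \<open>b\<close>, so the metric becomes an explicit expression in the symmetric trilinear form of \<open>h\<close>,
  the inverse of the Hessian of \<open>h\<close> at \<open>t\<close> (which is nondegenerate since \<open>H\<close> is a level set of \<open>h\<close>
  transverse to the radial direction), and a few one-forms. All isometries are then read off from
  the way these one-forms transform: they are invariant under the shifts, covariant under \<open>Aut(H)\<close>,
  and combine to doublets of \<open>SL(2)\<close> in type IIB coordinates.

  The flows of the generating fields are explicit, and integral curves are unique, so \<open>G\<close> is
  generated by explicit isometries. Conjugation by an automorphism maps each of them to a product of
  others. Finally, every element of \<open>G\<close> moves \<open>t\<close> within its ray while automorphisms preserve
  \<open>h(t)\<close>, so \<open>G\<close> contains no automorphism other than the identity.
\<close>

section \<open>Calculus of smooth maps\<close>

text \<open>\<open>H\<close> may be just an open piece of its level set, so at the start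
  \<open>h\<close> is controlled on \<open>H\<close> alone. Transversality of the radial direction
  is forced by comparing the growth of \<open>h\<close> like \<open>(1 + s)^3\<close> along rays
  with its value \<open>1\<close> on \<open>H\<close>. It makes the cone open, and openness turns
  facts about \<open>H\<close> into polynomial identities: an automorphism preserves the whole cubic
  and hence its polarization \<open>k3\<close>. The number \<open>3n + 6\<close> arises as follows:
  \<open>D\<close>, \<open>Z\<close>, \<open>X_h\<close> and \<open>X_f\<close> contribute 4, the
  \<open>V_a\<close> contribute \<open>n\<close>, the \<open>P_i\<close> and \<open>X^i\<close>
  contribute \<open>n + 1\<close> each, while \<open>X_e\<close> is \<open>P_0\<close> once more.
  All these fields except \<open>X_f\<close> are affine in type IIA coordinates, so closure under
  brackets is linear algebra apart from the brackets with \<open>X_f\<close>. \<open>G\<close> is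
  defined through every global flow of the fields and not through chosen formulas; this is why
  uniqueness of integral curves enters. Its generators translate along coordinate axes only, whereas
  conjugation by an automorphism turns an axis into an arbitrary vector, so images of generators are
  products of several generators.\<close>

lemma frechet_eqI: "(f has_derivative f') (at x) \<Longrightarrow> frechet_derivative f (at x) = f'"
  by (metis frechet_derivative_at)

lemma frechet_works: "f differentiable (at x) \<Longrightarrow> (f has_derivative frechet_derivative f (at x)) (at x)"
  by (simp add: frechet_derivative_works)

lemma has_derivative_cong_open:
  assumes "open S" "x \<in> S" "\<And>y. y \<in> S \<Longrightarrow> f y = g y" "(f has_derivative f') (at x)"
  shows "(g has_derivative f') (at x)"
  using assms has_derivative_transform_within_open by blast

text \<open>Derivatives depend on the germ only, so agreement on an open set passes to derivatives
  of every order.\<close>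

lemma Ck_on_cong:
  assumes "open S" "\<And>x. x \<in> S \<Longrightarrow> f x = g x" "Ck_on m f S"
  shows "Ck_on m g S"
  using assms(2,3)
proof (induction m arbitrary: f g)
  case 0
  then show ?case using continuous_on_cong[of S S f g] by auto
next
  case (Suc m)
  have d: "(g has_derivative frechet_derivative f (at x)) (at x)" if "x \<in> S" for x
    by (rule has_derivative_cong_open[OF assms(1) that Suc.prems(1) frechet_works]) (use Suc.prems that in auto)
  have "Ck_on m (\<lambda>x. frechet_derivative g (at x) v) S" for v
    by (rule Suc.IH[of "\<lambda>x. frechet_derivative f (at x) v"])
      (use Suc.prems(2) frechet_eqI[OF d] in simp_all)
  then show ?case using d by (auto simp: differentiable_def)
qed

text \<open>\<open>frechet_derivative\<close> is defined by choice, while the derivative rules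
  produce explicit terms; on an open set any explicitly known derivative may take its place.\<close>

lemma Ck_on_SucI:
  assumes "open S" "\<And>x. x \<in> S \<Longrightarrow> (f has_derivative f' x) (at x)"
    and "\<And>v. Ck_on m (\<lambda>x. f' x v) S"
  shows "Ck_on (Suc m) f S"
proof -
  have "Ck_on m (\<lambda>x. frechet_derivative f (at x) v) S" for v
    by (rule Ck_on_cong[OF assms(1) _ assms(3)[of v]]) (simp add: frechet_eqI[OF assms(2)])
  then show ?thesis using assms(2) by (auto simp: differentiable_def)
qed

lemma Ck_on_SucD: "Ck_on (Suc m) f S \<Longrightarrow> Ck_on m f S"
proof (induction m arbitrary: f)
  case 0
  then show ?case
    by (auto intro!: continuous_at_imp_continuous_on differentiable_imp_continuous_within)
next
  case (Suc m)
  then show ?case by (metis Ck_on.simps(2))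
qed

lemma Ck_on_const: "open S \<Longrightarrow> Ck_on m (\<lambda>x. c) S"
proof (induction m arbitrary: c)
  case 0
  then show ?case by simp
next
  case (Suc m)
  then show ?case by (intro Ck_on_SucI[where f' = "\<lambda>x v. 0"]) auto
qed

lemma Ck_on_bounded_linear:
  assumes "open S" "bounded_linear f"
  shows "Ck_on m f S"
proof (cases m)
  case 0
  then show ?thesis using assms by (simp add: linear_continuous_on)
next
  case (Suc j)
  show ?thesis unfolding Suc
    by (rule Ck_on_SucI[OF assms(1) bounded_linear_imp_has_derivative[OF assms(2)]]) (simp add: assms Ck_on_const)
qed

lemma Ck_on_add: "open S \<Longrightarrow> Ck_on m f S \<Longrightarrow> Ck_on m g S \<Longrightarrow> Ck_on m (\<lambda>x. f x + g x) S"
proof (induction m arbitrary: f g)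
  case 0
  then show ?case by (simp add: continuous_on_add)
next
  case (Suc m)
  then show ?case
    by (intro Ck_on_SucI[where f' = "\<lambda>x v. frechet_derivative f (at x) v + frechet_derivative g (at x) v"]
        has_derivative_add) (auto intro!: frechet_works)
qed

text \<open>By the product rule a directional derivative of \<open>B (f x) (g x)\<close> is a sum of
  two expressions of the same shape, so the induction on the order closes once \<open>f\<close> and
  \<open>g\<close> are generalized. Multiplication, scaling, inner products and \<open>k2\<close>
  are all instances.\<close>

lemma Ck_on_bilinear:
  assumes "bounded_bilinear B" "open S"
  shows "Ck_on m f S \<Longrightarrow> Ck_on m g S \<Longrightarrow> Ck_on m (\<lambda>x. B (f x) (g x)) S"
proof (induction m arbitrary: f g)
  case 0
  then show ?case by (simp add: bounded_bilinear.continuous_on[OF assms(1)])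
next
  case (Suc m)
  show ?case
  proof (intro Ck_on_SucI[OF assms(2)])
    show "((\<lambda>x. B (f x) (g x)) has_derivative
      (\<lambda>v. B (f x) (frechet_derivative g (at x) v) + B (frechet_derivative f (at x) v) (g x))) (at x)"
      if "x \<in> S" for x
      using Suc.prems that by (intro bounded_bilinear.FDERIV[OF assms(1)]) (auto intro!: frechet_works)
    show "Ck_on m (\<lambda>x. B (f x) (frechet_derivative g (at x) v) + B (frechet_derivative f (at x) v) (g x)) S" for v
      using Suc.prems Ck_on_SucD[OF Suc.prems(1)] Ck_on_SucD[OF Suc.prems(2)]
      by (intro Ck_on_add[OF assms(2)] Suc.IH) auto
  qed
qed

lemma Ck_on_sum:
  assumes "open S" "finite I" "\<And>i. i \<in> I \<Longrightarrow> Ck_on m (f i) S"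
  shows "Ck_on m (\<lambda>x. \<Sum>i\<in>I. f i x) S"
  using assms(2,3) by (induction I) (auto intro: Ck_on_const Ck_on_add assms(1))

text \<open>In the chain rule the direction in which \<open>g\<close> is differentiated varies with
  \<open>x\<close>, whereas \<open>Ck_on\<close> speaks of fixed directions. Expansion in a basis of
  the intermediate Euclidean space leaves finitely many fixed directions with coefficient functions,
  to which the product rule and the induction hypothesis for the derivatives of \<open>g\<close>
  apply.\<close>

lemma Ck_on_compose:
  fixes f :: "'a::real_normed_vector \<Rightarrow> 'b::euclidean_space" and g :: "'b \<Rightarrow> 'c::real_normed_vector"
  assumes "open S" "open T" "f ` S \<subseteq> T"
  shows "Ck_on m f S \<Longrightarrow> Ck_on m g T \<Longrightarrow> Ck_on m (\<lambda>x. g (f x)) S"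
proof (induction m arbitrary: g)
  case 0
  then show ?case using assms continuous_on_compose2 by (simp, blast)
next
  case (Suc m)
  let ?f' = "\<lambda>x. frechet_derivative f (at x)" and ?g' = "\<lambda>y. frechet_derivative g (at y)"
  have der: "((\<lambda>x. g (f x)) has_derivative (\<lambda>v. ?g' (f x) (?f' x v))) (at x)" if "x \<in> S" for x
    using Suc.prems that assms(3)
    by (intro has_derivative_compose[where g = g and f = f]) (auto intro!: frechet_works)
  have expand: "?g' (f x) (?f' x v) = (\<Sum>b\<in>Basis. (?f' x v \<bullet> b) *\<^sub>R ?g' (f x) b)" if "x \<in> S" for x v
  proof -
    have "linear (?g' (f x))"
      using Suc.prems that assms(3) by (auto intro!: linear_frechet_derivative)
    then have "?g' (f x) (\<Sum>b\<in>Basis. (?f' x v \<bullet> b) *\<^sub>R b) = (\<Sum>b\<in>Basis. (?f' x v \<bullet> b) *\<^sub>R ?g' (f x) b)"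
      by (simp add: linear_sum linear_scale)
    then show ?thesis by (simp add: euclidean_representation)
  qed
  have "Ck_on m (\<lambda>x. \<Sum>b\<in>Basis. (?f' x v \<bullet> b) *\<^sub>R ?g' (f x) b) S" for v
    using Suc.prems Ck_on_SucD[OF Suc.prems(1)] assms(1)
    by (intro Ck_on_sum Ck_on_bilinear[OF bounded_bilinear_scaleR] Suc.IH
        Ck_on_bilinear[OF bounded_bilinear_inner] Ck_on_const) auto
  then have "Ck_on m (\<lambda>x. ?g' (f x) (?f' x v)) S" for v
    using expand by (intro Ck_on_cong[OF assms(1) expand[symmetric]]) auto
  then show ?case by (intro Ck_on_SucI[OF assms(1) der]) auto
qed

text \<open>Real powers are closed under differentiation up to a constant factor, hence the
  induction over all exponents. Square roots, quotients and the cube root that normalizes vectors to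
  \<open>H\<close> are derived from this.\<close>

lemma Ck_on_powr: "Ck_on m (\<lambda>x::real. x powr a) {0<..}"
proof (induction m arbitrary: a)
  case 0
  then show ?case by (auto intro!: continuous_intros)
next
  case (Suc m)
  show ?case
  proof (rule Ck_on_SucI)
    show "((\<lambda>x. x powr a) has_derivative (\<lambda>v. v * (a * x powr (a - 1)))) (at x)"
      if "x \<in> {0<..}" for x :: real
      using that by (auto intro!: derivative_eq_intros simp: powr_diff field_simps)
    show "Ck_on m (\<lambda>x. v * (a * x powr (a - 1))) {0<..}" for v
      using Suc by (intro Ck_on_bilinear[OF bounded_bilinear_mult] Ck_on_const) auto
  qed auto
qed

section \<open>Smoothness rules for the operations in the coordinate formulas\<close>

named_theorems smooth_intros

lemma smooth_on_cong: "open S \<Longrightarrow> (\<And>x. x \<in> S \<Longrightarrow> f x = g x) \<Longrightarrow> smooth_on f S \<Longrightarrow> smooth_on g S"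
  unfolding smooth_on_def using Ck_on_cong by blast

lemma smooth_on_const [smooth_intros]: "open S \<Longrightarrow> smooth_on (\<lambda>x. c) S"
  by (simp add: smooth_on_def Ck_on_const)

lemma smooth_on_bounded_linear: "open S \<Longrightarrow> bounded_linear f \<Longrightarrow> smooth_on f S"
  by (simp add: smooth_on_def Ck_on_bounded_linear)

lemma smooth_on_id [smooth_intros]: "open S \<Longrightarrow> smooth_on (\<lambda>x. x) S"
  by (simp add: smooth_on_bounded_linear bounded_linear_ident)

lemma smooth_on_add [smooth_intros]:
  "open S \<Longrightarrow> smooth_on f S \<Longrightarrow> smooth_on g S \<Longrightarrow> smooth_on (\<lambda>x. f x + g x) S"
  by (simp add: smooth_on_def Ck_on_add)

lemma smooth_on_bilinear:
  "bounded_bilinear B \<Longrightarrow> open S \<Longrightarrow> smooth_on f S \<Longrightarrow> smooth_on g S \<Longrightarrow> smooth_on (\<lambda>x. B (f x) (g x)) S"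
  by (simp add: smooth_on_def Ck_on_bilinear)

lemmas smooth_on_mult [smooth_intros] = smooth_on_bilinear[OF bounded_bilinear_mult]
lemmas smooth_on_scaleR [smooth_intros] = smooth_on_bilinear[OF bounded_bilinear_scaleR]
lemmas smooth_on_inner [smooth_intros] = smooth_on_bilinear[OF bounded_bilinear_inner]

lemma smooth_on_compose:
  fixes f :: "'a::real_normed_vector \<Rightarrow> 'b::euclidean_space"
  shows "open S \<Longrightarrow> open T \<Longrightarrow> f ` S \<subseteq> T \<Longrightarrow> smooth_on f S \<Longrightarrow> smooth_on g T \<Longrightarrow> smooth_on (\<lambda>x. g (f x)) S"
  unfolding smooth_on_def using Ck_on_compose by blast

lemma Ck_on_linear_compose:
  assumes "bounded_linear L" "open S"
  shows "Ck_on m f S \<Longrightarrow> Ck_on m (\<lambda>x. L (f x)) S"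
proof (induction m arbitrary: f)
  case 0
  then show ?case using bounded_linear.continuous_on[OF assms(1)] by simp
next
  case (Suc m)
  then show ?case
    by (intro Ck_on_SucI[OF assms(2), where f' = "\<lambda>x v. L (frechet_derivative f (at x) v)"]
        bounded_linear.has_derivative[OF assms(1)]) (auto intro!: frechet_works)
qed

lemma smooth_on_linear_compose:
  "bounded_linear L \<Longrightarrow> open S \<Longrightarrow> smooth_on f S \<Longrightarrow> smooth_on (\<lambda>x. L (f x)) S"
  by (simp add: smooth_on_def Ck_on_linear_compose)

lemmas smooth_on_fst [smooth_intros] = smooth_on_linear_compose[OF bounded_linear_fst]
lemmas smooth_on_snd [smooth_intros] = smooth_on_linear_compose[OF bounded_linear_snd]
lemmas smooth_on_Re [smooth_intros] = smooth_on_linear_compose[OF bounded_linear_Re]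
lemmas smooth_on_Im [smooth_intros] = smooth_on_linear_compose[OF bounded_linear_Im]
lemmas smooth_on_minus [smooth_intros] = smooth_on_linear_compose[OF bounded_linear_minus[OF bounded_linear_ident]]
lemmas smooth_on_matrix_vector_mult [smooth_intros] =
  smooth_on_linear_compose[OF matrix_vector_mul_bounded_linear]

lemma smooth_on_diff [smooth_intros]:
  "open S \<Longrightarrow> smooth_on f S \<Longrightarrow> smooth_on g S \<Longrightarrow> smooth_on (\<lambda>x. f x - g x) S"
  using smooth_on_add[OF _ _ smooth_on_minus, of S f g] by simp

lemma smooth_on_Pair [smooth_intros]:
  assumes "open S" "smooth_on f S" "smooth_on g S"
  shows "smooth_on (\<lambda>x. (f x, g x)) S"
proof -
  have "smooth_on (\<lambda>x. (f x, 0) + (0, g x)) S"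
    using smooth_on_linear_compose[OF bounded_linear_Pair[OF bounded_linear_ident bounded_linear_zero] assms(1,2)]
      smooth_on_linear_compose[OF bounded_linear_Pair[OF bounded_linear_zero bounded_linear_ident] assms(1,3)]
      assms(1) by (intro smooth_on_add)
  then show ?thesis by simp
qed

lemma smooth_on_powr [smooth_intros]:
  "open S \<Longrightarrow> smooth_on f S \<Longrightarrow> (\<And>x. x \<in> S \<Longrightarrow> 0 < f x) \<Longrightarrow> smooth_on (\<lambda>x. (f x :: real) powr a) S"
  by (rule smooth_on_compose[where T = "{0<..}" and g = "\<lambda>x. x powr a"])
    (auto simp: smooth_on_def Ck_on_powr)

lemma smooth_on_sqrt [smooth_intros]:
  assumes "open S" "smooth_on f S" "\<And>x. x \<in> S \<Longrightarrow> 0 < f x" shows "smooth_on (\<lambda>x. sqrt (f x)) S"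
  by (rule smooth_on_cong[OF assms(1) _ smooth_on_powr[OF assms, of "1/2"]])
    (auto simp: powr_half_sqrt less_imp_le assms(3))

lemma smooth_on_divide [smooth_intros]:
  assumes "open S" "smooth_on f S" "smooth_on g S" "\<And>x. x \<in> S \<Longrightarrow> 0 < g x"
  shows "smooth_on (\<lambda>x. f x / (g x :: real)) S"
  by (rule smooth_on_cong[OF assms(1) _ smooth_on_mult[OF assms(1,2) smooth_on_powr[OF assms(1,3,4), of "-1"]]])
    (auto simp: powr_minus divide_inverse assms(4) less_imp_le)

lemma smooth_on_imp_differentiable: "smooth_on f S \<Longrightarrow> x \<in> S \<Longrightarrow> f differentiable (at x)"
  unfolding smooth_on_def by (metis Ck_on.simps(2))

section \<open>Isometry groups and integral curves\<close>

text \<open>\<open>Bij\<close> consists of extensional maps, and both \<open>inv_into\<close> and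
  \<open>frechet_derivative\<close> in \<open>isometries\<close> are choices. Explicit
  \<open>f'\<close> and \<open>D\<close> for a total map \<open>f\<close> agree with them on the
  open set \<open>S\<close>, so only formulas have to be checked.\<close>

lemma restrict_in_isometries:
  fixes S :: "'e::real_normed_vector set"
  assumes S: "open S"
    and f: "\<And>p. p \<in> S \<Longrightarrow> f p \<in> S" "\<And>p. p \<in> S \<Longrightarrow> f' (f p) = p" "smooth_on f S"
    and f': "\<And>p. p \<in> S \<Longrightarrow> f' p \<in> S" "\<And>p. p \<in> S \<Longrightarrow> f (f' p) = p" "smooth_on f' S"
    and D: "\<And>p. p \<in> S \<Longrightarrow> (f has_derivative D p) (at p)"
    and g: "\<And>p v w. p \<in> S \<Longrightarrow> g (f p) (D p v) (D p w) = g p v w"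
  shows "restrict f S \<in> isometries S g"
proof -
  have bij: "bij_betw f S S"
    by (rule bij_betw_byWitness[where f' = f']) (use f f' in auto)
  then have Bij: "restrict f S \<in> Bij S"
    by (simp add: Bij_def bij_betw_restrict_eq)
  have inv: "inv_into S (restrict f S) p = f' p" if "p \<in> S" for p
    using that f f' Bij unfolding Bij_def bij_betw_def by (intro inv_into_f_eq) auto
  have D': "(restrict f S has_derivative D p) (at p)" if "p \<in> S" for p
    using that by (intro has_derivative_cong_open[OF S that _ D]) auto
  show ?thesis
    unfolding isometries_def
    using Bij f f' g smooth_on_cong[OF S, of f "restrict f S"]
      smooth_on_cong[OF S, of f' "inv_into S (restrict f S)"]
    by (auto simp: inv frechet_eqI[OF D'])
qed

lemma isometriesD:
  fixes S :: "'e::real_normed_vector set"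
  assumes "f \<in> isometries S g"
  shows "f \<in> Bij S" "p \<in> S \<Longrightarrow> f p \<in> S" "p \<in> S \<Longrightarrow> inv_into S f p \<in> S"
    "p \<in> S \<Longrightarrow> inv_into S f (f p) = p" "p \<in> S \<Longrightarrow> f (inv_into S f p) = p"
    "smooth_on f S" "smooth_on (inv_into S f) S"
    "p \<in> S \<Longrightarrow> (f has_derivative frechet_derivative f (at p)) (at p)"
    "p \<in> S \<Longrightarrow> g (f p) (frechet_derivative f (at p) v) (frechet_derivative f (at p) w) = g p v w"
proof -
  have *: "f \<in> Bij S" "smooth_on f S" "smooth_on (inv_into S f) S" "bij_betw f S S"
    using assms by (auto simp: isometries_def Bij_def)
  show "f \<in> Bij S" "smooth_on f S" "smooth_on (inv_into S f) S" using * by auto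
  show "p \<in> S \<Longrightarrow> f p \<in> S" "p \<in> S \<Longrightarrow> inv_into S f p \<in> S"
    "p \<in> S \<Longrightarrow> inv_into S f (f p) = p" "p \<in> S \<Longrightarrow> f (inv_into S f p) = p"
    using *(4) by (auto simp: bij_betw_def f_inv_into_f inv_into_into)
  show "p \<in> S \<Longrightarrow> (f has_derivative frechet_derivative f (at p)) (at p)"
    using smooth_on_imp_differentiable[OF *(2)] frechet_works by blast
  show "p \<in> S \<Longrightarrow> g (f p) (frechet_derivative f (at p) v) (frechet_derivative f (at p) w) = g p v w"
    using assms by (auto simp: isometries_def)
qed

lemma subgroup_isometries:
  fixes S :: "'e::euclidean_space set"
  assumes S: "open S"
  shows "subgroup (isometries S g) (BijGroup S)"
proof (rule subgroup.intro)
  show "isometries S g \<subseteq> carrier (BijGroup S)"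
    by (auto simp: BijGroup_def isometries_def)
next
  fix x y assume x: "x \<in> isometries S g" and y: "y \<in> isometries S g"
  note X = isometriesD[OF x] and Y = isometriesD[OF y]
  have "restrict (\<lambda>p. x (y p)) S \<in> isometries S g"
  proof (rule restrict_in_isometries[OF S, where f' = "\<lambda>p. inv_into S y (inv_into S x p)"
        and D = "\<lambda>p v. frechet_derivative x (at (y p)) (frechet_derivative y (at p) v)"])
    show "smooth_on (\<lambda>p. x (y p)) S"
      by (rule smooth_on_compose[OF S S _ Y(6) X(6)]) (simp add: image_subset_iff Y(2))
    show "smooth_on (\<lambda>p. inv_into S y (inv_into S x p)) S"
      by (rule smooth_on_compose[OF S S _ X(7) Y(7)]) (simp add: image_subset_iff X(3))
    show "((\<lambda>p. x (y p)) has_derivative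
        (\<lambda>v. frechet_derivative x (at (y p)) (frechet_derivative y (at p) v))) (at p)" if "p \<in> S" for p
      by (rule has_derivative_compose[OF Y(8)[OF that] X(8)[OF Y(2)[OF that]]])
    show "g (x (y p)) (frechet_derivative x (at (y p)) (frechet_derivative y (at p) v))
        (frechet_derivative x (at (y p)) (frechet_derivative y (at p) w)) = g p v w" if "p \<in> S" for p v w
      by (simp only: X(9)[OF Y(2)[OF that]] Y(9)[OF that])
  qed (simp_all add: X(1-5) Y(1-5))
  then show "x \<otimes>\<^bsub>BijGroup S\<^esub> y \<in> isometries S g"
    using X(1) Y(1) by (simp add: BijGroup_def compose_def restrict_def)
next
  show "\<one>\<^bsub>BijGroup S\<^esub> \<in> isometries S g"
    using restrict_in_isometries[OF S, of "\<lambda>x. x" "\<lambda>x. x" "\<lambda>p v. v" g]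
    by (simp add: BijGroup_def smooth_on_id[OF S] has_derivative_ident)
next
  fix x assume x: "x \<in> isometries S g"
  note X = isometriesD[OF x]
  let ?i = "inv_into S x"
  have di: "(?i has_derivative frechet_derivative ?i (at p)) (at p)" if "p \<in> S" for p
    using smooth_on_imp_differentiable[OF X(7) that] frechet_works by blast
  \<comment> \<open>Differentiating \<open>x (?i q) = q\<close> shows that the derivative of the
    inverse is a right inverse of that of \<open>x\<close>; invariance of \<open>g\<close> under
    \<open>x\<close> at \<open>?i p\<close> is then invariance under the inverse at
    \<open>p\<close>.\<close>
  have chain: "frechet_derivative x (at (?i p)) (frechet_derivative ?i (at p) v) = v" if "p \<in> S" for p v
  proof -
    have 1: "((\<lambda>q. x (?i q)) has_derivative
        (\<lambda>v. frechet_derivative x (at (?i p)) (frechet_derivative ?i (at p) v))) (at p)"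
      by (rule has_derivative_compose[OF di[OF that] X(8)[OF X(3)[OF that]]])
    have 2: "((\<lambda>q. x (?i q)) has_derivative (\<lambda>v. v)) (at p)"
      by (rule has_derivative_cong_open[OF S that _ has_derivative_ident]) (simp add: X(5))
    show ?thesis using has_derivative_unique[OF 1 2] by metis
  qed
  have "restrict ?i S \<in> isometries S g"
  proof (rule restrict_in_isometries[OF S, where f' = x and D = "\<lambda>p. frechet_derivative ?i (at p)"])
    show "g (?i p) (frechet_derivative ?i (at p) v) (frechet_derivative ?i (at p) w) = g p v w"
      if "p \<in> S" for p v w
      using X(9)[OF X(3)[OF that], of "frechet_derivative ?i (at p) v" "frechet_derivative ?i (at p) w"]
      by (simp only: chain[OF that] X(5)[OF that])
  qed (simp_all add: X(1-7) di)
  then show "inv\<^bsub>BijGroup S\<^esub> x \<in> isometries S g"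
    using X(1) by (simp add: inv_BijGroup)
qed

lemma group_Iso_group:
  fixes S :: "'e::euclidean_space set"
  shows "open S \<Longrightarrow> group (Iso_group S g)"
  unfolding Iso_group_def
  by (rule subgroup.subgroup_is_group[OF subgroup_isometries group_BijGroup])

section \<open>Uniqueness of integral curves\<close>

lemma smooth_on_locally_Lipschitz:
  fixes X :: "'e::euclidean_space \<Rightarrow> 'e"
  assumes "open S" "smooth_on X S" "p \<in> S"
  obtains \<epsilon> L where "0 < \<epsilon>" "0 \<le> L" "ball p \<epsilon> \<subseteq> S"
    "\<And>x y. x \<in> ball p \<epsilon> \<Longrightarrow> y \<in> ball p \<epsilon> \<Longrightarrow> norm (X x - X y) \<le> L * norm (x - y)"
proof -
  let ?D = "\<lambda>x. frechet_derivative X (at x)"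
  have X1: "Ck_on 1 X S" using assms(2) by (simp add: smooth_on_def)
  \<comment> \<open>The sum of the norms of the partial derivatives is continuous and dominates the
    operator norm, so near \<open>p\<close> its value at \<open>p\<close> plus \<open>1\<close>
    serves as a Lipschitz constant.\<close>
  have "continuous_on S (\<lambda>x. \<Sum>b\<in>Basis. norm (?D x b))"
    using X1 by (auto intro!: continuous_intros)
  then have "isCont (\<lambda>x. \<Sum>b\<in>Basis. norm (?D x b)) p"
    using assms(1,3) by (simp add: continuous_on_eq_continuous_at)
  then obtain d where d: "0 < d" "\<And>x. dist x p < d \<Longrightarrow>
      dist (\<Sum>b\<in>Basis. norm (?D x b)) (\<Sum>b\<in>Basis. norm (?D p b)) < 1"
    unfolding continuous_at_eps_delta by (metis zero_less_one)
  obtain e where e: "0 < e" "ball p e \<subseteq> S" using assms(1,3) openE by blast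
  define L where "L = (\<Sum>b\<in>Basis. norm (?D p b)) + 1"
  have L: "0 \<le> L" unfolding L_def by (intro add_nonneg_nonneg sum_nonneg) auto
  define \<epsilon> where "\<epsilon> = min d e"
  have lin: "linear (?D x)" if "x \<in> S" for x
    using X1 that by (auto intro!: linear_frechet_derivative)
  have bound: "onorm (?D x) \<le> L" if x: "x \<in> ball p \<epsilon>" for x
  proof (rule onorm_le)
    fix v
    have xS: "x \<in> S" using x e by (auto simp: \<epsilon>_def)
    have "?D x v = ?D x (\<Sum>b\<in>Basis. (v \<bullet> b) *\<^sub>R b)" by (simp add: euclidean_representation)
    also have "\<dots> = (\<Sum>b\<in>Basis. (v \<bullet> b) *\<^sub>R ?D x b)"
      by (simp add: linear_sum[OF lin[OF xS]] linear_scale[OF lin[OF xS]])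
    also have "norm \<dots> \<le> (\<Sum>b\<in>Basis. norm v * norm (?D x b))"
      by (rule order_trans[OF norm_sum]) (auto intro!: sum_mono mult_right_mono Basis_le_norm)
    also have "\<dots> = (\<Sum>b\<in>Basis. norm (?D x b)) * norm v"
      by (simp add: sum_distrib_left mult.commute)
    also have "\<dots> \<le> L * norm v"
    proof (rule mult_right_mono)
      show "(\<Sum>b\<in>Basis. norm (?D x b)) \<le> L"
        using d(2)[of x] x unfolding L_def \<epsilon>_def by (auto simp: dist_real_def dist_commute)
    qed auto
    finally show "norm (?D x v) \<le> L * norm v" .
  qed
  have "norm (X x - X y) \<le> L * norm (x - y)" if "x \<in> ball p \<epsilon>" "y \<in> ball p \<epsilon>" for x y
  proof (rule differentiable_bound[OF convex_ball _ bound that(1,2)])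
    show "(X has_derivative ?D x) (at x within ball p \<epsilon>)" if "x \<in> ball p \<epsilon>" for x
      by (rule has_derivative_at_withinI, rule frechet_works) (use X1 that e(2) in \<open>auto simp: \<epsilon>_def\<close>)
  qed
  moreover have "ball p \<epsilon> \<subseteq> S" "0 < \<epsilon>" using d(1) e by (auto simp: \<epsilon>_def)
  ultimately show ?thesis using that[of \<epsilon> L] L by blast
qed

text \<open>The times at which both curves agree form a closed set containing \<open>0\<close>; the
  local Lipschitz bound makes it open as well, and the real line is connected.\<close>

lemma integral_curve_unique:
  fixes X :: "'e::euclidean_space \<Rightarrow> 'e" and \<gamma> \<eta> :: "real \<Rightarrow> 'e"
  assumes S: "open S" "smooth_on X S"
    and \<gamma>: "\<And>s. \<gamma> s \<in> S" "\<And>s. (\<gamma> has_vector_derivative X (\<gamma> s)) (at s)"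
    and \<eta>: "\<And>s. \<eta> s \<in> S" "\<And>s. (\<eta> has_vector_derivative X (\<eta> s)) (at s)"
    and init: "\<gamma> 0 = \<eta> 0"
  shows "\<gamma> s = \<eta> s"
proof -
  let ?E = "{s. \<gamma> s = \<eta> s}"
  have cont: "continuous_on UNIV \<gamma>" "continuous_on UNIV \<eta>"
    by (auto intro!: continuous_at_imp_continuous_on has_vector_derivative_continuous \<gamma>(2) \<eta>(2))
  have "closed ?E" using cont by (intro closed_Collect_eq)
  moreover have "open ?E"
    unfolding open_contains_ball
  proof
    fix s0 assume s0: "s0 \<in> ?E"
    obtain \<epsilon> L where L: "0 < \<epsilon>" "0 \<le> L"
      "\<And>x y. x \<in> ball (\<gamma> s0) \<epsilon> \<Longrightarrow> y \<in> ball (\<gamma> s0) \<epsilon> \<Longrightarrow> norm (X x - X y) \<le> L * norm (x - y)"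
      by (rule smooth_on_locally_Lipschitz[OF S \<gamma>(1)[of s0]]) blast
    have "open (\<gamma> -` ball (\<gamma> s0) \<epsilon> \<inter> \<eta> -` ball (\<gamma> s0) \<epsilon>)"
      by (intro open_Int open_vimage open_ball cont)
    moreover have "s0 \<in> \<gamma> -` ball (\<gamma> s0) \<epsilon> \<inter> \<eta> -` ball (\<gamma> s0) \<epsilon>" using s0 L(1) by auto
    ultimately obtain d where d: "0 < d" "ball s0 d \<subseteq> \<gamma> -` ball (\<gamma> s0) \<epsilon> \<inter> \<eta> -` ball (\<gamma> s0) \<epsilon>"
      using openE by blast
    \<comment> \<open>On an interval of radius \<open>r\<close> about \<open>s0\<close> the maximal
      distance \<open>?m\<close> of the curves satisfies \<open>?m \<le> L * r * ?m\<close>. The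
      choice of \<open>r\<close> ensures \<open>L * r < 1\<close> and so forces
      \<open>?m = 0\<close>; \<open>L + 1\<close> in the denominator covers
      \<open>L = 0\<close>.\<close>
    define r where "r = min (d/2) (1 / (2 * (L + 1)))"
    have r: "0 < r" "r < d" "L * r < 1"
    proof -
      show "0 < r" "r < d" using d(1) L(2) by (auto simp: r_def)
      have "L * r \<le> L * (1 / (2 * (L + 1)))" using L(2) by (intro mult_left_mono) (auto simp: r_def)
      also have "\<dots> < 1" using L(2) by (simp add: field_simps)
      finally show "L * r < 1" .
    qed
    have "continuous_on (cball s0 r) (\<lambda>s. norm (\<gamma> s - \<eta> s))"
      using cont by (intro continuous_intros) (auto intro: continuous_on_subset)
    then obtain sm where sm: "sm \<in> cball s0 r"
      "\<And>s. s \<in> cball s0 r \<Longrightarrow> norm (\<gamma> s - \<eta> s) \<le> norm (\<gamma> sm - \<eta> sm)"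
      using continuous_attains_sup[of "cball s0 r" "\<lambda>s. norm (\<gamma> s - \<eta> s)"] r(1) by auto
    let ?m = "norm (\<gamma> sm - \<eta> sm)"
    have "norm ((\<gamma> sm - \<eta> sm) - (\<gamma> s0 - \<eta> s0)) \<le> (L * ?m) * norm (sm - s0)"
    proof (rule differentiable_bound[OF convex_cball, where f = "\<lambda>s. \<gamma> s - \<eta> s"])
      fix s assume s: "s \<in> cball s0 r"
      have "((\<lambda>s. \<gamma> s - \<eta> s) has_vector_derivative X (\<gamma> s) - X (\<eta> s)) (at s within cball s0 r)"
        by (intro has_vector_derivative_diff has_vector_derivative_at_within[OF \<gamma>(2)]
            has_vector_derivative_at_within[OF \<eta>(2)])
      then show "((\<lambda>s. \<gamma> s - \<eta> s) has_derivative (\<lambda>t. t *\<^sub>R (X (\<gamma> s) - X (\<eta> s)))) (at s within cball s0 r)"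
        by (simp add: has_vector_derivative_def)
      have "s \<in> ball s0 d" using s r(2) by auto
      then have "norm (X (\<gamma> s) - X (\<eta> s)) \<le> L * norm (\<gamma> s - \<eta> s)"
        using d(2) by (intro L(3)) auto
      also have "\<dots> \<le> L * ?m" using sm(2)[OF s] L(2) by (intro mult_left_mono)
      finally have "norm (X (\<gamma> s) - X (\<eta> s)) \<le> L * ?m" .
      then show "onorm (\<lambda>t. t *\<^sub>R (X (\<gamma> s) - X (\<eta> s))) \<le> L * ?m"
        by (intro onorm_le) (simp add: mult.commute mult_left_mono)
    qed (use sm(1) r(1) in auto)
    also have "\<dots> \<le> (L * ?m) * r" using sm(1) L(2)
      by (intro mult_left_mono) (auto simp: dist_norm norm_minus_commute)
    finally have "?m \<le> (L * r) * ?m" using s0 by (simp add: algebra_simps)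
    moreover have "?m \<ge> 0" by simp
    ultimately have "?m = 0"
      using r(3) mult_strict_right_mono[of "L * r" 1 ?m] by linarith
    then have "ball s0 r \<subseteq> ?E" using sm(2) by fastforce
    then show "\<exists>e>0. ball s0 e \<subseteq> ?E" using r(1) by blast
  qed
  ultimately have "?E = UNIV" using init clopen[of ?E] by blast
  then show ?thesis by blast
qed

text \<open>\<open>G_set\<close> admits every global flow of a generating field. On \<open>S\<close>
  each of them is thereby identified with the explicit one; off \<open>S\<close> flows remain
  arbitrary.\<close>

lemma is_flow_unique:
  fixes X :: "'e::euclidean_space \<Rightarrow> 'e"
  assumes "open S" "smooth_on X S" "is_flow S X \<Phi>" "is_flow S X \<Psi>" "p \<in> S"
  shows "\<Phi> s p = \<Psi> s p"
proof (rule integral_curve_unique[of S X "\<lambda>s. \<Phi> s p" "\<lambda>s. \<Psi> s p"])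
  have "\<Phi> 0 p = p" "\<Psi> 0 p = p" using assms(3-5) unfolding is_flow_def by blast+
  then show "\<Phi> 0 p = \<Psi> 0 p" by simp
qed (use assms in \<open>unfold is_flow_def, blast+\<close>)

section \<open>The cubic form and the cone over a projective special real manifold\<close>

type_synonym 'n coeffs = "'n \<Rightarrow> 'n \<Rightarrow> 'n \<Rightarrow> real"

text \<open>The polarization of the cubic, normalized by \<open>k3 k t t t = 6 h(t)\<close>. It is
  needed over the complex field for \<open>tau\<close> and over the real field for everything
  else.\<close>

definition k3 :: "'n::finite coeffs \<Rightarrow> 'a::real_normed_field ^ 'n \<Rightarrow> 'a ^ 'n \<Rightarrow> 'a ^ 'n \<Rightarrow> 'a" where
  "k3 k x y z = (\<Sum>a\<in>UNIV. \<Sum>b\<in>UNIV. \<Sum>c\<in>UNIV. of_real (k a b c) * x$a * y$b * z$c)"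

text \<open>The covector \<open>k3 k x y _\<close>, written as a vector by means of the standard
  inner product. Being a bounded bilinear map it has rules for derivatives and smoothness, from
  which those for the real \<open>k3\<close> follow via \<open>k2_inner\<close>.\<close>

definition k2 :: "'n::finite coeffs \<Rightarrow> real ^ 'n \<Rightarrow> real ^ 'n \<Rightarrow> real ^ 'n" where
  "k2 k x y = (\<chi> c. \<Sum>a\<in>UNIV. \<Sum>b\<in>UNIV. k a b c * x$a * y$b)"

lemma k2_inner: "k2 k x y \<bullet> z = k3 k x y z" "z \<bullet> k2 k x y = k3 k x y z"
proof -
  have "k2 k x y \<bullet> z = (\<Sum>c\<in>UNIV. \<Sum>a\<in>UNIV. \<Sum>b\<in>UNIV. k a b c * x$a * y$b * z$c)"
    by (simp add: k2_def inner_vec_def sum_distrib_right)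
  also have "\<dots> = (\<Sum>a\<in>UNIV. \<Sum>c\<in>UNIV. \<Sum>b\<in>UNIV. k a b c * x$a * y$b * z$c)"
    by (rule sum.swap)
  also have "\<dots> = k3 k x y z"
    unfolding k3_def by (rule sum.cong[OF refl], subst sum.swap) simp
  finally show "k2 k x y \<bullet> z = k3 k x y z" .
  then show "z \<bullet> k2 k x y = k3 k x y z" by (simp add: inner_commute)
qed

lemma cubic_k3: "cubic k t = k3 k t t t / 6"
  by (simp add: cubic_def k3_def)

lemma k3_add: "k3 k (x + x') y z = k3 k x y z + k3 k x' y z"
    "k3 k x (y + y') z = k3 k x y z + k3 k x y' z"
    "k3 k x y (z + z') = k3 k x y z + k3 k x y z'"
  by (simp_all add: k3_def algebra_simps sum.distrib)

lemma k3_smult: "k3 k (r *s x) y z = r * k3 k x y z"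
    "k3 k x (r *s y) z = r * k3 k x y z"
    "k3 k x y (r *s z) = r * k3 k x y z"
  by (simp_all add: k3_def sum_distrib_left mult_ac)

lemma k3_scale: "k3 k (r *\<^sub>R x) y z = r * k3 k x y z"
    "k3 k x (r *\<^sub>R y) z = r * k3 k x y z"
    "k3 k x y (r *\<^sub>R z) = (r::real) * k3 k x y z"
  by (simp_all add: k3_def sum_distrib_left mult_ac)

lemma k3_diff: "k3 k (x - x') y z = k3 k x y z - k3 k x' y z"
    "k3 k x (y - y') z = k3 k x y z - k3 k x y' z"
    "k3 k x y (z - z') = k3 k x y z - k3 k x y z'"
  by (simp_all add: k3_def algebra_simps sum_subtractf)

lemma k3_minus: "k3 k (- x) y z = - k3 k x y z"
    "k3 k x (- y) z = - k3 k x y z"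
    "k3 k x y (- z) = - k3 k x y z"
  by (simp_all add: k3_def sum_negf)

lemma k3_zero: "k3 k 0 y z = 0" "k3 k x 0 z = 0" "k3 k x y 0 = 0"
  by (simp_all add: k3_def)

lemmas k3_linear = k3_add k3_smult k3_scale k3_diff k3_minus k3_zero

text \<open>Tested against an arbitrary \<open>w\<close>, vector identities in \<open>k2\<close>
  become scalar identities in \<open>k3\<close>, for which symmetry gives a normal form.\<close>

lemma vec_eq_innerI: "(\<And>w. x \<bullet> w = y \<bullet> w) \<Longrightarrow> x = (y::'a::real_inner)"
  by (metis inner_commute vector_eq_ldot)

lemma bounded_bilinear_k2: "bounded_bilinear (k2 k)"
  unfolding bilinear_conv_bounded_bilinear[symmetric] bilinear_def
  by (intro conjI allI linearI; rule vec_eq_innerI; simp add: k2_inner inner_add_left k3_linear)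

lemmas k2_linear = bounded_bilinear.add_left[OF bounded_bilinear_k2]
  bounded_bilinear.add_right[OF bounded_bilinear_k2]
  bounded_bilinear.diff_left[OF bounded_bilinear_k2]
  bounded_bilinear.diff_right[OF bounded_bilinear_k2]
  bounded_bilinear.minus_left[OF bounded_bilinear_k2]
  bounded_bilinear.minus_right[OF bounded_bilinear_k2]
  bounded_bilinear.scaleR_left[OF bounded_bilinear_k2]
  bounded_bilinear.scaleR_right[OF bounded_bilinear_k2]
  bounded_bilinear.zero_left[OF bounded_bilinear_k2]
  bounded_bilinear.zero_right[OF bounded_bilinear_k2]

lemmas smooth_on_k2 [smooth_intros] = smooth_on_bilinear[OF bounded_bilinear_k2]

lemma smooth_on_k3 [smooth_intros]:
  "open S \<Longrightarrow> smooth_on f S \<Longrightarrow> smooth_on g S \<Longrightarrow> smooth_on h S \<Longrightarrow> smooth_on (\<lambda>x. k3 k (f x) (g x) (h x) :: real) S"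
  unfolding k2_inner[symmetric] by (intro smooth_intros)

lemmas has_derivative_k2 [derivative_intros] = bounded_bilinear.FDERIV[OF bounded_bilinear_k2]

lemma has_derivative_k3 [derivative_intros]:
  assumes "(f has_derivative f') (at x within s)" "(g has_derivative g') (at x within s)"
    "(h has_derivative h') (at x within s)"
  shows "((\<lambda>x. k3 k (f x) (g x) (h x) :: real) has_derivative
    (\<lambda>v. k3 k (f x) (g x) (h' v) + (k3 k (f x) (g' v) (h x) + k3 k (f' v) (g x) (h x)))) (at x within s)"
  unfolding k2_inner[symmetric]
  by (rule has_derivative_eq_rhs[OF has_derivative_inner[OF has_derivative_k2[OF assms(1,2)] assms(3)]])
    (simp add: inner_add_left inner_add_right inner_commute)

lemma smooth_on_cubic [smooth_intros]:
  "open S \<Longrightarrow> smooth_on f S \<Longrightarrow> smooth_on (\<lambda>x. cubic k (f x) :: real) S"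
  unfolding cubic_k3 by (rule smooth_on_linear_compose[OF bounded_linear_divide]) (auto intro: smooth_intros)

lemma cubic_scaleR: "cubic k (r *\<^sub>R t) = r ^ 3 * cubic k (t :: real ^ _)"
  by (simp add: cubic_k3 k3_linear power3_eq_cube)

section \<open>Symmetry, Taylor expansion and polarization of the cubic\<close>

locale cubic_form =
  fixes k :: "'n::finite \<Rightarrow> 'n \<Rightarrow> 'n \<Rightarrow> real"
  assumes sym: "symmetric3 k"
begin

lemma k3_commute: "k3 k x y z = k3 k y x z" "k3 k x y z = k3 k x z y"
proof -
  have *: "k a b c = k b a c" "k a b c = k a c b" for a b c
    using sym unfolding symmetric3_def by blast+
  show "k3 k x y z = k3 k y x z"
    unfolding k3_def
    by (subst sum.swap, intro sum.cong refl, subst *(1)) (simp add: mult_ac)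
  show "k3 k x y z = k3 k x z y"
    unfolding k3_def
    by (rule sum.cong[OF refl], subst sum.swap, intro sum.cong refl, subst *(2)) (simp add: mult_ac)
qed

lemma k2_commute: "k2 k x y = k2 k y x"
  by (rule vec_eq_innerI) (simp add: k2_inner k3_commute(1))

lemmas multilinear = k2_linear k2_inner k3_linear k3_commute inner_add_left inner_diff_left

lemma cubic_add_smult:
  "cubic k (x + s *s y) = cubic k x + s * (k3 k x x y / 2) + s ^ 2 * (k3 k x y y / 2) + s ^ 3 * cubic k y"
  by (simp add: cubic_k3 k3_linear k3_commute algebra_simps power2_eq_square power3_eq_cube add_divide_distrib)

text \<open>Since the trilinear form is recovered from values of the cubic, a linear map that
  preserves the cubic preserves \<open>k3\<close>.\<close>

lemma k3_polarization:
  "k3 k x y z = cubic k (x + y + z) - cubic k (x + y) - cubic k (y + z) - cubic k (x + z)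
     + cubic k x + cubic k y + cubic k z"
  by (simp add: cubic_k3 k3_linear k3_commute algebra_simps add_divide_distrib)

lemma has_derivative_cubic [derivative_intros]:
  assumes "(f has_derivative f') (at x within s)"
  shows "((\<lambda>x. cubic k (f x) :: real) has_derivative (\<lambda>v. k3 k (f x) (f x) (f' v) / 2)) (at x within s)"
  unfolding cubic_k3
  by (rule derivative_eq_intros assms refl | simp add: k3_commute)+

end

locale psr = cubic_form k for k :: "'n::finite \<Rightarrow> 'n \<Rightarrow> 'n \<Rightarrow> real" +
  fixes H :: "(real ^ 'n) set"
  assumes psr: "psr_manifold k H"
begin

lemma H_nonempty: "H \<noteq> {}" and H_cubic: "p \<in> H \<Longrightarrow> cubic k p = 1"
  using psr by (auto simp: psr_manifold_def)

section \<open>Openness of the cone over the hypersurface\<close>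

lemma H_defining_function:
  assumes "p \<in> H"
  obtains f :: "real ^ 'n \<Rightarrow> real" and r where "0 < r" "f p = 0" "\<And>x. x \<in> ball p r \<Longrightarrow> f differentiable (at x)"
    "\<exists>v. frechet_derivative f (at p) v \<noteq> 0" "\<And>x. x \<in> ball p r \<Longrightarrow> f x = 0 \<Longrightarrow> x \<in> H"
proof -
  obtain V and f :: "real ^ 'n \<Rightarrow> real" where V: "open V" "p \<in> V" "smooth_on f V"
    "\<forall>x\<in>V. \<exists>v. frechet_derivative f (at x) v \<noteq> 0" "H \<inter> V = {x\<in>V. f x = 0}"
    using psr assms unfolding psr_manifold_def smooth_hypersurface_def by blast
  obtain r where r: "0 < r" "ball p r \<subseteq> V" using V(1,2) openE by blast
  show ?thesis
  proof (rule that[of r f])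
    show "f p = 0" using V assms by blast
    show "f differentiable (at x)" if "x \<in> ball p r" for x
      using smooth_on_imp_differentiable[OF V(3)] that r by blast
    show "\<exists>v. frechet_derivative f (at p) v \<noteq> 0" using V(2,4) by blast
    show "x \<in> H" if "x \<in> ball p r" "f x = 0" for x using that r V(5) by blast
  qed (rule r)
qed

lemma directional_increase:
  fixes f :: "real ^ 'n \<Rightarrow> real"
  assumes f: "(f has_derivative f') (at p)" "f p = 0" and v: "0 < f' v"
  obtains d where "0 < d" "\<And>s. 0 < s \<Longrightarrow> s < d \<Longrightarrow> 0 < f (p + s *\<^sub>R v)"
proof -
  have lin: "linear f'" using f(1) has_derivative_linear by blast
  have "((\<lambda>s. p + s *\<^sub>R v) has_derivative (\<lambda>s. s *\<^sub>R v)) (at 0)"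
    by (auto intro!: derivative_eq_intros)
  from has_derivative_compose[OF this, of f f']
  have "((\<lambda>s. f (p + s *\<^sub>R v)) has_derivative (\<lambda>s. f' (s *\<^sub>R v))) (at 0)"
    using f(1) by simp
  then have "((\<lambda>s. f (p + s *\<^sub>R v)) has_real_derivative f' v) (at 0)"
    by (simp add: has_field_derivative_def linear_scale[OF lin] mult_commute_abs)
  from has_real_derivative_pos_inc_right[OF this v] show ?thesis
    using that f(2) by auto
qed

lemma zero_on_segment:
  fixes f :: "real ^ 'n \<Rightarrow> real"
  assumes "convex B" "\<And>x. x \<in> B \<Longrightarrow> f differentiable (at x)" "x \<in> B" "y \<in> B" "f x < 0" "0 < f y"
  obtains c where "0 \<le> c" "c \<le> 1" "f ((1 - c) *\<^sub>R x + c *\<^sub>R y) = 0"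
proof -
  have "continuous_on {0..1} (\<lambda>c. f ((1 - c) *\<^sub>R x + c *\<^sub>R y))"
  proof (rule continuous_on_compose2[where g = f and t = B])
    show "continuous_on B f"
      by (intro continuous_at_imp_continuous_on ballI differentiable_imp_continuous_within assms(2))
    show "(\<lambda>c. (1 - c) *\<^sub>R x + c *\<^sub>R y) ` {0..1} \<subseteq> B"
      using assms(1,3,4) by (auto simp: convex_alt)
  qed (auto intro!: continuous_intros)
  then obtain c where "0 \<le> c" "c \<le> 1" "f ((1 - c) *\<^sub>R x + c *\<^sub>R y) = 0"
    using IVT'[of "\<lambda>c. f ((1 - c) *\<^sub>R x + c *\<^sub>R y)" 0 0 1] assms(5,6) by auto
  then show ?thesis using that by blast
qed

text \<open>The point equals \<open>(1 + s) p + s c w\<close>, so this is the Taylor expansion at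
  \<open>(1 + s) p\<close> in direction \<open>w\<close>. The leading term carries the radial
  growth, the others are errors controlled by \<open>c\<close>.\<close>

lemma cubic_along_radius:
  "cubic k (p + s *\<^sub>R (p + c *\<^sub>R w)) = (1 + s) ^ 3 * cubic k p + (1 + s)\<^sup>2 * (s * c) * (k3 k p p w / 2)
     + (1 + s) * (s * c)\<^sup>2 * (k3 k p w w / 2) + (s * c) ^ 3 * cubic k (w :: real ^ 'n)"
proof -
  have "p + s *\<^sub>R (p + c *\<^sub>R w) = (1 + s) *\<^sub>R p + (s * c) *s w"
    by (simp add: algebra_simps scalar_mult_eq_scaleR)
  then show ?thesis
    by (simp only: cubic_add_smult cubic_scaleR k3_linear power2_eq_square)
      (simp add: algebra_simps add_divide_distrib power2_eq_square power3_eq_cube)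
qed

text \<open>If the position vector were tangent to \<open>H\<close> at \<open>p\<close>, then \<open>H\<close> would contain points
  \<open>p + s (p + c w)\<close> with \<open>s > 0\<close> and \<open>c\<close> small, where the cubic exceeds \<open>1\<close>.\<close>

lemma radial_derivative_nonzero:
  fixes f :: "real ^ 'n \<Rightarrow> real"
  assumes p: "p \<in> H" and r: "0 < r" and f0: "f p = 0"
    and f: "\<And>x. x \<in> ball p r \<Longrightarrow> f differentiable (at x)"
    and nz: "\<exists>v. frechet_derivative f (at p) v \<noteq> 0"
    and fH: "\<And>x. x \<in> ball p r \<Longrightarrow> f x = 0 \<Longrightarrow> x \<in> H"
  shows "frechet_derivative f (at p) p \<noteq> 0"
proof
  let ?f' = "frechet_derivative f (at p)"
  assume f'p: "?f' p = 0"
  have df: "(f has_derivative ?f') (at p)" using f r by (intro frechet_works) auto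
  have lin: "linear ?f'" using df has_derivative_linear by blast
  obtain v where v: "?f' v \<noteq> 0" using nz by blast
  define w where "w = ?f' v *\<^sub>R v"
  have w: "0 < ?f' w" using v by (simp add: w_def linear_scale[OF lin] power2_eq_square[symmetric])
  define C where "C = \<bar>k3 k p p w / 2\<bar> + \<bar>k3 k p w w / 2\<bar> + \<bar>cubic k w\<bar>"
  have C: "0 \<le> C" unfolding C_def by simp
  \<comment> \<open>The three error terms in \<open>cubic_along_radius\<close> will be at most
    \<open>4\<close>, \<open>2\<close> and \<open>1\<close> times \<open>s * \<epsilon> * C\<close>.
    Their sum has to stay below the growth \<open>3 * s\<close> of \<open>(1 + s) ^ 3\<close>, hence
    the condition on \<open>7 * \<epsilon> * C\<close>.\<close>
  define \<epsilon> where "\<epsilon> = min 1 (1 / (7 * (C + 1)))"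
  have \<epsilon>: "0 < \<epsilon>" "\<epsilon> \<le> 1" "7 * \<epsilon> * C < 3"
  proof -
    show "0 < \<epsilon>" "\<epsilon> \<le> 1" using C by (auto simp: \<epsilon>_def)
    have "7 * \<epsilon> * C \<le> 7 * (1 / (7 * (C + 1))) * C" using C by (intro mult_right_mono) (auto simp: \<epsilon>_def)
    also have "\<dots> < 3" using C by (simp add: field_simps)
    finally show "7 * \<epsilon> * C < 3" .
  qed
  \<comment> \<open>As \<open>?f' p = 0\<close>, the derivatives of \<open>f\<close> along
    \<open>p + \<epsilon> w\<close> and \<open>p - \<epsilon> w\<close> are
    \<open>\<epsilon> * ?f' w\<close> and its negative. So \<open>f\<close> has opposite signs at
    the two displaced points, and a zero between them is a point of \<open>H\<close>.\<close>
  obtain d1 where d1: "0 < d1" "\<And>s. 0 < s \<Longrightarrow> s < d1 \<Longrightarrow> 0 < f (p + s *\<^sub>R (p + \<epsilon> *\<^sub>R w))"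
    using directional_increase[OF df f0, of "p + \<epsilon> *\<^sub>R w"] w \<epsilon>(1)
    by (auto simp: linear_add[OF lin] linear_scale[OF lin] f'p)
  have "((\<lambda>x. - f x) has_derivative (\<lambda>x. - ?f' x)) (at p)" using df by (intro derivative_intros)
  then obtain d2 where d2: "0 < d2" "\<And>s. 0 < s \<Longrightarrow> s < d2 \<Longrightarrow> 0 < - f (p + s *\<^sub>R (p + (- \<epsilon>) *\<^sub>R w))"
    using directional_increase[of "\<lambda>x. - f x" "\<lambda>x. - ?f' x" p "p + (- \<epsilon>) *\<^sub>R w"] w \<epsilon>(1) f0
    by (auto simp: linear_add[OF lin] linear_scale[OF lin] linear_diff[OF lin] f'p)
  define D where "D = norm (p + \<epsilon> *\<^sub>R w) + norm (p + (- \<epsilon>) *\<^sub>R w) + 1"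
  have D: "0 < D" unfolding D_def by (simp add: add_nonneg_pos)
  define s where "s = min (min (d1/2) (d2/2)) (min 1 (r / (2 * D)))"
  have s: "0 < s" "s < d1" "s < d2" "s \<le> 1" "s * D < r"
  proof -
    show "0 < s" "s < d1" "s < d2" "s \<le> 1" using d1 d2 D r by (auto simp: s_def)
    have "s * D \<le> r / (2 * D) * D" using D by (intro mult_right_mono) (auto simp: s_def)
    also have "\<dots> < r" using D r by simp
    finally show "s * D < r" .
  qed
  have ball: "p + s *\<^sub>R u \<in> ball p r" if "norm u \<le> D" for u
  proof -
    have "norm (s *\<^sub>R u) \<le> s * D" using s(1) that by simp
    then show ?thesis using s(5) by (simp add: dist_norm)
  qed
  have B: "p + s *\<^sub>R (p + (- \<epsilon>) *\<^sub>R w) \<in> ball p r" "p + s *\<^sub>R (p + \<epsilon> *\<^sub>R w) \<in> ball p r"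
    by (rule ball, simp add: D_def)+
  have neg: "f (p + s *\<^sub>R (p + (- \<epsilon>) *\<^sub>R w)) < 0" using d2(2)[OF s(1,3)] by simp
  obtain c where c: "0 \<le> c" "c \<le> 1"
    "f ((1 - c) *\<^sub>R (p + s *\<^sub>R (p + (- \<epsilon>) *\<^sub>R w)) + c *\<^sub>R (p + s *\<^sub>R (p + \<epsilon> *\<^sub>R w))) = 0"
    using zero_on_segment[OF convex_ball f B neg d1(2)[OF s(1,2)]] by blast
  define u where "u = (2 * c - 1) * \<epsilon>"
  have eq: "(1 - c) *\<^sub>R (p + s *\<^sub>R (p + (- \<epsilon>) *\<^sub>R w)) + c *\<^sub>R (p + s *\<^sub>R (p + \<epsilon> *\<^sub>R w)) = p + s *\<^sub>R (p + u *\<^sub>R w)"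
    by (simp add: u_def vec_eq_iff algebra_simps)
  have "p + s *\<^sub>R (p + u *\<^sub>R w) \<in> ball p r"
    unfolding eq[symmetric] using B c(1,2) convex_ball[of p r] by (auto simp only: convex_alt)
  then have h1: "cubic k (p + s *\<^sub>R (p + u *\<^sub>R w)) = 1"
    using fH c(3) H_cubic unfolding eq by blast
  have u: "\<bar>u\<bar> \<le> \<epsilon>"
    using mult_right_mono[of "\<bar>2 * c - 1\<bar>" 1 \<epsilon>] c(1,2) \<epsilon>(1) by (simp add: u_def abs_mult)
  have su: "\<bar>s * u\<bar> \<le> s * \<epsilon>" using s(1) u by (simp add: abs_mult)
  have su1: "\<bar>s * u\<bar> \<le> 1" using su mult_le_one[OF s(4) _ \<epsilon>(2)] \<epsilon>(1) by linarith
  have t1: "\<bar>(1 + s)\<^sup>2 * (s * u) * (k3 k p p w / 2)\<bar> \<le> 4 * (s * \<epsilon>) * C"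
  proof -
    have "(1 + s)\<^sup>2 \<le> 2\<^sup>2" using s(1,4) by (intro power_mono) auto
    then show ?thesis unfolding abs_mult using su C s(1) \<epsilon>(1)
      by (intro mult_mono) (auto simp: C_def abs_mult)
  qed
  have t2: "\<bar>(1 + s) * (s * u)\<^sup>2 * (k3 k p w w / 2)\<bar> \<le> 2 * (s * \<epsilon>) * C"
  proof -
    have "(s * u)\<^sup>2 \<le> \<bar>s * u\<bar> * 1" using su1
      by (metis abs_ge_zero mult_left_mono power2_abs power2_eq_square)
    then have "(s * u)\<^sup>2 \<le> s * \<epsilon>" using su by linarith
    then show ?thesis unfolding abs_mult using C s \<epsilon>(1)
      by (intro mult_mono) (auto simp: C_def abs_mult)
  qed
  have t3: "\<bar>(s * u) ^ 3 * cubic k w\<bar> \<le> 1 * (s * \<epsilon>) * C"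
  proof -
    have "\<bar>(s * u) ^ 3\<bar> \<le> \<bar>s * u\<bar>" using su1 power_decreasing[of 1 3 "\<bar>s * u\<bar>"] by (simp add: power_abs)
    then have "\<bar>(s * u) ^ 3\<bar> \<le> s * \<epsilon>" using su by linarith
    then show ?thesis unfolding abs_mult using C s \<epsilon>(1)
      by (simp only: mult_1, intro mult_mono) (auto simp: C_def abs_mult)
  qed
  have "1 + 3 * s \<le> (1 + s) ^ 3" using s(1) by (simp add: power3_eq_cube algebra_simps)
  moreover have "s * (7 * \<epsilon> * C) < s * 3" using \<epsilon>(3) s(1) by (rule mult_strict_left_mono)
  ultimately show False
    using h1 t1 t2 t3 H_cubic[OF p] unfolding cubic_along_radius by (simp add: algebra_simps)
qed

text \<open>The radial derivative of a defining function is nonzero, so the function has opposite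
  signs at \<open>(1 - s) p\<close> and \<open>(1 + s) p\<close>. This persists for all
  \<open>x\<close> near \<open>p\<close>, and the intermediate value theorem finds a positive
  multiple of \<open>x\<close> in \<open>H\<close>.\<close>

lemma ball_subset_cone:
  assumes p: "p \<in> H"
  obtains e where "0 < e" "ball p e \<subseteq> cone H"
proof -
  obtain f :: "real ^ 'n \<Rightarrow> real" and r
    where fr: "0 < r" "f p = 0" "\<And>x. x \<in> ball p r \<Longrightarrow> f differentiable (at x)"
    "\<exists>v. frechet_derivative f (at p) v \<noteq> 0" "\<And>x. x \<in> ball p r \<Longrightarrow> f x = 0 \<Longrightarrow> x \<in> H"
    by (rule H_defining_function[OF p]) blast
  let ?f' = "frechet_derivative f (at p)"
  have nz: "?f' p \<noteq> 0" by (rule radial_derivative_nonzero[OF p fr])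
  have df: "(f has_derivative ?f') (at p)" using fr by (intro frechet_works) auto
  have lin: "linear ?f'" using df has_derivative_linear by blast
  \<comment> \<open>The sign makes \<open>g = \<sigma> f\<close> increase outwards along the
    radius.\<close>
  define \<sigma> where "\<sigma> = sgn (?f' p)"
  have \<sigma>: "\<sigma> * ?f' p > 0" "\<sigma> \<noteq> 0" using nz by (auto simp: \<sigma>_def sgn_if)
  define g where "g = (\<lambda>x. \<sigma> * f x)"
  have g: "(g has_derivative (\<lambda>v. \<sigma> * ?f' v)) (at p)" "g p = 0"
    using df fr(2) by (auto simp: g_def intro: derivative_intros)
  have gn: "((\<lambda>x. - g x) has_derivative (\<lambda>v. - (\<sigma> * ?f' v))) (at p)" "- g p = 0"
    using g by (auto intro: derivative_intros)
  obtain d1 where d1: "0 < d1" "\<And>s. 0 < s \<Longrightarrow> s < d1 \<Longrightarrow> 0 < g (p + s *\<^sub>R p)"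
    using directional_increase[OF g \<sigma>(1)] by blast
  obtain d2 where d2: "0 < d2" "\<And>s. 0 < s \<Longrightarrow> s < d2 \<Longrightarrow> 0 < - g (p + s *\<^sub>R (- p))"
    using directional_increase[OF gn, of "- p"] \<sigma>(1) by (auto simp: linear_neg[OF lin])
  define s where "s = min (min (d1/2) (d2/2)) (min (1/2) (r / (2 * (norm p + 1))))"
  have np: "0 < norm p + 1" by (simp add: add_nonneg_pos)
  have s: "0 < s" "s < d1" "s < d2" "s < 1" "s * norm p < r"
  proof -
    show "0 < s" "s < d1" "s < d2" "s < 1" using d1 d2 np fr(1) by (auto simp: s_def)
    have "s * norm p \<le> s * (norm p + 1)" using \<open>0 < s\<close> by simp
    also have "\<dots> \<le> r / (2 * (norm p + 1)) * (norm p + 1)" using np by (intro mult_right_mono) (auto simp: s_def)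
    also have "\<dots> < r" using np fr(1) by (simp add: field_simps add_pos_nonneg)
    finally show "s * norm p < r" .
  qed
  let ?P = "(1 + s) *\<^sub>R p" and ?Q = "(1 - s) *\<^sub>R p"
  have PQ: "?P \<in> ball p r" "?Q \<in> ball p r" "0 < g ?P" "g ?Q < 0"
  proof -
    show "?P \<in> ball p r" "?Q \<in> ball p r" using s by (simp_all add: dist_norm algebra_simps)
    show "0 < g ?P" using d1(2)[OF s(1,2)] by (simp add: algebra_simps)
    show "g ?Q < 0" using d2(2)[OF s(1,3)] by (simp add: algebra_simps)
  qed
  have dg: "g differentiable (at x)" if "x \<in> ball p r" for x
    using fr(3)[OF that] by (auto simp: g_def intro: differentiable_mult)
  have cont: "continuous_on (ball p r) g"
    by (intro continuous_at_imp_continuous_on ballI differentiable_imp_continuous_within dg)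
  have op: "open (ball p r \<inter> g -` {0<..})" "open (ball p r \<inter> g -` {..<0})"
    using cont by (auto intro!: continuous_open_preimage)
  \<comment> \<open>The points \<open>x\<close> for which the change of sign between
    \<open>(1 - s) x\<close> and \<open>(1 + s) x\<close> still takes place inside the ball; an open
    condition satisfied by \<open>p\<close>.\<close>
  let ?T = "(\<lambda>x. (1 + s) *\<^sub>R x) -` (ball p r \<inter> g -` {0<..}) \<inter> (\<lambda>x. (1 - s) *\<^sub>R x) -` (ball p r \<inter> g -` {..<0})"
  have "open ?T" by (intro open_Int open_vimage op continuous_intros)
  moreover have "p \<in> ?T" using PQ by auto
  ultimately obtain e where e: "0 < e" "ball p e \<subseteq> ?T" by (rule openE)
  have "ball p e \<subseteq> cone H"
  proof
    fix x assume "x \<in> ball p e"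
    then have x: "(1 + s) *\<^sub>R x \<in> ball p r" "(1 - s) *\<^sub>R x \<in> ball p r" "0 < g ((1 + s) *\<^sub>R x)" "g ((1 - s) *\<^sub>R x) < 0"
      using e(2) by auto
    obtain c where c: "0 \<le> c" "c \<le> 1" "g ((1 - c) *\<^sub>R ((1 - s) *\<^sub>R x) + c *\<^sub>R ((1 + s) *\<^sub>R x)) = 0"
      using zero_on_segment[OF convex_ball dg x(2,1,4,3)] by blast
    define m where "m = (1 - c) * (1 - s) + c * (1 + s)"
    have m: "(1 - c) *\<^sub>R ((1 - s) *\<^sub>R x) + c *\<^sub>R ((1 + s) *\<^sub>R x) = m *\<^sub>R x"
      by (simp add: m_def vec_eq_iff algebra_simps)
    have mpos: "0 < m"
    proof -
      have "m = (1 - s) + 2 * c * s" by (simp add: m_def algebra_simps)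
      then show ?thesis using s c by (simp add: add_pos_nonneg)
    qed
    have "m *\<^sub>R x \<in> ball p r"
      unfolding m[symmetric] using x(1,2) c(1,2) convex_ball[of p r] by (auto simp only: convex_alt)
    moreover have "f (m *\<^sub>R x) = 0" using c(3) \<sigma>(2) by (simp only: m g_def) simp
    ultimately have "m *\<^sub>R x \<in> H" using fr(5) by blast
    moreover have "x = (1 / m) *\<^sub>R (m *\<^sub>R x)" using mpos by simp
    ultimately show "x \<in> cone H" using mpos unfolding cone_def by (smt (verit) mem_Collect_eq zero_less_divide_1_iff)
  qed
  then show ?thesis using that e(1) by blast
qed

lemma cone_scaleR: "t \<in> cone H \<Longrightarrow> 0 < r \<Longrightarrow> r *\<^sub>R t \<in> cone H"
  unfolding cone_def by (auto, metis mult_pos_pos)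

lemma H_subset_cone: "p \<in> H \<Longrightarrow> p \<in> cone H"
  unfolding cone_def by (auto intro!: exI[of _ 1] exI[of _ p])

lemma open_cone: "open (cone H)"
  unfolding open_contains_ball
proof
  fix x assume "x \<in> cone H"
  then obtain r t where x: "x = r *\<^sub>R t" "0 < r" "t \<in> H" by (auto simp: cone_def)
  obtain e where e: "0 < e" "ball t e \<subseteq> cone H" using ball_subset_cone[OF x(3)] by blast
  have "y \<in> cone H" if "y \<in> ball x (r * e)" for y
  proof -
    have "y = r *\<^sub>R ((1/r) *\<^sub>R y)" using x by simp
    moreover have "dist t ((1/r) *\<^sub>R y) = dist x y / r"
    proof -
      have "dist x y = norm (r *\<^sub>R (t - (1/r) *\<^sub>R y))" using x by (simp add: dist_norm scaleR_right_diff_distrib)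
      then show ?thesis using x(2) by (simp add: dist_norm)
    qed
    then have "(1/r) *\<^sub>R y \<in> ball t e" using that x(2) by (simp only: mem_ball pos_divide_less_eq mult.commute)
    ultimately show ?thesis using e(2) cone_scaleR[OF _ x(2), of "(1/r) *\<^sub>R y"] by auto
  qed
  then show "\<exists>e>0. ball x e \<subseteq> cone H" using e(1) x(2) by (intro exI[of _ "r * e"]) auto
qed

lemma cone_segment:
  assumes "t \<in> cone H"
  obtains e where "0 < e" "\<And>s. \<bar>s\<bar> < e \<Longrightarrow> t + s *\<^sub>R x \<in> cone H"
proof -
  have "open ((\<lambda>s. t + s *\<^sub>R x) -` cone H)"
    by (intro open_vimage open_cone continuous_intros)
  moreover have "0 \<in> (\<lambda>s. t + s *\<^sub>R x) -` cone H" using assms by simp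
  ultimately obtain e where "0 < e" "ball 0 e \<subseteq> (\<lambda>s. t + s *\<^sub>R x) -` cone H" by (rule openE)
  then show ?thesis using that by (auto simp: subset_iff dist_norm)
qed

lemma cubic_pos: "t \<in> cone H \<Longrightarrow> 0 < cubic k t"
  unfolding cone_def using H_cubic by (auto simp: cubic_scaleR)

section \<open>Level set, tangent vectors and Hessian\<close>

lemma H_eq_level_set: "t \<in> H \<longleftrightarrow> t \<in> cone H \<and> cubic k t = 1"
proof
  assume t: "t \<in> cone H \<and> cubic k t = 1"
  then obtain r p where r: "t = r *\<^sub>R p" "0 < r" "p \<in> H" by (auto simp: cone_def)
  then have "r ^ 3 = 1 ^ 3" using t H_cubic by (simp add: cubic_scaleR)
  then have "r = 1" using r(2) power_eq_imp_eq_base[of r 3 1] by simp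
  then show "t \<in> H" using r by simp
qed (use H_cubic H_subset_cone in auto)

text \<open>The line \<open>p + s v\<close> is pushed back to \<open>H\<close> along rays: division
  by the cube root of \<open>h\<close> lands in the level set, which inside the cone is
  \<open>H\<close>. Since \<open>h\<close> is stationary at \<open>p\<close> along \<open>v\<close>,
  the factor has derivative \<open>0\<close> and the velocity remains \<open>v\<close>.\<close>

lemma tangent_spaceI:
  assumes p: "p \<in> H" and v: "k3 k p p v = 0"
  shows "v \<in> tangent_space H p"
proof -
  obtain e where e: "0 < e" "\<And>s. \<bar>s\<bar> < e \<Longrightarrow> p + s *\<^sub>R v \<in> cone H"
    using cone_segment[OF H_subset_cone[OF p]] by blast
  have cone: "p + s *\<^sub>R v \<in> cone H" if "s \<in> {-e<..<e}" for s
    using e(2)[of s] that by auto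
  define \<gamma> where "\<gamma> = (\<lambda>s. cubic k (p + s *\<^sub>R v) powr (-1/3) *\<^sub>R (p + s *\<^sub>R v))"
  have smooth: "smooth_on \<gamma> {-e<..<e}"
    unfolding \<gamma>_def using cubic_pos[OF cone] by (intro smooth_intros) auto
  have img: "\<gamma> s \<in> H" if s: "s \<in> {-e<..<e}" for s
  proof -
    let ?h = "cubic k (p + s *\<^sub>R v)"
    have h: "0 < ?h" using cubic_pos[OF cone[OF s]] .
    have "(?h powr (-1/3)) ^ 3 = ?h powr (-1)"
      using h by (simp add: powr_power)
    then have "cubic k (\<gamma> s) = 1" using h by (simp add: \<gamma>_def cubic_scaleR powr_minus)
    moreover have "\<gamma> s \<in> cone H" unfolding \<gamma>_def using cone_scaleR[OF cone[OF s]] h by simp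
    ultimately show ?thesis by (simp add: H_eq_level_set)
  qed
  have "((\<lambda>s. cubic k (p + s *\<^sub>R v)) has_derivative (\<lambda>s. k3 k p p (s *\<^sub>R v) / 2)) (at 0)"
    by (auto intro!: derivative_eq_intros)
  then have "((\<lambda>s. cubic k (p + s *\<^sub>R v)) has_real_derivative 0) (at 0)"
    by (simp add: k3_linear v has_field_derivative_def flip: lambda_zero)
  then have "((\<lambda>s. cubic k (p + s *\<^sub>R v) powr (-1/3)) has_real_derivative 0) (at 0)"
    using H_cubic[OF p] by (auto intro!: derivative_eq_intros)
  moreover have "((\<lambda>s. p + s *\<^sub>R v) has_vector_derivative v) (at 0)"
    by (auto intro!: derivative_eq_intros)
  ultimately have "(\<gamma> has_vector_derivative v) (at 0)"
    unfolding \<gamma>_def using H_cubic[OF p]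
    by (auto dest: has_vector_derivative_scaleR)
  then show ?thesis
    unfolding tangent_space_def using e(1) smooth img H_cubic[OF p]
    by (auto intro!: exI[of _ \<gamma>] exI[of _ e] simp: \<gamma>_def)
qed

lemma partial2_cubic: "partial a (partial b (cubic k)) x = k3 k x (axis a 1) (axis b (1::real))"
proof -
  have ax: "axis a s = s *\<^sub>R axis a (1::real)" for a s by (simp add: axis_def vec_eq_iff)
  have p: "partial b (cubic k) x = k3 k x x (axis b 1) / (2::real)" for b x
  proof -
    have "((\<lambda>s. cubic k (x + axis b s)) has_derivative (\<lambda>s. k3 k x x (s *\<^sub>R axis b 1) / 2)) (at 0)"
    proof -
      have "((\<lambda>s. x + s *\<^sub>R axis b 1) has_derivative (\<lambda>s. s *\<^sub>R axis b 1)) (at (0::real))"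
        by (auto intro!: derivative_eq_intros)
      from has_derivative_cubic[OF this] show ?thesis by (simp flip: ax add: axis_eq_0_iff[THEN iffD2])
    qed
    then have "((\<lambda>s. cubic k (x + axis b s)) has_real_derivative k3 k x x (axis b 1) / 2) (at 0)"
      unfolding has_field_derivative_def by (rule has_derivative_eq_rhs) (auto simp: k3_linear)
    then show ?thesis unfolding partial_def by (rule DERIV_imp_deriv)
  qed
  have "((\<lambda>s. k3 k (x + s *\<^sub>R axis a 1) (x + s *\<^sub>R axis a 1) (axis b 1) / 2) has_derivative
      (\<lambda>s. s * k3 k x (axis a 1) (axis b (1::real)))) (at 0)"
    by (auto intro!: derivative_eq_intros simp: k3_linear k3_commute)
  then have "((\<lambda>s. partial b (cubic k) (x + axis a s)) has_real_derivative k3 k x (axis a 1) (axis b 1)) (at 0)"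
    unfolding p has_field_derivative_def ax[symmetric] by (rule has_derivative_eq_rhs) auto
  then show "partial a (partial b (cubic k)) x = k3 k x (axis a 1) (axis b (1::real))"
    unfolding partial_def[of a] by (rule DERIV_imp_deriv)
qed

lemma sum_axis_real: "(\<Sum>a\<in>UNIV. v$a *\<^sub>R axis a (1::real)) = v"
  using basis_expansion[of v] by (simp add: scalar_mult_eq_scaleR)

lemma k3_sum: "k3 k x (\<Sum>a\<in>I. f a) z = (\<Sum>a\<in>I. k3 k x (f a) z)"
    "k3 k x y (\<Sum>a\<in>I. f a) = (\<Sum>a\<in>I. k3 k x y (f a))"
  by (induction I rule: infinite_finite_induct) (auto simp: k3_linear)

lemma k3_expand: "k3 k p v w = (\<Sum>a\<in>UNIV. \<Sum>b\<in>UNIV. k3 k p (axis a 1) (axis b (1::real)) * v$a * w$b)"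
proof -
  have "k3 k p v w = k3 k p (\<Sum>a\<in>UNIV. v$a *\<^sub>R axis a 1) (\<Sum>b\<in>UNIV. w$b *\<^sub>R axis b 1)"
    by (simp only: sum_axis_real)
  also have "\<dots> = (\<Sum>a\<in>UNIV. \<Sum>b\<in>UNIV. k3 k p (axis a 1) (axis b (1::real)) * v$a * w$b)"
    unfolding k3_sum by (subst sum.swap) (simp add: k3_linear mult_ac)
  finally show ?thesis .
qed

text \<open>A null vector \<open>v\<close> of the Hessian at \<open>p\<close> satisfies in
  particular \<open>k3 k p p v = 0\<close>, so it is tangent to \<open>H\<close>, where the Hessian
  is negative definite. The Hessian at another point of the ray differs by a scalar factor.\<close>

lemma hessian_nondegenerate:
  assumes t: "t \<in> cone H" and v: "\<And>w. k3 k t v w = 0"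
  shows "v = 0"
proof (rule ccontr)
  assume "v \<noteq> 0"
  obtain r p where r: "t = r *\<^sub>R p" "0 < r" "p \<in> H" using t by (auto simp: cone_def)
  have pv: "k3 k p v w = 0" for w using v[of w] r by (simp add: k3_linear)
  have "v \<in> tangent_space H p" using pv[of p] by (intro tangent_spaceI r(3)) (simp add: k3_commute)
  then have "0 < (\<Sum>a\<in>UNIV. \<Sum>b\<in>UNIV. - partial a (partial b (cubic k)) p * v$a * v$b)"
    using psr r(3) \<open>v \<noteq> 0\<close> unfolding psr_manifold_def by blast
  also have "\<dots> = - k3 k p v v"
    by (subst k3_expand) (simp add: partial2_cubic sum_negf)
  finally show False using pv by simp
qed

subsection \<open>Automorphisms\<close>

lemma Aut_H_invertible: "A \<in> Aut_H H \<Longrightarrow> invertible A"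
  by (simp add: Aut_H_def)

lemma Aut_H_cone: "A \<in> Aut_H H \<Longrightarrow> t \<in> cone H \<Longrightarrow> A *v t \<in> cone H"
proof -
  assume A: "A \<in> Aut_H H" and "t \<in> cone H"
  then obtain r p where r: "t = r *\<^sub>R p" "0 < r" "p \<in> H" by (auto simp: cone_def)
  then have "A *v p \<in> H" using A by (auto simp: Aut_H_def)
  then show ?thesis using r by (auto simp: matrix_vector_mult_scaleR cone_def)
qed

text \<open>On the cone the claim follows from homogeneity and \<open>A\<close> preserving
  \<open>H\<close>. For arbitrary \<open>x\<close> the difference of the two cubics along
  \<open>p + s x\<close> is a polynomial in \<open>s\<close> that vanishes near \<open>0\<close>;
  its coefficient of \<open>s^3\<close> is the difference at \<open>x\<close>.\<close>

lemma Aut_H_cubic: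
  assumes A: "A \<in> Aut_H H"
  shows "cubic k (A *v x) = cubic k (x :: real ^ 'n)"
proof -
  have cone: "cubic k (A *v t) = cubic k t" if "t \<in> cone H" for t
  proof -
    obtain r p where r: "t = r *\<^sub>R p" "0 < r" "p \<in> H" using \<open>t \<in> cone H\<close> by (auto simp: cone_def)
    then have "A *v p \<in> H" using A by (auto simp: Aut_H_def)
    then show ?thesis using r H_cubic by (simp add: matrix_vector_mult_scaleR cubic_scaleR)
  qed
  obtain p where p: "p \<in> H" using H_nonempty by blast
  obtain e where e: "0 < e" "\<And>s. \<bar>s\<bar> < e \<Longrightarrow> p + s *\<^sub>R x \<in> cone H"
    using cone_segment[OF H_subset_cone[OF p]] by blast
  define \<phi> where "\<phi> s = cubic k (A *v (p + s *\<^sub>R x)) - cubic k (p + s *\<^sub>R x)" for s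
  have zero: "\<phi> s = 0" if "\<bar>s\<bar> < e" for s
    unfolding \<phi>_def using cone[OF e(2)[OF that]] by simp
  define c where "c = k3 k (A *v p) (A *v p) (A *v x) / 2 - k3 k p p x / 2"
  define d where "d = k3 k (A *v p) (A *v x) (A *v x) / 2 - k3 k p x x / 2"
  have \<phi>: "\<phi> s = s * c + s ^ 2 * d + s ^ 3 * (cubic k (A *v x) - cubic k x)" for s
  proof -
    have "A *v (p + s *\<^sub>R x) = A *v p + s *s (A *v x)" "p + s *\<^sub>R x = p + s *s x"
      by (simp_all add: matrix_vector_right_distrib matrix_vector_mult_scaleR scalar_mult_eq_scaleR)
    then show ?thesis
      unfolding \<phi>_def c_def d_def using cone[OF H_subset_cone[OF p]]
      by (simp add: cubic_add_smult algebra_simps diff_divide_distrib)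
  qed
  define q where "q = e / 3"
  have q: "0 < q" "\<bar>q\<bar> < e" "\<bar>-q\<bar> < e" "\<bar>2 * q\<bar> < e" "\<bar>- (2 * q)\<bar> < e" using e(1) by (auto simp: q_def)
  \<comment> \<open>This combination of values at \<open>q\<close>, \<open>-q\<close>,
    \<open>2q\<close> and \<open>-2q\<close> cancels the quadratic and the linear part and isolates
    the cubic coefficient; \<open>q = e / 3\<close> keeps \<open>2q\<close> inside the
    interval.\<close>
  have "\<phi> (2 * q) - \<phi> (- (2 * q)) - 2 * (\<phi> q - \<phi> (- q)) = 12 * (q ^ 3 * (cubic k (A *v x) - cubic k x))"
    unfolding \<phi> by (simp add: algebra_simps power2_eq_square power3_eq_cube)
  then have "q ^ 3 * (cubic k (A *v x) - cubic k x) = 0"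
    using zero[OF q(2)] zero[OF q(3)] zero[OF q(4)] zero[OF q(5)] by simp
  then show ?thesis using q(1) by simp
qed

lemma Aut_H_subset_Aut_h: "Aut_H H \<subseteq> Aut_h k"
  unfolding Aut_h_def using Aut_H_cubic Aut_H_invertible by blast

lemma Aut_H_k3: "A \<in> Aut_H H \<Longrightarrow> k3 k (A *v x) (A *v y) (A *v z) = k3 k x y (z :: real ^ 'n)"
  by (simp add: k3_polarization matrix_vector_right_distrib[symmetric] Aut_H_cubic)

lemma matrix_inv_works:
  fixes A :: "real ^ 'm::finite ^ 'm"
  assumes "invertible A"
  shows "A ** matrix_inv A = mat 1" "matrix_inv A ** A = mat 1"
    "A *v (matrix_inv A *v x) = x" "matrix_inv A *v (A *v x) = x" "invertible (matrix_inv A)"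
proof -
  have "\<exists>B. A ** B = mat 1 \<and> B ** A = mat 1" using assms by (simp add: invertible_def)
  then have *: "A ** matrix_inv A = mat 1 \<and> matrix_inv A ** A = mat 1"
    unfolding matrix_inv_def by (rule someI_ex)
  then show "A ** matrix_inv A = mat 1" "matrix_inv A ** A = mat 1" "invertible (matrix_inv A)"
    by (auto simp: invertible_def)
  show "A *v (matrix_inv A *v x) = x" "matrix_inv A *v (A *v x) = x"
    using * by (simp_all add: matrix_vector_mul_assoc)
qed

text \<open>\<open>matrix_inv\<close> is defined by choice; uniqueness of inverses allows it to be
  computed by exhibiting a candidate.\<close>

lemma matrix_inv_eqI:
  fixes A :: "real ^ 'm::finite ^ 'm"
  assumes "A ** B = mat 1" "B ** A = mat 1"
  shows "matrix_inv A = B"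
proof -
  have "\<exists>B. A ** B = mat 1 \<and> B ** A = mat 1" using assms by blast
  then have "A ** matrix_inv A = mat 1 \<and> matrix_inv A ** A = mat 1"
    unfolding matrix_inv_def by (rule someI_ex)
  then show ?thesis using assms by (metis matrix_mul_assoc matrix_mul_lid matrix_mul_rid)
qed

lemma Aut_H_mult: "A \<in> Aut_H H \<Longrightarrow> B \<in> Aut_H H \<Longrightarrow> A ** B \<in> Aut_H H"
  unfolding Aut_H_def by (auto simp: invertible_mult matrix_vector_mul_assoc[symmetric] image_image[symmetric])

lemma Aut_H_inv: "A \<in> Aut_H H \<Longrightarrow> matrix_inv A \<in> Aut_H H"
proof -
  assume A: "A \<in> Aut_H H"
  note i = matrix_inv_works[OF Aut_H_invertible[OF A]]
  have "(\<lambda>t. matrix_inv A *v t) ` H = (\<lambda>t. matrix_inv A *v t) ` (\<lambda>t. A *v t) ` H"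
    using A by (simp add: Aut_H_def)
  also have "\<dots> = H" by (simp add: image_image i)
  finally show ?thesis using i by (simp add: Aut_H_def)
qed

lemma Aut_H_one: "mat 1 \<in> Aut_H H"
  by (simp add: Aut_H_def invertible_def)

lemma group_Aut_H: "group (Aut_H_group H)"
proof (rule groupI)
  fix A assume "A \<in> carrier (Aut_H_group H)"
  then show "\<exists>B\<in>carrier (Aut_H_group H). B \<otimes>\<^bsub>Aut_H_group H\<^esub> A = \<one>\<^bsub>Aut_H_group H\<^esub>"
    using Aut_H_inv[of A] matrix_inv_works(2)[of A] Aut_H_invertible[of A]
    by (auto simp: Aut_H_group_def intro!: bexI[of _ "matrix_inv A"])
qed (auto simp: Aut_H_group_def Aut_H_mult Aut_H_one matrix_mul_assoc)

end

section \<open>The metric in real coordinates\<close>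

lemma sum_UNIV_option: "(\<Sum>i\<in>UNIV. f i) = f None + (\<Sum>a\<in>UNIV. f (Some a))"
  for f :: "'n::finite option \<Rightarrow> 'b::comm_monoid_add"
  by (simp add: UNIV_option_conv sum.reindex)

lemma ext_nth [simp]: "ext x0 x $ None = x0" "ext x0 x $ Some a = x $ a"
  by (simp_all add: ext_def)

lemma low_nth [simp]: "low x $ a = x $ Some a"
  by (simp add: low_def)

lemma ext_low: "ext (x $ None) (low x) = x"
  by (simp add: vec_eq_iff ext_def split: option.splits)

lemma low_ext [simp]: "low (ext x0 x) = x"
  by (simp add: vec_eq_iff)

lemma vec_option_eq_iff: "x = y \<longleftrightarrow> x $ None = y $ None \<and> (\<forall>a. x $ Some a = y $ Some a)"
  by (metis not_None_eq vec_eq_iff)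

definition cplx :: "real ^ 'n \<Rightarrow> real ^ 'n \<Rightarrow> complex ^ 'n::finite" where
  "cplx b t = (\<chi> a. Complex (b$a) (t$a))"

lemma re_im_cplx [simp]: "re_vec (cplx b t) = b" "im_vec (cplx b t) = t"
  by (simp_all add: re_vec_def im_vec_def cplx_def vec_eq_iff)

lemma cplx_re_im [simp]: "cplx (re_vec z) (im_vec z) = z"
  by (simp add: re_vec_def im_vec_def cplx_def vec_eq_iff)

lemma cplx_nth [simp]: "cplx b t $ a = Complex (b$a) (t$a)"
  by (simp add: cplx_def)

lemma cplx_split: "cplx b t = cplx b 0 + \<i> *s cplx t 0"
  by (simp add: vec_eq_iff complex_eq_iff)

lemma k3_cplx: "k3 k (cplx x 0) (cplx y 0) (cplx z 0) = of_real (k3 k x y z)"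
proof -
  have *: "cplx x 0 $ a = of_real (x$a)" for x :: "real ^ 'b" and a by (simp add: complex_eq_iff)
  show ?thesis unfolding k3_def * by simp
qed

lemma axis_cplx: "axis a 1 = cplx (axis a 1) 0"
  by (simp add: vec_eq_iff complex_eq_iff axis_def)

section \<open>The second derivatives of the prepotential\<close>

context cubic_form
begin

lemma DERIV_cubic: "((\<lambda>s. cubic k (x + s *s y)) has_field_derivative k3 k x x y / 2) (at 0)"
  unfolding cubic_add_smult by (auto intro!: derivative_eq_intros)

lemma DERIV_k3: "((\<lambda>s. k3 k (x + s *s y) (x + s *s y) z) has_field_derivative 2 * k3 k x y z) (at 0)"
  by (auto intro!: derivative_eq_intros simp: k3_linear k3_commute)

lemma low_axis: "low (X + axis (Some b) s) = low X + s *s axis b 1" "low (X + axis None s) = low X"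
    "(X + axis (Some b) s) $ None = X $ None" "(X + axis None s) $ None = X $ None + s"
  for X :: "complex ^ 'm::finite option"
  by (simp_all add: vec_eq_iff axis_def)

lemma partial_prepotential_Some:
  "partial (Some b) (prepotential k) X = - (k3 k (low X) (low X) (axis b 1) / 2) / X $ None"
  unfolding partial_def prepotential_def low_axis
  by (rule DERIV_imp_deriv, rule DERIV_cdivide, rule DERIV_minus, rule DERIV_cubic)

lemma partial_prepotential_None:
  assumes "X $ None \<noteq> 0"
  shows "partial None (prepotential k) X = cubic k (low X) / (X $ None)\<^sup>2"
  unfolding partial_def prepotential_def low_axis
  using assms by (intro DERIV_imp_deriv) (auto intro!: derivative_eq_intros simp: power2_eq_square)

lemma tau_eq:
  "tau k z $ Some a $ Some b = - k3 k z (axis a 1) (axis b 1)"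
  "tau k z $ None $ Some b = k3 k z z (axis b 1) / 2"
  "tau k z $ Some a $ None = k3 k z z (axis a 1) / 2"
  "tau k z $ None $ None = - 2 * cubic k z"
proof -
  show "tau k z $ Some a $ Some b = - k3 k z (axis a 1) (axis b 1)"
    unfolding tau_def vec_lambda_beta partial_def[of "Some a"] partial_prepotential_Some low_axis low_ext ext_nth
    by (rule DERIV_imp_deriv) (auto intro!: derivative_eq_intros DERIV_k3)
  show "tau k z $ None $ Some b = k3 k z z (axis b 1) / 2"
    unfolding tau_def vec_lambda_beta partial_def[of "None"] partial_prepotential_Some low_axis low_ext ext_nth
    by (rule DERIV_imp_deriv) (auto intro!: derivative_eq_intros)
  show "tau k z $ Some a $ None = k3 k z z (axis a 1) / 2"
  proof -
    have "(\<lambda>s. partial None (prepotential k) (ext 1 z + axis (Some a) s)) = (\<lambda>s. cubic k (z + s *s axis a 1))"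
      by (subst partial_prepotential_None) (auto simp del: vector_add_component simp: low_axis)
    then show ?thesis
      unfolding tau_def vec_lambda_beta partial_def[of "Some a"]
      by (simp only:) (rule DERIV_imp_deriv, rule DERIV_cubic)
  qed
  show "tau k z $ None $ None = - 2 * cubic k z"
    unfolding tau_def vec_lambda_beta partial_def[of None "partial None (prepotential k)"]
  \<comment> \<open>The formula for the first derivative holds where \<open>X^0 = 1 + s\<close> is
    nonzero, which is guaranteed on the unit ball about \<open>s = 0\<close>.\<close>
  proof (rule DERIV_imp_deriv, rule has_field_derivative_transform_within_open)
    show "((\<lambda>s. cubic k z / (1 + s)\<^sup>2) has_field_derivative - 2 * cubic k z) (at 0)"
      by (auto intro!: derivative_eq_intros)
    show "cubic k z / (1 + s)\<^sup>2 = partial None (prepotential k) (ext 1 z + axis None s)" if "s \<in> ball 0 1" for s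
    proof -
      have "1 + s \<noteq> 0" using that by (auto simp: add_eq_0_iff)
      then show ?thesis
        by (subst partial_prepotential_None) (auto simp del: vector_add_component simp: low_axis)
    qed
  qed auto
qed

lemma k3_zz: "k3 k (cplx b t) (cplx b t) (cplx x 0) = Complex (k3 k b b x - k3 k t t x) (2 * k3 k b t x)"
  unfolding cplx_split[of b t] by (simp add: k3_linear k3_cplx complex_eq_iff k3_commute)

lemma k3_z: "k3 k (cplx b t) (cplx y 0) (cplx x 0) = Complex (k3 k b y x) (k3 k t y x)"
  unfolding cplx_split[of b t] by (simp add: k3_linear k3_cplx complex_eq_iff)

lemma k3_zzz: "k3 k (cplx b t) (cplx b t) (cplx b t) =
    Complex (k3 k b b b - 3 * k3 k b t t) (3 * k3 k b b t - k3 k t t t)"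
  unfolding cplx_split[of b t] by (simp add: k3_linear k3_cplx complex_eq_iff k3_commute)

lemma k3_axis_sum: "(\<Sum>b\<in>UNIV. k3 k x y (axis b 1) * w$b) = k3 k x y (w :: real ^ 'n)"
  unfolding k2_inner(1)[symmetric] inner_axis by (simp add: inner_vec_def[of "k2 k x y" w])

lemma k2_nth: "k2 k x y $ a = k3 k x y (axis a 1)"
  by (simp add: k2_inner(1)[symmetric] inner_axis)

end

text \<open>\<open>form_Y\<close>, \<open>form_A\<close> and \<open>form_E\<close> are the
  \<open>w\<close>-, \<open>u\<close>- and \<open>u0\<close>-components of a tangent vector after
  the linear transformation of \<open>(u0, u, w0, w)\<close> that accompanies the shift of
  \<open>b\<close> to \<open>0\<close>. In this frame the coefficients of the metric depend on
  \<open>t\<close> and \<open>\<rho>\<close> alone.\<close>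

definition form_Y :: "real ^ 'n \<Rightarrow> real \<Rightarrow> real ^ 'n \<Rightarrow> real ^ 'n" where
  "form_Y b w0 w = w - w0 *\<^sub>R b"

definition form_A :: "'n::finite coeffs \<Rightarrow> real ^ 'n \<Rightarrow> real ^ 'n \<Rightarrow> real \<Rightarrow> real ^ 'n \<Rightarrow> real ^ 'n" where
  "form_A k b u w0 w = u + k2 k b (form_Y b w0 w) + (w0 / 2) *\<^sub>R k2 k b b"

definition form_E :: "'n::finite coeffs \<Rightarrow> real ^ 'n \<Rightarrow> real \<Rightarrow> real ^ 'n \<Rightarrow> real \<Rightarrow> real ^ 'n \<Rightarrow> real" where
  "form_E k b u0 u w0 w = u0 + b \<bullet> u + w0 * k3 k b b b / 3 + k3 k b b (form_Y b w0 w) / 2"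

definition hess :: "'n::finite coeffs \<Rightarrow> real ^ 'n \<Rightarrow> real ^ 'n ^ 'n" where
  "hess k t = (\<chi> a b. k3 k t (axis a 1) (axis b 1))"

text \<open>The Hessian of \<open>log h\<close> at \<open>t\<close>, where
  \<open>k3 k t t x / 2\<close> is the derivative of \<open>h\<close> along
  \<open>x\<close>.\<close>

definition log_hess :: "'n::finite coeffs \<Rightarrow> real ^ 'n \<Rightarrow> real ^ 'n \<Rightarrow> real ^ 'n \<Rightarrow> real" where
  "log_hess k t x y = k3 k t x y / cubic k t - (k3 k t t x / 2) * (k3 k t t y / 2) / (cubic k t)\<^sup>2"

lemma (in cubic_form) W_form_Some:
  "W_form k (cplx b t) (ext u0 u) (ext w0 w) (Some a) =
    Complex ((form_A k b u w0 w + (w0 / 2) *\<^sub>R k2 k t t) $ a) (k2 k t (form_Y b w0 w) $ a)"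
proof -
  have "x $ a = x \<bullet> axis a 1" for x :: "real ^ 'n" by (simp add: inner_axis)
  note * = this[of "form_A k b u w0 w + _"] this[of "k2 k t _"] this[of u]
  have s: "(\<Sum>c\<in>UNIV. tau k (cplx b t) $ Some a $ Some c * complex_of_real (w $ c)) =
    - Complex (k3 k b (axis a 1) w) (k3 k t (axis a 1) w)"
    unfolding tau_eq axis_cplx k3_z
    by (simp add: complex_eq_iff sum_negf k3_axis_sum)
  have tn: "tau k (cplx b t) $ Some a $ None =
      Complex (k3 k b b (axis a 1) / 2 - k3 k t t (axis a 1) / 2) (k3 k b t (axis a 1))"
    unfolding tau_eq axis_cplx k3_zz by (simp add: complex_eq_iff diff_divide_distrib)
  show ?thesis
    unfolding W_form_def sum_UNIV_option ext_nth s tn *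
    by (simp add: complex_eq_iff form_A_def form_Y_def inner_add_left k2_inner k3_linear k3_commute algebra_simps)
qed

lemma (in cubic_form) W_form_None:
  "W_form k (cplx b t) (ext u0 u) (ext w0 w) None = Complex
     (u0 - (k3 k b b w - k3 k t t w) / 2 + w0 * (k3 k b b b - 3 * k3 k b t t) / 3)
     (- k3 k b t w + w0 * (3 * k3 k b b t - k3 k t t t) / 3)"
proof -
  have s: "(\<Sum>c\<in>UNIV. tau k (cplx b t) $ None $ Some c * complex_of_real (w $ c)) =
    Complex ((k3 k b b w - k3 k t t w) / 2) (k3 k b t w)"
    unfolding tau_eq axis_cplx k3_zz
    by (simp add: complex_eq_iff left_diff_distrib diff_divide_distrib sum_subtractf sum_divide_distrib[symmetric]
        mult.assoc sum_distrib_left[symmetric] k3_axis_sum)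
  show ?thesis
    unfolding W_form_def sum_UNIV_option ext_nth s unfolding tau_eq cubic_k3 k3_zzz
    by (simp add: complex_eq_iff algebra_simps)
qed

lemma (in cubic_form) N_mat_eq:
  "N_mat k (cplx b t) $ Some a $ Some c = 2 * k3 k t (axis a 1) (axis c 1)"
  "N_mat k (cplx b t) $ Some a $ None = - 2 * k3 k b t (axis a 1)"
  "N_mat k (cplx b t) $ None $ Some a = - 2 * k3 k b t (axis a 1)"
  "N_mat k (cplx b t) $ None $ None = 2 * k3 k b b t - 2 / 3 * k3 k t t t"
  unfolding N_mat_def vec_lambda_beta tau_eq axis_cplx k3_z k3_zz cubic_k3 k3_zzz
  by (simp_all add: diff_divide_distrib)

lemma (in cubic_form) hess_mult: "hess k t *v x = k2 k t x"
  by (simp add: vec_eq_iff matrix_vector_mult_def hess_def k3_axis_sum k2_nth k3_commute)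

lemma matrix_vector_ext:
  "M *v ext x0 x = ext (M $ None $ None * x0 + (\<Sum>c\<in>UNIV. M $ None $ Some c * x$c))
     (\<chi> a. M $ Some a $ None * x0 + (\<Sum>c\<in>UNIV. M $ Some a $ Some c * x$c))"
  by (simp add: vec_option_eq_iff matrix_vector_mult_def sum_UNIV_option)

section \<open>The inverse of \<open>N\<close> and the term of the metric in
  \<open>W\<close>\<close>

context psr
begin

definition "hinv t = matrix_inv (hess k t)"

lemma hess_inv:
  assumes t: "t \<in> cone H"
  shows "k2 k t (hinv t *v x) = x" "hinv t *v (k2 k t x) = x"
proof -
  have "inj ((*v) (hess k t))"
  proof (rule linear_injective_0[THEN iffD2, OF matrix_vector_mul_linear], intro allI impI)
    fix x assume "hess k t *v x = 0"
    then have "k3 k t x w = 0" for w by (simp add: hess_mult k2_inner(1)[symmetric])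
    then show "x = 0" by (rule hessian_nondegenerate[OF t])
  qed
  then have "invertible (hess k t)"
    by (simp add: invertible_left_inverse matrix_left_invertible_injective)
  then show "k2 k t (hinv t *v x) = x" "hinv t *v (k2 k t x) = x"
    unfolding hinv_def hess_mult[symmetric] by (rule matrix_inv_works)+
qed

lemma hinv_sym: "t \<in> cone H \<Longrightarrow> x \<bullet> (hinv t *v y) = y \<bullet> (hinv t *v x)"
  using hess_inv(1)[of t x] hess_inv(1)[of t y]
  by (metis inner_commute k2_inner(1) k3_commute(2))

text \<open>At \<open>b = 0\<close> the matrix \<open>N\<close> consists of the block
  \<open>2 * hess\<close> and the corner entry \<open>-4 h\<close>. Undoing the shift by
  \<open>b\<close> turns the inverse into \<open>hinv / 2\<close> on the block minus the rank one
  matrix built from the vector \<open>(1, b)\<close>, divided by \<open>4 h\<close>.\<close>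

lemma inv_N_mat:
  assumes t: "t \<in> cone H"
  shows "matrix_inv (N_mat k (cplx b t)) $ Some a $ Some c = hinv t $ a $ c / 2 - b$a * b$c / (4 * cubic k t)"
    "matrix_inv (N_mat k (cplx b t)) $ Some a $ None = - b$a / (4 * cubic k t)"
    "matrix_inv (N_mat k (cplx b t)) $ None $ Some a = - b$a / (4 * cubic k t)"
    "matrix_inv (N_mat k (cplx b t)) $ None $ None = - 1 / (4 * cubic k t)"
proof -
  let ?h = "cubic k t"
  define N where "N = N_mat k (cplx b t)"
  define M :: "real ^ 'n option ^ 'n option" where "M = (\<chi> i j. case i of
      None \<Rightarrow> (case j of None \<Rightarrow> - 1 / (4 * ?h) | Some c \<Rightarrow> - b$c / (4 * ?h))
    | Some a \<Rightarrow> (case j of None \<Rightarrow> - b$a / (4 * ?h) | Some c \<Rightarrow> hinv t $ a $ c / 2 - b$a * b$c / (4 * ?h)))"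
  have h: "?h > 0" using cubic_pos[OF t] .
  have "N *v (M *v ext x0 x) = ext x0 x" for x0 and x :: "real ^ 'n"
  proof -
    \<comment> \<open>The pairing of the vector with \<open>(1, b)\<close>, divided by
      \<open>4 h\<close>: the contribution of the rank one part.\<close>
    define \<kappa> where "\<kappa> = (x0 + b \<bullet> x) / (4 * ?h)"
    have Mx: "M *v ext x0 x = ext (- \<kappa>) ((1/2) *\<^sub>R (hinv t *v x) - \<kappa> *\<^sub>R b)"
      unfolding matrix_vector_ext
      by (simp add: M_def vec_option_eq_iff \<kappa>_def inner_vec_def sum_divide_distrib[symmetric] sum_negf
          matrix_vector_mult_def algebra_simps sum_subtractf sum_distrib_left add_divide_distrib)
    have Ny: "N *v ext y0 y = ext ((2 * k3 k b b t - 2 / 3 * k3 k t t t) * y0 - 2 * k3 k b t y)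
        ((- 2 * y0) *\<^sub>R k2 k b t + 2 *\<^sub>R k2 k t y)" for y0 and y :: "real ^ 'n"
    proof -
      have "k2 k x y $ a = k3 k x y (axis a 1)" for x y a by (simp add: k2_inner[symmetric] inner_axis)
      moreover have "(\<Sum>c\<in>UNIV. 2 * k3 k t (axis a 1) (axis c 1) * y $ c) = 2 * k3 k t (axis a 1) y" for a
        by (simp add: mult.assoc sum_distrib_left[symmetric] sum_negf k3_axis_sum)
      moreover have "(\<Sum>c\<in>UNIV. - 2 * k3 k b t (axis c 1) * y $ c) = - 2 * k3 k b t y"
        by (simp add: mult.assoc sum_distrib_left[symmetric] sum_negf k3_axis_sum)
      ultimately show ?thesis
        unfolding matrix_vector_ext N_def N_mat_eq by (simp add: vec_option_eq_iff k3_commute)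
    qed
    have kH: "k3 k b t (hinv t *v x) = b \<bullet> x"
      by (metis hess_inv(1)[OF t] k2_inner(2) k3_commute)
    have "k3 k t t t = 6 * ?h" by (simp add: cubic_k3)
    then show ?thesis
      unfolding Mx Ny using h
      by (simp add: k2_linear k3_linear hess_inv(1)[OF t] kH k3_commute k2_commute[of b t] algebra_simps)
        (simp add: \<kappa>_def field_simps)
  qed
  then have "N *v (M *v x) = x" for x by (metis ext_low)
  then have "N ** M = mat 1" by (simp add: matrix_eq matrix_vector_mul_assoc[symmetric])
  then have "matrix_inv N = M" by (intro matrix_inv_eqI) (auto simp: matrix_left_right_inverse)
  then show "matrix_inv (N_mat k (cplx b t)) $ Some a $ Some c = hinv t $ a $ c / 2 - b$a * b$c / (4 * cubic k t)"
    "matrix_inv (N_mat k (cplx b t)) $ Some a $ None = - b$a / (4 * cubic k t)"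
    "matrix_inv (N_mat k (cplx b t)) $ None $ Some a = - b$a / (4 * cubic k t)"
    "matrix_inv (N_mat k (cplx b t)) $ None $ None = - 1 / (4 * cubic k t)"
    by (simp_all add: N_def M_def)
qed

lemma metric_M_cplx:
  assumes t: "t \<in> cone H"
  shows "metric_M k (cplx b t) (cplx vb vt) (cplx wb wt) = - (log_hess k t vb wb + log_hess k t vt wt) / 4"
proof -
  have ax: "s *s axis a (1::real) = axis a s" for a s by (simp add: axis_def vec_eq_iff)
  have 1: "partial c (\<lambda>t. ln (cubic k t)) x = k3 k x x (axis c 1) / 2 / cubic k x" if "x \<in> cone H" for c x
  proof -
    have pos: "0 < cubic k (x + 0 *s axis c 1)" using cubic_pos[OF that] by simp
    have "((\<lambda>s. ln (cubic k (x + s *s axis c 1))) has_real_derivative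
        1 / cubic k (x + 0 *s axis c 1) * (k3 k x x (axis c 1) / 2)) (at 0)"
      by (rule DERIV_chain2[OF DERIV_ln_divide[OF pos] DERIV_cubic])
    then show ?thesis unfolding partial_def
      by (intro DERIV_imp_deriv) (simp add: ax axis_eq_0_iff[THEN iffD2] mult.commute)
  qed
  have 2: "partial a (partial c (\<lambda>t. ln (cubic k t))) t = log_hess k t (axis a 1) (axis c 1)" for a c
  proof -
    let ?f = "\<lambda>s. k3 k (t + s *s axis a 1) (t + s *s axis a 1) (axis c 1) / 2 / cubic k (t + s *s axis a 1)"
    have "(?f has_real_derivative log_hess k t (axis a 1) (axis c 1)) (at 0)"
      by (rule DERIV_cong[OF DERIV_divide[OF DERIV_cdivide[OF DERIV_k3] DERIV_cubic]])
        (use cubic_pos[OF t] in \<open>simp_all add: log_hess_def field_simps power2_eq_square\<close>)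
    moreover have "open ((\<lambda>s. t + s *s axis a (1::real)) -` cone H)"
      unfolding scalar_mult_eq_scaleR by (intro open_vimage open_cone continuous_intros)
    moreover have "0 \<in> (\<lambda>s. t + s *s axis a (1::real)) -` cone H" using t by simp
    ultimately have "((\<lambda>s. partial c (\<lambda>t. ln (cubic k t)) (t + axis a s)) has_real_derivative
        log_hess k t (axis a 1) (axis c 1)) (at 0)"
      by (rule has_field_derivative_transform_within_open) (simp add: 1 ax)
    then show ?thesis unfolding partial_def[of a] by (rule DERIV_imp_deriv)
  qed
  have lh: "log_hess k t x y = (\<Sum>a\<in>UNIV. \<Sum>c\<in>UNIV. log_hess k t (axis a 1) (axis c 1) * (x$a * y$c))" for x y
  proof -
    have "(\<Sum>a\<in>UNIV. \<Sum>c\<in>UNIV. log_hess k t (axis a 1) (axis c 1) * (x$a * y$c)) =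
      (\<Sum>a\<in>UNIV. \<Sum>c\<in>UNIV. k3 k t (axis a 1) (axis c 1) * x$a * y$c) / cubic k t -
      (\<Sum>a\<in>UNIV. k3 k t t (axis a 1) * x$a) * (\<Sum>c\<in>UNIV. k3 k t t (axis c 1) * y$c) / (4 * (cubic k t)\<^sup>2)"
      by (simp add: log_hess_def algebra_simps sum_subtractf sum_divide_distrib sum_product)
    also have "\<dots> = log_hess k t x y"
      unfolding k3_expand[of t x y, symmetric] k3_axis_sum by (simp add: log_hess_def)
    finally show ?thesis by simp
  qed
  show ?thesis
    unfolding metric_M_def re_im_cplx 2 lh[of vb] lh[of vt]
    by (simp add: algebra_simps sum.distrib)
qed

text \<open>The rank one part of the inverse of \<open>N\<close> and the term in \<open>z\<close>
  and its conjugate are both products of contractions: \<open>B\<close> pairs \<open>W\<close> with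
  \<open>(1, b)\<close> and \<open>Z\<close> pairs it with \<open>(1, z)\<close>. What remains is
  quadratic in \<open>hinv\<close>. In the real part of the sum the terms mixing
  \<open>form_E\<close> with \<open>form_Y\<close> and those mixing \<open>w0\<close> with
  \<open>form_A\<close> cancel.\<close>

lemma W_part:
  assumes t: "t \<in> cone H"
  shows "Re (\<Sum>i\<in>UNIV. \<Sum>j\<in>UNIV.
         (of_real (matrix_inv (N_mat k (cplx b t)) $ i $ j)
            - of_real (2 / (8 * cubic k t)) * ext 1 (cplx b t) $ i * cnj (ext 1 (cplx b t) $ j))
         * W_form k (cplx b t) (ext u0 u) (ext w0 w) i * cnj (W_form k (cplx b t) (ext u0' u') (ext w0' w') j)) =
      form_A k b u w0 w \<bullet> (hinv t *v form_A k b u' w0' w') / 2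
      - (t \<bullet> form_A k b u w0 w) * (t \<bullet> form_A k b u' w0' w') / (4 * cubic k t)
      + k3 k t (form_Y b w0 w) (form_Y b w0' w') / 2
      - k3 k t t (form_Y b w0 w) * k3 k t t (form_Y b w0' w') / (8 * cubic k t)
      - form_E k b u0 u w0 w * form_E k b u0' u' w0' w' / (2 * cubic k t)
      - cubic k t / 2 * w0 * w0'"
proof -
  let ?h = "cubic k t"
  define V where "V = W_form k (cplx b t) (ext u0 u) (ext w0 w)"
  define V' where "V' = W_form k (cplx b t) (ext u0' u') (ext w0' w')"
  define A where "A = form_A k b u w0 w"
  define A' where "A' = form_A k b u' w0' w'"
  define Y where "Y = form_Y b w0 w"
  define Y' where "Y' = form_Y b w0' w'"
  define E where "E = form_E k b u0 u w0 w"
  define E' where "E' = form_E k b u0' u' w0' w'"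
  define P where "P = A + (w0 / 2) *\<^sub>R k2 k t t"
  define P' where "P' = A' + (w0' / 2) *\<^sub>R k2 k t t"
  have h: "?h > 0" using cubic_pos[OF t] .
  have h6: "k3 k t t t = 6 * ?h" by (simp add: cubic_k3)
  have VS: "V (Some a) = Complex (P$a) (k2 k t Y$a)" "V' (Some a) = Complex (P'$a) (k2 k t Y'$a)" for a
    unfolding V_def V'_def W_form_Some P_def P'_def A_def A'_def Y_def Y'_def by simp_all
  define B where "B = V None + (\<Sum>a\<in>UNIV. of_real (b$a) * V (Some a))"
  define B' where "B' = V' None + (\<Sum>a\<in>UNIV. of_real (b$a) * V' (Some a))"
  define Z where "Z = V None + (\<Sum>a\<in>UNIV. cplx b t $ a * V (Some a))"
  define Z' where "Z' = V' None + (\<Sum>a\<in>UNIV. cplx b t $ a * V' (Some a))"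
  have sums: "(\<Sum>a\<in>UNIV. of_real (b$a) * V (Some a)) = Complex (b \<bullet> P) (k3 k t Y b)"
    "(\<Sum>a\<in>UNIV. of_real (b$a) * V' (Some a)) = Complex (b \<bullet> P') (k3 k t Y' b)"
    "(\<Sum>a\<in>UNIV. cplx b t $ a * V (Some a)) = Complex (b \<bullet> P - k3 k t Y t) (t \<bullet> P + k3 k t Y b)"
    "(\<Sum>a\<in>UNIV. cplx b t $ a * V' (Some a)) = Complex (b \<bullet> P' - k3 k t Y' t) (t \<bullet> P' + k3 k t Y' b)"
    unfolding VS by (simp_all add: complex_eq_iff inner_vec_def k2_inner(2)[symmetric] sum_subtractf sum.distrib add.commute)
  have B: "B = Complex (E + k3 k t t Y / 2) (- 2 * ?h * w0)" "B' = Complex (E' + k3 k t t Y' / 2) (- 2 * ?h * w0')"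
    unfolding B_def B'_def sums unfolding V_def V'_def W_form_None
    by (simp_all add: complex_eq_iff P_def P'_def E_def E'_def A_def A'_def Y_def Y'_def form_A_def form_E_def form_Y_def
        k3_linear k2_linear inner_add_right k2_inner k3_commute h6 inner_diff_right algebra_simps add_divide_distrib diff_divide_distrib)
  have Z: "Z = Complex (E - k3 k t t Y / 2) (t \<bullet> A + ?h * w0)" "Z' = Complex (E' - k3 k t t Y' / 2) (t \<bullet> A' + ?h * w0')"
    unfolding Z_def Z'_def sums unfolding V_def V'_def W_form_None
    by (simp_all add: complex_eq_iff P_def P'_def E_def E'_def A_def A'_def Y_def Y'_def form_A_def form_E_def form_Y_def
        k3_linear k2_linear inner_add_right k2_inner k3_commute h6 inner_diff_right algebra_simps add_divide_distrib diff_divide_distrib)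
  have main: "(\<Sum>i\<in>UNIV. \<Sum>j\<in>UNIV.
         (of_real (matrix_inv (N_mat k (cplx b t)) $ i $ j)
            - of_real (2 / (8 * ?h)) * ext 1 (cplx b t) $ i * cnj (ext 1 (cplx b t) $ j)) * V i * cnj (V' j)) =
     (\<Sum>a\<in>UNIV. \<Sum>c\<in>UNIV. of_real (hinv t $ a $ c / 2) * V (Some a) * cnj (V' (Some c)))
     - of_real (1 / (4 * ?h)) * B * cnj B' - of_real (1 / (4 * ?h)) * Z * cnj Z'"
    unfolding sum_UNIV_option inv_N_mat[OF t] ext_nth B_def B'_def Z_def Z'_def cnj_sum complex_cnj_add
      complex_cnj_mult complex_cnj_complex_of_real
    by (simp add: algebra_simps sum.distrib sum_subtractf sum_product sum_distrib_left sum_distrib_right sum_negf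
        add_divide_distrib diff_divide_distrib sum_divide_distrib)
  have re: "Re (\<Sum>a\<in>UNIV. \<Sum>c\<in>UNIV. of_real (hinv t $ a $ c / 2) * V (Some a) * cnj (V' (Some c)))
     = P \<bullet> (hinv t *v P') / 2 + k2 k t Y \<bullet> (hinv t *v k2 k t Y') / 2"
    unfolding VS
    by (simp add: inner_vec_def matrix_vector_mult_def sum_distrib_left sum.distrib[symmetric] sum_divide_distrib algebra_simps
        add_divide_distrib)
  have PP: "P \<bullet> (hinv t *v P') = A \<bullet> (hinv t *v A') + (w0' / 2) * (t \<bullet> A) + (w0 / 2) * (t \<bullet> A') + w0 * w0' / 4 * (6 * ?h)"
  proof -
    have "k2 k t t \<bullet> (hinv t *v A') = t \<bullet> A'"
      using hinv_sym[OF t, of "k2 k t t" A'] by (simp add: hess_inv(2)[OF t] inner_commute)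
    then show ?thesis
      by (simp add: P_def P'_def matrix_vector_right_distrib matrix_vector_mult_scaleR hess_inv(2)[OF t] inner_add_left
          inner_add_right k2_inner h6 inner_commute[of A t] algebra_simps)
  qed
  show ?thesis
    unfolding V_def[symmetric] V'_def[symmetric] A_def[symmetric] A'_def[symmetric] Y_def[symmetric] Y'_def[symmetric]
      E_def[symmetric] E'_def[symmetric] main minus_complex.sel re PP B Z
    using h by (simp add: hess_inv(2)[OF t] k2_inner k3_commute field_simps)
qed

end

text \<open>Points \<open>((b, t), \<rho>, (u0, u), (w0, w), \<sigma>)\<close>, where \<open>z = b + i t\<close>, and where \<open>u\<close> stands for
  \<open>\<zeta>'\<close> and \<open>w\<close> for \<open>\<zeta>\<close>. All components are real, so that the cubic form enters only through
  \<open>k2\<close> and \<open>k3\<close>.\<close>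

type_synonym 'n flat = "((real ^ 'n) \<times> (real ^ 'n)) \<times> real \<times> (real \<times> (real ^ 'n)) \<times> (real \<times> (real ^ 'n)) \<times> real"

abbreviation "fb \<equiv> \<lambda>q :: 'n::finite flat. fst (fst q)"
abbreviation "ft \<equiv> \<lambda>q :: 'n::finite flat. snd (fst q)"
abbreviation "fr \<equiv> \<lambda>q :: 'n::finite flat. fst (snd q)"
abbreviation "fu0 \<equiv> \<lambda>q :: 'n::finite flat. fst (fst (snd (snd q)))"
abbreviation "fu \<equiv> \<lambda>q :: 'n::finite flat. snd (fst (snd (snd q)))"
abbreviation "fw0 \<equiv> \<lambda>q :: 'n::finite flat. fst (fst (snd (snd (snd q))))"
abbreviation "fw \<equiv> \<lambda>q :: 'n::finite flat. snd (fst (snd (snd (snd q))))"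
abbreviation "fs \<equiv> \<lambda>q :: 'n::finite flat. snd (snd (snd (snd q)))"

definition to_iia :: "'n::finite flat \<Rightarrow> 'n iia" where
  "to_iia q = (cplx (fb q) (ft q), fr q, ext (fu0 q) (fu q), ext (fw0 q) (fw q), fs q)"

definition of_iia :: "'n::finite iia \<Rightarrow> 'n flat" where
  "of_iia p = ((re_vec (fst p), im_vec (fst p)), fst (snd p),
     (fst (snd (snd p)) $ None, low (fst (snd (snd p)))),
     (fst (snd (snd (snd p))) $ None, low (fst (snd (snd (snd p))))), snd (snd (snd (snd p))))"

lemma of_to_iia [simp]: "of_iia (to_iia q) = q"
  by (simp add: of_iia_def to_iia_def)

lemma to_of_iia [simp]: "to_iia (of_iia p) = p"
  by (simp add: of_iia_def to_iia_def ext_low)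

lemma to_iia_eq_iff [simp]: "to_iia q = to_iia r \<longleftrightarrow> q = r"
  by (metis of_to_iia)

lemma ext_linear: "ext (a + b) (x + y) = ext a x + ext b y" "ext (c * a) (c *\<^sub>R x) = c *\<^sub>R ext a x"
  for x y :: "real ^ 'n::finite"
  by (simp_all add: vec_option_eq_iff)

lemma cplx_linear: "cplx (b + b') (t + t') = cplx b t + cplx b' t'" "cplx (c *\<^sub>R b) (c *\<^sub>R t) = c *\<^sub>R cplx b t"
  by (simp_all add: vec_eq_iff complex_eq_iff)

lemma linear_to_iia: "linear to_iia"
proof (rule linearI)
  show "to_iia (q + r) = to_iia q + to_iia r" for q r :: "'a flat"
    by (simp add: to_iia_def prod_eq_iff ext_linear cplx_linear)
  show "to_iia (c *\<^sub>R q) = c *\<^sub>R to_iia q" for c and q :: "'a flat"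
    by (simp add: to_iia_def prod_eq_iff ext_linear cplx_linear)
qed

lemma linear_of_iia: "linear of_iia"
proof (rule linearI)
  show "of_iia (q + r) = of_iia q + of_iia r" for q r :: "'a iia"
    by (metis linear_add[OF linear_to_iia] of_to_iia to_of_iia)
  show "of_iia (c *\<^sub>R q) = c *\<^sub>R of_iia q" for c and q :: "'a iia"
    by (metis linear_scale[OF linear_to_iia] of_to_iia to_of_iia)
qed

lemma bounded_linear_to_iia: "bounded_linear to_iia"
  using linear_to_iia linear_conv_bounded_linear by blast

lemma bounded_linear_of_iia: "bounded_linear of_iia"
  using linear_of_iia linear_conv_bounded_linear by blast

text \<open>The contact form \<open>d\<sigma> + \<zeta>' d\<zeta> - \<zeta> d\<zeta>'\<close> at
  \<open>q\<close>, evaluated on \<open>v\<close>.\<close>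

definition form_S :: "'n::finite flat \<Rightarrow> 'n flat \<Rightarrow> real" where
  "form_S q v = fs v + fu0 q * fw0 v + fu q \<bullet> fw v - fw0 q * fu0 v - fw q \<bullet> fu v"

section \<open>The metric on the domain of real coordinates\<close>

context psr
begin

definition flat_dom :: "'n flat set" where
  "flat_dom = {q. ft q \<in> cone H \<and> 0 < fr q}"

definition flat_metric :: "'n flat \<Rightarrow> 'n flat \<Rightarrow> 'n flat \<Rightarrow> real" where
  "flat_metric q v v' = (let b = fb q; t = ft q; \<rho> = fr q; h = cubic k t;
       A = form_A k b (fu v) (fw0 v) (fw v); A' = form_A k b (fu v') (fw0 v') (fw v');
       Y = form_Y b (fw0 v) (fw v); Y' = form_Y b (fw0 v') (fw v');
       E = form_E k b (fu0 v) (fu v) (fw0 v) (fw v); E' = form_E k b (fu0 v') (fu v') (fw0 v') (fw v')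
     in - (log_hess k t (fb v) (fb v') + log_hess k t (ft v) (ft v')) / 4
      + fr v * fr v' / (4 * \<rho>\<^sup>2)
      - 1 / (4 * \<rho>) * (A \<bullet> (hinv t *v A') / 2 - (t \<bullet> A) * (t \<bullet> A') / (4 * h)
          + k3 k t Y Y' / 2 - k3 k t t Y * k3 k t t Y' / (8 * h)
          - E * E' / (2 * h) - h / 2 * fw0 v * fw0 v')
      + 1 / (64 * \<rho>\<^sup>2) * form_S q v * form_S q v')"

lemma to_iia_in_N_bar [simp]: "to_iia q \<in> N_bar H \<longleftrightarrow> q \<in> flat_dom"
  by (auto simp: N_bar_def M_bar_def flat_dom_def to_iia_def)

lemma of_iia_in_flat_dom [simp]: "of_iia p \<in> flat_dom \<longleftrightarrow> p \<in> N_bar H"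
  by (metis to_iia_in_N_bar to_of_iia)

lemma open_flat_dom: "open flat_dom"
proof -
  have "open ((\<lambda>q. ft q) -` cone H \<inter> (\<lambda>q. fr q) -` {0<..})"
    by (intro open_Int open_vimage open_cone continuous_intros)
  moreover have "(\<lambda>q. ft q) -` cone H \<inter> (\<lambda>q. fr q) -` {0<..} = flat_dom" by (auto simp: flat_dom_def)
  ultimately show ?thesis by simp
qed

lemma N_bar_eq: "N_bar H = of_iia -` flat_dom"
  by (simp only: set_eq_iff vimage_eq of_iia_in_flat_dom simp_thms)

lemma open_N_bar: "open (N_bar H)"
  unfolding N_bar_eq
  by (intro open_vimage open_flat_dom linear_continuous_on bounded_linear_of_iia)

lemma q_metric_to_iia:
  assumes "q \<in> flat_dom"
  shows "q_metric k (to_iia q) (to_iia v) (to_iia w) = flat_metric q v w"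
proof -
  have t: "ft q \<in> cone H" using assms by (simp add: flat_dom_def)
  have S: "fs v + (\<Sum>i\<in>UNIV. ext (fu0 q) (fu q) $ i * ext (fw0 v) (fw v) $ i
      - ext (fw0 q) (fw q) $ i * ext (fu0 v) (fu v) $ i) = form_S q v" for v
    by (simp add: sum_UNIV_option form_S_def inner_vec_def sum_subtractf)
  show ?thesis
    unfolding to_iia_def q_metric.simps S re_im_cplx W_part[OF t] metric_M_cplx[OF t]
    by (simp add: flat_metric_def Let_def)
qed

lemma log_hess_linear:
  "log_hess k t (x + x') y = log_hess k t x y + log_hess k t x' y"
  "log_hess k t x (y + y') = log_hess k t x y + log_hess k t x y'"
  "log_hess k t (r *\<^sub>R x) y = r * log_hess k t x y"
  "log_hess k t x (r *\<^sub>R y) = r * log_hess k t x y"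
  by (simp_all add: log_hess_def k3_linear algebra_simps add_divide_distrib)

lemma log_hess_commute: "log_hess k t x y = log_hess k t y x"
  by (simp add: log_hess_def k3_commute mult.commute)

lemma form_linear:
  "form_Y b (w0 + w0') (w + w') = form_Y b w0 w + form_Y b w0' w'"
  "form_A k b (u + u') (w0 + w0') (w + w') = form_A k b u w0 w + form_A k b u' w0' w'"
  "form_E k b (u0 + u0') (u + u') (w0 + w0') (w + w') = form_E k b u0 u w0 w + form_E k b u0' u' w0' w'"
  "form_S q (v + v') = form_S q v + form_S q v'"
  by (simp_all add: form_A_def form_E_def form_Y_def form_S_def k2_linear k3_linear algebra_simps
      inner_add_right add_divide_distrib diff_divide_distrib)

lemma flat_metric_polarization:
  assumes "q \<in> flat_dom"
  shows "flat_metric q v w = (flat_metric q (v + w) (v + w) - flat_metric q v v - flat_metric q w w) / 2"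
proof -
  have t: "ft q \<in> cone H" using assms by (simp add: flat_dom_def)
  show ?thesis
    unfolding flat_metric_def Let_def fst_add snd_add form_linear log_hess_linear
    using hinv_sym[OF t, of "form_A k (fb q) (fu v) (fw0 v) (fw v)" "form_A k (fb q) (fu w) (fw0 w) (fw w)"]
    by (simp add: k3_linear matrix_vector_right_distrib inner_add_left inner_add_right k3_commute
        log_hess_commute[of _ "fb w" "fb v"] log_hess_commute[of _ "ft w" "ft v"]
        algebra_simps add_divide_distrib diff_divide_distrib)
qed

text \<open>Maps of real coordinates are total functions, arbitrary off \<open>flat_dom\<close>; the
  restriction makes lifts extensional, as elements of \<open>Bij\<close> have to be.\<close>

definition lift :: "('n flat \<Rightarrow> 'n flat) \<Rightarrow> 'n iia \<Rightarrow> 'n iia" where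
  "lift \<phi> = (\<lambda>p\<in>N_bar H. to_iia (\<phi> (of_iia p)))"

text \<open>By polarization it suffices that the quadratic form of the metric is preserved.\<close>

lemma lift_isometry:
  assumes f: "\<And>q. q \<in> flat_dom \<Longrightarrow> f q \<in> flat_dom" "\<And>q. q \<in> flat_dom \<Longrightarrow> f' (f q) = q" "smooth_on f flat_dom"
    and f': "\<And>q. q \<in> flat_dom \<Longrightarrow> f' q \<in> flat_dom" "\<And>q. q \<in> flat_dom \<Longrightarrow> f (f' q) = q" "smooth_on f' flat_dom"
    and D: "\<And>q. q \<in> flat_dom \<Longrightarrow> (f has_derivative D q) (at q)"
    and g: "\<And>q v. q \<in> flat_dom \<Longrightarrow> flat_metric (f q) (D q v) (D q v) = flat_metric q v v"
  shows "lift f \<in> carrier (q_iso k H)"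
proof -
  have smooth: "smooth_on (\<lambda>p. to_iia (g (of_iia p))) (N_bar H)" if "smooth_on g flat_dom" for g
    by (rule smooth_on_linear_compose[OF bounded_linear_to_iia open_N_bar],
        rule smooth_on_compose[OF open_N_bar open_flat_dom _ smooth_on_bounded_linear[OF open_N_bar bounded_linear_of_iia] that])
      auto
  have "restrict (\<lambda>p. to_iia (f (of_iia p))) (N_bar H) \<in> isometries (N_bar H) (q_metric k)"
  proof (rule restrict_in_isometries[OF open_N_bar, where f' = "\<lambda>p. to_iia (f' (of_iia p))"
        and D = "\<lambda>p v. to_iia (D (of_iia p) (of_iia v))"])
    fix p v w assume "p \<in> N_bar H"
    then have q: "of_iia p \<in> flat_dom" by simp
    show "((\<lambda>p. to_iia (f (of_iia p))) has_derivative (\<lambda>v. to_iia (D (of_iia p) (of_iia v)))) (at p)"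
      by (rule bounded_linear.has_derivative[OF bounded_linear_to_iia],
          rule has_derivative_compose[OF bounded_linear_imp_has_derivative[OF bounded_linear_of_iia] D[OF q]])
    have lin: "linear (D (of_iia p))" using D[OF q] has_derivative_linear by blast
    have bil: "flat_metric (f (of_iia p)) (D (of_iia p) v) (D (of_iia p) w) = flat_metric (of_iia p) v w" for v w
      using flat_metric_polarization[OF f(1)[OF q], of "D (of_iia p) v" "D (of_iia p) w"]
        flat_metric_polarization[OF q, of v w] g[OF q, of "v + w"] g[OF q, of v] g[OF q, of w]
      by (simp only: linear_add[OF lin])
    have "q_metric k (to_iia (f (of_iia p))) (to_iia (D (of_iia p) (of_iia v))) (to_iia (D (of_iia p) (of_iia w)))
        = flat_metric (of_iia p) (of_iia v) (of_iia w)"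
      by (simp only: q_metric_to_iia[OF f(1)[OF q]] bil)
    also have "\<dots> = q_metric k p v w"
      using q_metric_to_iia[OF q, of "of_iia v" "of_iia w"] by simp
    finally show "q_metric k (to_iia (f (of_iia p))) (to_iia (D (of_iia p) (of_iia v))) (to_iia (D (of_iia p) (of_iia w)))
        = q_metric k p v w" .
  qed (simp_all add: f(1,2) f'(1,2) smooth f(3) f'(3))
  then show ?thesis by (simp add: lift_def q_iso_def Iso_group_def)
qed

end

section \<open>Affine isometries\<close>

text \<open>Translations by the Heisenberg group generated by the fields \<open>P\<close>,
  \<open>X\<close> and \<open>Z\<close>. The additional terms in the last coordinate are those that
  keep the contact form invariant.\<close>

definition heis :: "real \<times> (real ^ 'n) \<Rightarrow> real \<times> (real ^ 'n) \<Rightarrow> real \<Rightarrow> 'n flat \<Rightarrow> 'n::finite flat" where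
  "heis x p s q = (fst q, fr q, (fu0 q + fst x, fu q + snd x), (fw0 q + fst p, fw q + snd p),
     fs q + s + fu0 q * fst p + fu q \<bullet> snd p - fw0 q * fst x - fw q \<bullet> snd x)"

text \<open>The time one flow of the combination of the fields \<open>V_a\<close> with coefficients
  \<open>v\<close>. The system is nilpotent, so its solution is polynomial, of degree three in
  \<open>v\<close>.\<close>

definition b_shift :: "('n \<Rightarrow> 'n \<Rightarrow> 'n \<Rightarrow> real) \<Rightarrow> real ^ 'n \<Rightarrow> 'n flat \<Rightarrow> 'n::finite flat" where
  "b_shift k v q = ((fb q + v, ft q), fr q,
     (fu0 q - fu q \<bullet> v + k3 k v v (fw q) / 2 + fw0 q * k3 k v v v / 6,
      fu q - k2 k v (fw q) - (fw0 q / 2) *\<^sub>R k2 k v v),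
     (fw0 q, fw q + fw0 q *\<^sub>R v), fs q)"

text \<open>The contragredient action, for components with lower indices.\<close>

definition dual :: "real ^ 'n ^ 'n \<Rightarrow> real ^ 'n \<Rightarrow> real ^ 'n::finite" where
  "dual A x = matrix_inv (transpose A) *v x"

text \<open>An automorphism combined with a dilation: \<open>c = 1\<close> gives
  \<open>Aut_act\<close>, and \<open>A = mat 1\<close> with \<open>c = exp (s / 2)\<close> gives the
  flow of \<open>D\<close>, under which \<open>\<rho>\<close> and \<open>\<sigma>\<close> have
  weight \<open>1\<close> and all components of \<open>\<zeta>\<close> and \<open>\<zeta>'\<close>
  weight \<open>1/2\<close>.\<close>

definition lin_act :: "real \<Rightarrow> real ^ 'n ^ 'n \<Rightarrow> 'n flat \<Rightarrow> 'n::finite flat" where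
  "lin_act c A q = ((A *v fb q, A *v ft q), c\<^sup>2 * fr q, (c * fu0 q, c *\<^sub>R dual A (fu q)),
     (c * fw0 q, c *\<^sub>R (A *v fw q)), c\<^sup>2 * fs q)"

context psr
begin

lemma heis_isometry: "lift (heis x p s) \<in> carrier (q_iso k H)"
proof (rule lift_isometry[where f' = "heis (- x) (- p) (- s)"
      and D = "\<lambda>q v. (fst v, fr v, (fu0 v, fu v), (fw0 v, fw v),
        fs v + fu0 v * fst p + fu v \<bullet> snd p - fw0 v * fst x - fw v \<bullet> snd x)"])
  have smooth: "smooth_on (heis x p s) flat_dom" for x p s
    unfolding heis_def by (intro smooth_intros open_flat_dom)
  show "smooth_on (heis x p s) flat_dom" "smooth_on (heis (- x) (- p) (- s)) flat_dom" by (rule smooth)+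
  show "(heis x p s has_derivative (\<lambda>v. (fst v, fr v, (fu0 v, fu v), (fw0 v, fw v),
        fs v + fu0 v * fst p + fu v \<bullet> snd p - fw0 v * fst x - fw v \<bullet> snd x))) (at q)" for q
    unfolding heis_def[abs_def] by (rule has_derivative_eq_rhs, (rule derivative_intros)+) auto
  show "flat_metric (heis x p s q) (fst v, fr v, (fu0 v, fu v), (fw0 v, fw v),
        fs v + fu0 v * fst p + fu v \<bullet> snd p - fw0 v * fst x - fw v \<bullet> snd x)
      (fst v, fr v, (fu0 v, fu v), (fw0 v, fw v),
        fs v + fu0 v * fst p + fu v \<bullet> snd p - fw0 v * fst x - fw v \<bullet> snd x) = flat_metric q v v" for q v
  proof -
    have "form_S (heis x p s q) (fst v, fr v, (fu0 v, fu v), (fw0 v, fw v),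
        fs v + fu0 v * fst p + fu v \<bullet> snd p - fw0 v * fst x - fw v \<bullet> snd x) = form_S q v"
      by (simp add: form_S_def heis_def inner_add_left algebra_simps inner_commute)
    then show ?thesis
      unfolding flat_metric_def Let_def by (simp add: heis_def)
  qed
qed (simp_all add: heis_def flat_dom_def prod_eq_iff inner_add_left inner_minus_right algebra_simps inner_commute)

lemma b_shift_add: "b_shift k v (b_shift k v' q) = b_shift k (v + v') q"
proof -
  have u: "fu q - k2 k v' (fw q) - (fw0 q / 2) *\<^sub>R k2 k v' v' - k2 k v (fw q + fw0 q *\<^sub>R v') - (fw0 q / 2) *\<^sub>R k2 k v v
      = fu q - k2 k (v + v') (fw q) - (fw0 q / 2) *\<^sub>R k2 k (v + v') (v + v')"
    by (rule vec_eq_innerI)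
      (simp add: k2_inner k3_linear k3_commute inner_add_left inner_diff_left algebra_simps add_divide_distrib)
  have u0: "fu0 (b_shift k v (b_shift k v' q)) = fu0 (b_shift k (v + v') q)"
    by (simp add: b_shift_def k2_inner k3_linear k3_commute inner_add_right inner_diff_left algebra_simps add_divide_distrib)
  have "fu (b_shift k v (b_shift k v' q)) = fu (b_shift k (v + v') q)"
    using u by (simp add: b_shift_def)
  then show ?thesis
    by (simp add: prod_eq_iff u0) (simp add: b_shift_def algebra_simps)
qed

lemma b_shift_zero: "b_shift k 0 q = q"
  unfolding b_shift_def by (simp add: k3_linear k2_linear)

text \<open>The map is linear in all coordinates but \<open>b\<close>, which it translates; this
  explains its derivative. \<open>form_Y\<close>, \<open>form_A\<close>, \<open>form_E\<close> and
  \<open>form_S\<close> are literally unchanged, and \<open>b\<close> enters the metric in no other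
  way than through them and \<open>db\<close>.\<close>

lemma b_shift_isometry: "lift (b_shift k v) \<in> carrier (q_iso k H)"
proof (rule lift_isometry[where f' = "b_shift k (- v)" and D = "\<lambda>q d. (fst d, snd (b_shift k v d))"])
  have smooth: "smooth_on (b_shift k v) flat_dom" for v
    unfolding b_shift_def[abs_def] divide_inverse by (intro smooth_intros open_flat_dom)
  show "smooth_on (b_shift k v) flat_dom" "smooth_on (b_shift k (- v)) flat_dom" by (rule smooth)+
  show "(b_shift k v has_derivative (\<lambda>d. (fst d, snd (b_shift k v d)))) (at q)" for q
    unfolding b_shift_def[abs_def] divide_inverse by (rule has_derivative_eq_rhs, (rule derivative_intros)+)
      (auto simp: k3_linear k2_linear)
  show "flat_metric (b_shift k v q) (fst d, snd (b_shift k v d)) (fst d, snd (b_shift k v d)) = flat_metric q d d" for q d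
  proof -
    let ?d = "(fst d, snd (b_shift k v d))"
    have Y: "form_Y (fb (b_shift k v q)) (fw0 ?d) (fw ?d) = form_Y (fb q) (fw0 d) (fw d)"
      by (simp add: form_Y_def b_shift_def algebra_simps)
    have A: "form_A k (fb (b_shift k v q)) (fu ?d) (fw0 ?d) (fw ?d) = form_A k (fb q) (fu d) (fw0 d) (fw d)"
      unfolding form_A_def Y
      by (rule vec_eq_innerI)
        (simp add: b_shift_def form_Y_def multilinear algebra_simps)
    have E: "form_E k (fb (b_shift k v q)) (fu0 ?d) (fu ?d) (fw0 ?d) (fw ?d) = form_E k (fb q) (fu0 d) (fu d) (fw0 d) (fw d)"
      unfolding form_E_def Y
      by (simp add: b_shift_def form_Y_def k2_inner k3_linear k3_commute inner_add_left inner_add_right inner_diff_right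
          inner_commute algebra_simps add_divide_distrib diff_divide_distrib)
    have S: "form_S (b_shift k v q) ?d = form_S q d"
      unfolding form_S_def
      by (simp add: b_shift_def k2_inner k3_linear k3_commute inner_add_left inner_add_right inner_diff_right
          inner_diff_left inner_commute algebra_simps add_divide_distrib diff_divide_distrib)
    show ?thesis
      unfolding flat_metric_def Let_def A Y E S by (simp add: b_shift_def)
  qed
qed (simp_all add: b_shift_add b_shift_zero flat_dom_def, simp_all add: b_shift_def)

end

lemma dual_linear: "dual A (x + y) = dual A x + dual A y" "dual A (c *\<^sub>R x) = c *\<^sub>R dual A x"
  by (simp_all add: dual_def matrix_vector_right_distrib matrix_vector_mult_scaleR)

lemmas has_derivative_matrix_vector [derivative_intros] =
  bounded_linear.has_derivative[OF matrix_vector_mul_bounded_linear]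

lemma smooth_on_dual [smooth_intros]:
  "open S \<Longrightarrow> smooth_on f S \<Longrightarrow> smooth_on (\<lambda>x. dual A (f x)) S"
  unfolding dual_def by (intro smooth_intros)

lemma has_derivative_dual [derivative_intros]:
  "(f has_derivative f') F \<Longrightarrow> ((\<lambda>x. dual A (f x)) has_derivative (\<lambda>v. dual A (f' v))) F"
  unfolding dual_def by (rule has_derivative_matrix_vector)

lemma inner_matrix_vector: "x \<bullet> (A *v y) = (transpose A *v x) \<bullet> y" for A :: "real ^ 'n ^ 'm::finite"
  by (simp add: dot_lmul_matrix)

context psr
begin

lemma dual_inner:
  assumes "invertible A"
  shows "(A *v y) \<bullet> dual A x = y \<bullet> (x :: real ^ 'n)" "dual A x \<bullet> (A *v y) = x \<bullet> y"
    "dual A (transpose A *v x) = x" "transpose A *v dual A x = x"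
proof -
  have "invertible (transpose A)" using assms by (simp add: transpose_invertible)
  note i = matrix_inv_works[OF this]
  show "dual A x \<bullet> (A *v y) = x \<bullet> y" by (simp only: inner_matrix_vector dual_def i)
  then show "(A *v y) \<bullet> dual A x = y \<bullet> x" by (simp add: inner_commute)
  show "dual A (transpose A *v x) = x" "transpose A *v dual A x = x" by (simp_all only: dual_def i)
qed

lemma dual_eqI:
  assumes "invertible A" "\<And>y. z \<bullet> (A *v y) = x \<bullet> (y :: real ^ 'n)"
  shows "dual A x = z"
proof (rule vec_eq_innerI)
  fix w
  have "w = A *v (matrix_inv A *v w)" using matrix_inv_works[OF assms(1)] by simp
  then show "dual A x \<bullet> w = z \<bullet> w" using assms dual_inner[OF assms(1)] by metis
qed

lemma Aut_H_k2:
  assumes "A \<in> Aut_H H"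
  shows "k2 k (A *v x) (A *v y) = dual A (k2 k x y)"
  by (rule dual_eqI[OF Aut_H_invertible[OF assms], symmetric]) (simp add: k2_inner Aut_H_k3[OF assms])

text \<open>\<open>k2\<close> intertwines \<open>A\<close> with its contragredient, so the Hessian
  maps vectors to covectors equivariantly, and its inverse maps covectors back to vectors
  equivariantly.\<close>

lemma Aut_H_hinv:
  assumes A: "A \<in> Aut_H H" and t: "t \<in> cone H"
  shows "hinv (A *v t) *v dual A x = A *v (hinv t *v x)"
  using hess_inv(2)[OF Aut_H_cone[OF A t], of "A *v (hinv t *v x)"]
  by (simp add: Aut_H_k2[OF A] hess_inv(1)[OF t])

lemma lin_act_mult:
  assumes "invertible A" "invertible B"
  shows "lin_act c A (lin_act d B q) = lin_act (c * d) (A ** B) (q :: 'n flat)"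
proof -
  have "dual A (dual B x) = dual (A ** B) x" for x :: "real ^ 'n"
    by (rule dual_eqI[symmetric]) (simp_all add: invertible_mult assms dual_inner matrix_vector_mul_assoc[symmetric])
  then show ?thesis
    by (simp add: lin_act_def dual_linear matrix_vector_mult_scaleR matrix_vector_mul_assoc power_mult_distrib mult_ac)
qed

lemma lin_act_one: "lin_act 1 (mat 1) q = (q :: 'n flat)"
proof -
  have "dual (mat 1) x = x" for x :: "real ^ 'n"
    by (rule dual_eqI[OF Aut_H_invertible[OF Aut_H_one]]) simp
  then show ?thesis by (simp add: lin_act_def)
qed

text \<open>The forms in \<open>\<zeta>\<close> and \<open>\<zeta>'\<close> scale by
  \<open>c\<close> and the contact form by \<open>c^2\<close>, which the factor \<open>c^2\<close>
  of \<open>\<rho>\<close> compensates. The matrix \<open>A\<close> disappears from all pairings of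
  vectors with covectors.\<close>

lemma lin_act_isometry:
  assumes c: "0 < c" and A: "A \<in> Aut_H H"
  shows "lift (lin_act c A) \<in> carrier (q_iso k H)"
proof (rule lift_isometry[where f' = "lin_act (1 / c) (matrix_inv A)" and D = "\<lambda>q. lin_act c A"])
  have i: "invertible A" "invertible (matrix_inv A)"
    using A Aut_H_inv Aut_H_invertible by blast+
  have smooth: "smooth_on (lin_act c A) flat_dom" for c and A :: "real ^ 'n ^ 'n"
    unfolding lin_act_def[abs_def] by (intro smooth_intros open_flat_dom)
  show "smooth_on (lin_act c A) flat_dom" "smooth_on (lin_act (1 / c) (matrix_inv A)) flat_dom" by (rule smooth)+
  show "lin_act (1 / c) (matrix_inv A) (lin_act c A q) = q" "lin_act c A (lin_act (1 / c) (matrix_inv A) q) = q" for q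
    using c by (simp_all add: lin_act_mult i matrix_inv_works[OF i(1)] lin_act_one)
  show "(lin_act c A has_derivative lin_act c A) (at q)" for q
    unfolding lin_act_def[abs_def] by (rule has_derivative_eq_rhs, (rule derivative_intros)+) auto
  show "lin_act c A q \<in> flat_dom" "lin_act (1 / c) (matrix_inv A) q \<in> flat_dom" if "q \<in> flat_dom" for q
    using that c Aut_H_cone[OF A] Aut_H_cone[OF Aut_H_inv[OF A]] by (simp_all add: flat_dom_def lin_act_def)
  show "flat_metric (lin_act c A q) (lin_act c A d) (lin_act c A d) = flat_metric q d d" if "q \<in> flat_dom" for q d
  proof -
    let ?q = "lin_act c A q" and ?d = "lin_act c A d"
    have t: "ft q \<in> cone H" and r: "0 < fr q" using that by (auto simp: flat_dom_def)
    have Y: "form_Y (fb ?q) (fw0 ?d) (fw ?d) = c *\<^sub>R (A *v form_Y (fb q) (fw0 d) (fw d))"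
      by (simp add: form_Y_def lin_act_def algebra_simps matrix_vector_mult_diff_distrib matrix_vector_mult_scaleR)
    have Af: "form_A k (fb ?q) (fu ?d) (fw0 ?d) (fw ?d) = c *\<^sub>R dual A (form_A k (fb q) (fu d) (fw0 d) (fw d))"
      unfolding form_A_def Y
      by (simp add: lin_act_def k2_linear Aut_H_k2[OF A] dual_linear algebra_simps)
    have E: "form_E k (fb ?q) (fu0 ?d) (fu ?d) (fw0 ?d) (fw ?d) = c * form_E k (fb q) (fu0 d) (fu d) (fw0 d) (fw d)"
      unfolding form_E_def Y
      by (simp add: lin_act_def k3_linear Aut_H_k3[OF A] dual_inner[OF i(1)] algebra_simps)
    have S: "form_S ?q ?d = c\<^sup>2 * form_S q d"
      unfolding form_S_def
      by (simp add: lin_act_def dual_inner[OF i(1)] algebra_simps power2_eq_square)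
    have L: "log_hess k (ft ?q) (fb ?d) (fb ?d) = log_hess k (ft q) (fb d) (fb d)"
      "log_hess k (ft ?q) (ft ?d) (ft ?d) = log_hess k (ft q) (ft d) (ft d)"
      unfolding log_hess_def by (simp_all add: lin_act_def Aut_H_k3[OF A] Aut_H_cubic[OF A])
    have T: "ft ?q = A *v ft q" "cubic k (A *v ft q) = cubic k (ft q)"
      by (simp_all add: lin_act_def Aut_H_cubic[OF A])
    show ?thesis
      unfolding flat_metric_def Let_def Y Af E S L unfolding T
      using c r cubic_pos[OF t]
      by (simp add: k3_linear Aut_H_k3[OF A] dual_inner[OF i(1)] matrix_vector_mult_scaleR Aut_H_hinv[OF A t] )
        (simp add: lin_act_def power_mult_distrib field_simps power2_eq_square)
  qed
qed

end

section \<open>S-duality\<close>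

type_synonym 'n flatb = "((real ^ 'n) \<times> (real ^ 'n)) \<times> complex \<times> (real ^ 'n) \<times> (real ^ 'n) \<times> real \<times> real"

abbreviation "gb \<equiv> \<lambda>r :: 'n::finite flatb. fst (fst r)"
abbreviation "gt \<equiv> \<lambda>r :: 'n::finite flatb. snd (fst r)"
abbreviation "gtau \<equiv> \<lambda>r :: 'n::finite flatb. fst (snd r)"
abbreviation "gc \<equiv> \<lambda>r :: 'n::finite flatb. fst (snd (snd r))"
abbreviation "gd \<equiv> \<lambda>r :: 'n::finite flatb. fst (snd (snd (snd r)))"
abbreviation "gc0 \<equiv> \<lambda>r :: 'n::finite flatb. fst (snd (snd (snd (snd r))))"
abbreviation "gp \<equiv> \<lambda>r :: 'n::finite flatb. snd (snd (snd (snd (snd r))))"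

definition to_iib :: "'n::finite flatb \<Rightarrow> 'n iib" where
  "to_iib r = (cplx (gb r) (gt r), snd r)"

definition b_to_a :: "'n::finite coeffs \<Rightarrow> 'n flatb \<Rightarrow> 'n flat" where
  "b_to_a k r = (fst r, (Im (gtau r))\<^sup>2 / 2 * cubic k (gt r),
     (gc0 r - k3 k (gb r) (gb r) (gc r - Re (gtau r) *\<^sub>R gb r) / 6,
      gd r + (1/2) *\<^sub>R k2 k (gb r) (gc r - Re (gtau r) *\<^sub>R gb r)),
     (Re (gtau r), - (gc r - Re (gtau r) *\<^sub>R gb r)),
     - 2 * (gp r + 1/2 * Re (gtau r) * gc0 r) + gd r \<bullet> (gc r - Re (gtau r) *\<^sub>R gb r)
       - k3 k (gb r) (gc r) (gc r - Re (gtau r) *\<^sub>R gb r) / 6)"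

text \<open>The equations of \<open>b_to_a\<close> solved for the type IIB coordinates:
  \<open>w = -(c - Re \<tau> b)\<close> yields the components of \<open>c\<close>, and
  \<open>\<rho> = (Im \<tau>)^2 h / 2\<close> yields the imaginary part of
  \<open>\<tau>\<close>.\<close>

definition a_to_b :: "'n::finite coeffs \<Rightarrow> 'n flat \<Rightarrow> 'n flatb" where
  "a_to_b k q = (fst q, Complex (fw0 q) (sqrt (2 * fr q / cubic k (ft q))), fw0 q *\<^sub>R fb q - fw q,
     fu q + (1/2) *\<^sub>R k2 k (fb q) (fw q), fu0 q - k3 k (fb q) (fb q) (fw q) / 6,
     - (fs q + fw0 q * fu0 q + fw q \<bullet> fu q) / 2 + fw0 q * k3 k (fb q) (fb q) (fw q) / 6
       - k3 k (fb q) (fw q) (fw q) / 3)"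

definition slb :: "real ^ 2 ^ 2 \<Rightarrow> 'n flatb \<Rightarrow> 'n::finite flatb" where
  "slb m r = ((m$2$1 *\<^sub>R gc r + m$2$2 *\<^sub>R gb r, cmod (of_real (m$2$1) * gtau r + of_real (m$2$2)) *\<^sub>R gt r),
     (of_real (m$1$1) * gtau r + of_real (m$1$2)) / (of_real (m$2$1) * gtau r + of_real (m$2$2)),
     m$1$1 *\<^sub>R gc r + m$1$2 *\<^sub>R gb r, gd r,
     m$2$2 * gc0 r - m$2$1 * gp r, - m$1$2 * gc0 r + m$1$1 * gp r)"

definition sl :: "'n::finite coeffs \<Rightarrow> real ^ 2 ^ 2 \<Rightarrow> 'n flat \<Rightarrow> 'n flat" where
  "sl k m q = b_to_a k (slb m (a_to_b k q))"

lemma sl2_act_to_iib: "sl2_act_iib m (to_iib r) = to_iib (slb m r)"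
proof -
  have "(\<chi> a. Complex (m$2$1 * gc r $ a + m$2$2 * Re (cplx (gb r) (gt r) $ a)) (l * Im (cplx (gb r) (gt r) $ a))) =
      cplx (m$2$1 *\<^sub>R gc r + m$2$2 *\<^sub>R gb r) (l *\<^sub>R gt r)" for l
    by (simp add: vec_eq_iff)
  moreover have "(\<chi> a. m$1$1 * gc r $ a + m$1$2 * Re (cplx (gb r) (gt r) $ a)) = m$1$1 *\<^sub>R gc r + m$1$2 *\<^sub>R gb r"
    by (simp add: vec_eq_iff)
  ultimately show ?thesis
    by (cases r) (auto simp: to_iib_def slb_def Let_def)
qed

lemma (in cubic_form) iib_to_iia_to_iib: "iib_to_iia k (to_iib r) = to_iia (b_to_a k r)"
proof -
  have 3: "(\<Sum>a\<in>UNIV. \<Sum>b\<in>UNIV. \<Sum>c\<in>UNIV. k a b c / 6 * x$a * y$b * z$c) = k3 k x y z / 6" for x y z :: "real ^ 'n"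
    by (simp add: k3_def sum_divide_distrib)
  have 2: "(\<chi> a. d$a + (\<Sum>b\<in>UNIV. \<Sum>c\<in>UNIV. k a b c / 2 * x$b * y$c)) = d + (1/2) *\<^sub>R k2 k x y" for d x y :: "real ^ 'n"
  proof -
    have *: "k a b c = k b c a" for a b c
      using sym unfolding symmetric3_def by metis
    have "(\<Sum>b\<in>UNIV. \<Sum>c\<in>UNIV. k a b c / 2 * x$b * y$c) = (1/2) * k2 k x y $ a" for a
      unfolding k2_def vec_lambda_beta sum_distrib_left by (intro sum.cong refl, subst *) simp
    then show ?thesis by (simp add: vec_eq_iff)
  qed
  have 1: "(\<Sum>a\<in>UNIV. x$a * y$a) = x \<bullet> y" for x y :: "real ^ 'n" by (simp add: inner_vec_def)
  show ?thesis
    by (cases r, cases "fst r") (simp only: to_iib_def fst_conv snd_conv iib_to_iia.simps Let_def re_im_cplx 3 2 1 to_iia_def b_to_a_def)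
qed

section \<open>The action of \<open>SL(2)\<close> on the type IIB domain\<close>

context psr
begin

definition dom_b :: "'n flatb set" where
  "dom_b = {r. gt r \<in> cone H \<and> 0 < Im (gtau r)}"

lemma open_dom_b: "open dom_b"
proof -
  have "open ((\<lambda>r. gt r) -` cone H \<inter> (\<lambda>r. Im (gtau r)) -` {0<..})"
    by (intro open_Int open_vimage open_cone open_greaterThan continuous_intros)
  moreover have "(\<lambda>r. gt r) -` cone H \<inter> (\<lambda>r. Im (gtau r)) -` {0<..} = dom_b" by (auto simp: dom_b_def)
  ultimately show ?thesis by simp
qed

lemma to_iib_in_N_iib: "to_iib r \<in> N_iib H \<longleftrightarrow> r \<in> dom_b"
  by (cases r) (auto simp: to_iib_def N_iib_def dom_b_def M_bar_def)

lemma b_to_a_dom: "r \<in> dom_b \<Longrightarrow> b_to_a k r \<in> flat_dom"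
  by (simp add: dom_b_def flat_dom_def b_to_a_def cubic_pos)

lemma a_to_b_dom: "q \<in> flat_dom \<Longrightarrow> a_to_b k q \<in> dom_b"
  by (simp add: dom_b_def flat_dom_def a_to_b_def cubic_pos)

lemma b_to_a_to_b: "q \<in> flat_dom \<Longrightarrow> b_to_a k (a_to_b k q) = q"
proof -
  assume q: "q \<in> flat_dom"
  then have "0 < cubic k (ft q)" "0 < fr q" by (auto simp: flat_dom_def cubic_pos)
  then show ?thesis
    by (simp add: b_to_a_def a_to_b_def prod_eq_iff k3_linear k2_linear inner_diff_right inner_add_left k2_inner k3_commute
        inner_commute algebra_simps add_divide_distrib diff_divide_distrib)
qed

lemma a_to_b_to_a: "r \<in> dom_b \<Longrightarrow> a_to_b k (b_to_a k r) = r"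
proof -
  assume r: "r \<in> dom_b"
  then have "0 < cubic k (gt r)" "0 < Im (gtau r)" by (auto simp: dom_b_def cubic_pos)
  then show ?thesis
    by (simp add: b_to_a_def a_to_b_def prod_eq_iff k3_linear k2_linear inner_diff_right inner_add_left inner_diff_left inner_add_right
        k2_inner k3_commute complex_eq_iff
        inner_commute algebra_simps add_divide_distrib diff_divide_distrib)
qed

lemma slb_denominator:
  fixes m :: "real ^ 2 ^ 2"
  assumes "det m = (1::real)" "0 < Im \<tau>"
  shows "of_real (m$2$1) * \<tau> + of_real (m$2$2) \<noteq> 0"
proof
  assume "of_real (m$2$1) * \<tau> + of_real (m$2$2) = 0"
  then have "m$2$1 * Im \<tau> = 0" "m$2$1 * Re \<tau> + m$2$2 = 0" by (auto simp: complex_eq_iff)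
  then have "m$2$1 = 0" "m$2$2 = 0" using assms(2) by auto
  then show False using assms(1) by (simp add: det_2)
qed

lemma Im_moebius:
  fixes m :: "real ^ 2 ^ 2"
  assumes "det m = (1::real)"
  shows "Im ((of_real (m$1$1) * \<tau> + of_real (m$1$2)) / (of_real (m$2$1) * \<tau> + of_real (m$2$2))) =
    Im \<tau> / (cmod (of_real (m$2$1) * \<tau> + of_real (m$2$2)))\<^sup>2"
proof -
  have "(m$1$1 * m$2$2 - m$1$2 * m$2$1) * Im \<tau> = Im \<tau>" using assms by (simp add: det_2)
  then show ?thesis unfolding Im_divide cmod_power2 by (simp add: algebra_simps)
qed

lemma slb_dom: "det m = 1 \<Longrightarrow> r \<in> dom_b \<Longrightarrow> slb m r \<in> dom_b"
  using slb_denominator[of m "gtau r"]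
  by (simp add: dom_b_def slb_def Im_moebius cone_scaleR)

text \<open>The denominator of the Moebius transformation is a cocycle for matrix multiplication. It
  governs the action on \<open>\<tau>\<close> and, through its modulus, the rescaling of
  \<open>t\<close>.\<close>

lemma slb_mult:
  assumes "det m = 1" "det m' = 1" "r \<in> dom_b"
  shows "slb m (slb m' r) = slb (m ** m') r"
proof -
  have r: "0 < Im (gtau r)" using assms by (simp add: dom_b_def)
  let ?j = "of_real (m'$2$1) * gtau r + of_real (m'$2$2)"
  let ?t = "(of_real (m'$1$1) * gtau r + of_real (m'$1$2)) / ?j"
  have j: "?j \<noteq> 0" using slb_denominator[OF assms(2) r] .
  have M: "(m ** m') $ i $ l = m$i$1 * m'$1$l + m$i$2 * m'$2$l" for i l
    by (simp add: matrix_matrix_mult_def sum_2)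
  have cocycle: "(of_real (m$2$1) * ?t + of_real (m$2$2)) * ?j = of_real ((m ** m')$2$1) * gtau r + of_real ((m ** m')$2$2)"
    "(of_real (m$1$1) * ?t + of_real (m$1$2)) * ?j = of_real ((m ** m')$1$1) * gtau r + of_real ((m ** m')$1$2)"
    using j by (simp_all add: M field_simps)
  have tau: "(of_real (m$1$1) * ?t + of_real (m$1$2)) / (of_real (m$2$1) * ?t + of_real (m$2$2)) =
     (of_real ((m ** m')$1$1) * gtau r + of_real ((m ** m')$1$2)) / (of_real ((m ** m')$2$1) * gtau r + of_real ((m ** m')$2$2))"
    unfolding cocycle[symmetric] using j by simp
  have norm: "cmod (of_real (m$2$1) * ?t + of_real (m$2$2)) * cmod ?j =
      cmod (of_real ((m ** m')$2$1) * gtau r + of_real ((m ** m')$2$2))"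
    unfolding norm_mult[symmetric] cocycle ..
  show ?thesis
    unfolding slb_def prod_eq_iff fst_conv snd_conv tau scaleR_scaleR norm
    by (simp add: M algebra_simps)
qed

lemma slb_one: "slb (mat 1) r = r"
  by (simp add: slb_def mat_def prod_eq_iff)

lemma sl_dom: "det m = 1 \<Longrightarrow> q \<in> flat_dom \<Longrightarrow> sl k m q \<in> flat_dom"
  by (simp add: sl_def b_to_a_dom slb_dom a_to_b_dom)

lemma sl_mult: "det m = 1 \<Longrightarrow> det m' = 1 \<Longrightarrow> q \<in> flat_dom \<Longrightarrow> sl k m (sl k m' q) = sl k (m ** m') q"
  by (simp add: sl_def a_to_b_to_a slb_dom a_to_b_dom slb_mult)

lemma sl_one: "q \<in> flat_dom \<Longrightarrow> sl k (mat 1) q = q"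
  by (simp add: sl_def slb_one b_to_a_to_b)

text \<open>\<open>s_duality\<close> passes to type IIB coordinates by \<open>the_inv_into\<close>;
  injectivity of the coordinate change on \<open>N_iib H\<close> identifies this with the explicit
  inverse \<open>a_to_b\<close>.\<close>

lemma s_duality_to_iia:
  assumes q: "q \<in> flat_dom"
  shows "s_duality k H m (to_iia q) = to_iia (sl k m q)"
proof -
  have surj: "\<exists>r. p = to_iib r" for p :: "'n iib"
    by (rule exI[of _ "((re_vec (fst p), im_vec (fst p)), snd p)"]) (simp add: to_iib_def)
  have "inj_on (iib_to_iia k) (N_iib H)"
  proof (rule inj_onI)
    fix p p' assume pp: "p \<in> N_iib H" "p' \<in> N_iib H" "iib_to_iia k p = iib_to_iia k p'"
    obtain r r' where r: "p = to_iib r" "p' = to_iib r'" using surj by metis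
    have "r \<in> dom_b" "r' \<in> dom_b" using pp(1,2) unfolding r to_iib_in_N_iib by auto
    moreover have "b_to_a k r = b_to_a k r'" using pp(3) unfolding r iib_to_iia_to_iib by simp
    ultimately show "p = p'" using a_to_b_to_a r by metis
  qed
  moreover have "iib_to_iia k (to_iib (a_to_b k q)) = to_iia q"
    unfolding iib_to_iia_to_iib b_to_a_to_b[OF q] ..
  moreover have "to_iib (a_to_b k q) \<in> N_iib H" unfolding to_iib_in_N_iib using a_to_b_dom[OF q] .
  ultimately have "the_inv_into (N_iib H) (iib_to_iia k) (to_iia q) = to_iib (a_to_b k q)"
    by (rule the_inv_into_f_eq)
  then show ?thesis
    unfolding s_duality_def by (simp add: sl2_act_to_iib iib_to_iia_to_iib sl_def)
qed

end

section \<open>Smoothness of S-duality\<close>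

lemma smooth_on_Complex [smooth_intros]:
  assumes "open S" "smooth_on f S" "smooth_on g S"
  shows "smooth_on (\<lambda>x. Complex (f x) (g x)) S"
proof -
  have "smooth_on (\<lambda>x. f x *\<^sub>R (1::complex) + g x *\<^sub>R \<i>) S"
    using assms by (intro smooth_intros)
  then show ?thesis by (rule smooth_on_cong[OF assms(1), rotated]) (simp add: complex_eq_iff)
qed

lemma smooth_on_cmod [smooth_intros]:
  assumes "open S" "smooth_on f S" "\<And>x. x \<in> S \<Longrightarrow> f x \<noteq> 0"
  shows "smooth_on (\<lambda>x. cmod (f x)) S"
  unfolding cmod_def power2_eq_square
proof (intro smooth_intros assms)
  show "0 < Re (f x) * Re (f x) + Im (f x) * Im (f x)" if "x \<in> S" for x
    using assms(3)[OF that] by (metis complex_neq_0 power2_eq_square)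
qed

lemma smooth_on_complex_divide [smooth_intros]:
  assumes S: "open S" and "smooth_on f S" "smooth_on g S" "\<And>x. x \<in> S \<Longrightarrow> g x \<noteq> (0::complex)"
  shows "smooth_on (\<lambda>x. f x / g x) S"
proof -
  have "smooth_on (\<lambda>x. (1 / (cmod (g x) * cmod (g x))) *\<^sub>R (f x * cnj (g x))) S"
    by (intro smooth_intros S assms smooth_on_linear_compose[OF bounded_linear_cnj]) (use assms(4) in auto)
  then show ?thesis
    by (rule smooth_on_cong[OF S, rotated])
      (simp add: complex_div_cnj[of "f _"] scaleR_conv_of_real power2_eq_square)
qed

context psr
begin

lemma smooth_b_to_a: "smooth_on (b_to_a k) dom_b"
  unfolding b_to_a_def[abs_def] divide_inverse power2_eq_square by (intro smooth_intros open_dom_b)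

lemma smooth_a_to_b: "smooth_on (a_to_b k) flat_dom"
proof -
  have "smooth_on (\<lambda>q. (fst q, Complex (fw0 q) (sqrt (2 * fr q / cubic k (ft q))), fw0 q *\<^sub>R fb q - fw q,
     fu q + (1/2) *\<^sub>R k2 k (fb q) (fw q), fu0 q + (- (1 / 6)) * k3 k (fb q) (fb q) (fw q),
     (- (1/2)) * (fs q + fw0 q * fu0 q + fw q \<bullet> fu q) + (1/6) * (fw0 q * k3 k (fb q) (fb q) (fw q))
       + (- (1/3)) * k3 k (fb q) (fw q) (fw q))) flat_dom"
    by (intro smooth_intros open_flat_dom) (auto simp: flat_dom_def cubic_pos)
  then show ?thesis by (rule smooth_on_cong[OF open_flat_dom, rotated]) (simp add: a_to_b_def add_divide_distrib)
qed

lemma smooth_slb: "det m = 1 \<Longrightarrow> smooth_on (slb m) dom_b"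
  unfolding slb_def[abs_def]
  by (intro smooth_intros open_dom_b) (auto simp: dom_b_def slb_denominator)

lemma smooth_sl:
  assumes "det m = 1"
  shows "smooth_on (sl k m) flat_dom"
proof -
  have "smooth_on (\<lambda>q. slb m (a_to_b k q)) flat_dom"
    by (rule smooth_on_compose[OF open_flat_dom open_dom_b _ smooth_a_to_b smooth_slb[OF assms]])
      (simp add: image_subset_iff a_to_b_dom)
  then show ?thesis
    unfolding sl_def[abs_def]
    by (rule smooth_on_compose[OF open_flat_dom open_dom_b _ _ smooth_b_to_a, rotated])
      (simp add: image_subset_iff slb_dom[OF assms] a_to_b_dom)
qed

end

subsection \<open>Invariance of the metric under S-duality\<close>

text \<open>In type IIB coordinates the metric is a combination of the following forms, each of which
  transforms in a simple way: \<open>(iib_E, iib_F)\<close> is a doublet, \<open>iib_A\<close> is invariant.\<close>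

definition iib_Y :: "'n::finite flatb \<Rightarrow> 'n flatb \<Rightarrow> real ^ 'n" where
  "iib_Y r v = Re (gtau r) *\<^sub>R gb v - gc v"

definition iib_A :: "'n::finite coeffs \<Rightarrow> 'n flatb \<Rightarrow> 'n flatb \<Rightarrow> real ^ 'n" where
  "iib_A k r v = gd v + (1/2) *\<^sub>R (k2 k (gc r) (gb v) - k2 k (gb r) (gc v))"

definition iib_E :: "'n::finite coeffs \<Rightarrow> 'n flatb \<Rightarrow> 'n flatb \<Rightarrow> real" where
  "iib_E k r v = gc0 v + gb r \<bullet> gd v + (k3 k (gb r) (gc r) (gb v) - k3 k (gb r) (gb r) (gc v)) / 6"

definition iib_F :: "'n::finite coeffs \<Rightarrow> 'n flatb \<Rightarrow> 'n flatb \<Rightarrow> real" where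
  "iib_F k r v = - gp v + gc r \<bullet> gd v + (k3 k (gc r) (gc r) (gb v) - k3 k (gc r) (gb r) (gc v)) / 6"

text \<open>The derivative of the Moebius transformation is entered as \<open>1 / j^2\<close>, its
  value for determinant \<open>1\<close>.\<close>

definition d_slb :: "real ^ 2 ^ 2 \<Rightarrow> 'n::finite flatb \<Rightarrow> 'n flatb \<Rightarrow> 'n flatb" where
  "d_slb m r v = (let j = of_real (m$2$1) * gtau r + of_real (m$2$2) in
    ((m$2$1 *\<^sub>R gc v + m$2$2 *\<^sub>R gb v,
      cmod j *\<^sub>R gt v + (m$2$1 * (Re j * Re (gtau v) + Im j * Im (gtau v)) / cmod j) *\<^sub>R gt r),
     gtau v / j\<^sup>2,
     m$1$1 *\<^sub>R gc v + m$1$2 *\<^sub>R gb v, gd v,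
     m$2$2 * gc0 v - m$2$1 * gp v, - m$1$2 * gc0 v + m$1$1 * gp v))"

definition d_b_to_a :: "'n::finite coeffs \<Rightarrow> 'n flatb \<Rightarrow> 'n flatb \<Rightarrow> 'n flat" where
  "d_b_to_a k r v = (let b = gb r; e = gc r - Re (gtau r) *\<^sub>R b;
       e' = gc v - Re (gtau v) *\<^sub>R b - Re (gtau r) *\<^sub>R gb v in
     (fst v, Im (gtau r) * Im (gtau v) * cubic k (gt r) + (Im (gtau r))\<^sup>2 / 2 * (k3 k (gt r) (gt r) (gt v) / 2),
      (gc0 v - (2 * k3 k b (gb v) e + k3 k b b e') / 6, gd v + (1/2) *\<^sub>R (k2 k (gb v) e + k2 k b e')),
      (Re (gtau v), - e'),
      - 2 * (gp v + 1/2 * (Re (gtau v) * gc0 r + Re (gtau r) * gc0 v)) + gd v \<bullet> e + gd r \<bullet> e'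
        - (k3 k (gb v) (gc r) e + k3 k b (gc v) e + k3 k b (gc r) e') / 6))"

context psr
begin

lemma has_derivative_b_to_a: "(b_to_a k has_derivative d_b_to_a k r) (at r)"
  unfolding b_to_a_def[abs_def] divide_inverse power2_eq_square
  by (rule has_derivative_eq_rhs, (rule derivative_intros)+)
    (auto simp: d_b_to_a_def Let_def k3_commute algebra_simps inner_commute power2_eq_square)

lemma has_derivative_slb:
  assumes m: "det m = 1" and r: "r \<in> dom_b"
  shows "(slb m has_derivative d_slb m r) (at r)"
proof -
  let ?j = "\<lambda>r :: 'n flatb. of_real (m$2$1) * gtau r + of_real (m$2$2)"
  have tau: "0 < Im (gtau r)" using r by (simp add: dom_b_def)
  have j: "?j r \<noteq> 0" using slb_denominator[OF m tau] .
  have dj: "(?j has_derivative (\<lambda>v. of_real (m$2$1) * gtau v)) (at r)"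
    by (rule has_derivative_eq_rhs, (rule derivative_intros)+) auto
  have dn: "((\<lambda>r. of_real (m$1$1) * gtau r + of_real (m$1$2)) has_derivative (\<lambda>v. of_real (m$1$1) * gtau v)) (at r)"
    by (rule has_derivative_eq_rhs, (rule derivative_intros)+) auto
  have dmoeb: "((\<lambda>r. (of_real (m$1$1) * gtau r + of_real (m$1$2)) / ?j r) has_derivative (\<lambda>v. gtau v / (?j r)\<^sup>2)) (at r)"
  proof (rule has_derivative_eq_rhs[OF has_derivative_divide'[OF dn dj j]], rule ext)
    fix v :: "'n flatb"
    have "of_real (m$1$1) * of_real (m$2$2) - of_real (m$1$2) * of_real (m$2$1) = (1 :: complex)"
      using m by (simp add: det_2 flip: of_real_mult of_real_diff)
    moreover have "of_real (m$1$1) * gtau v * ?j r - (of_real (m$1$1) * gtau r + of_real (m$1$2)) * (of_real (m$2$1) * gtau v)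
      = (of_real (m$1$1) * of_real (m$2$2) - of_real (m$1$2) * of_real (m$2$1)) * gtau v"
      by (simp add: algebra_simps)
    ultimately show "(of_real (m$1$1) * gtau v * ?j r - (of_real (m$1$1) * gtau r + of_real (m$1$2)) * (of_real (m$2$1) * gtau v))
      / (?j r * ?j r) = gtau v / (?j r)\<^sup>2"
      by (simp add: power2_eq_square)
  qed
  have dnorm: "((\<lambda>r. cmod (?j r)) has_derivative
      (\<lambda>v. m$2$1 * (Re (?j r) * Re (gtau v) + Im (?j r) * Im (gtau v)) / cmod (?j r))) (at r)"
    using has_derivative_compose[OF dj has_derivative_norm[OF j]]
    by (rule has_derivative_eq_rhs)
      (simp add: fun_eq_iff inner_complex_def sgn_eq algebra_simps add_divide_distrib)
  show ?thesis
    unfolding slb_def[abs_def]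
    by (rule has_derivative_eq_rhs, (rule dmoeb dnorm derivative_intros)+)
      (auto simp: d_slb_def Let_def)
qed

text \<open>Four groups of terms, each invariant by itself: the doublet formed from \<open>b\<close>
  and \<open>c\<close>, via \<open>db\<close> and \<open>iib_Y\<close>; the hyperbolic metric of
  \<open>\<tau>\<close> coupled to the scale of \<open>t\<close>; the invariant
  \<open>iib_A\<close>; the doublet \<open>(iib_E, iib_F)\<close>. They are \<open>T1\<close> to
  \<open>T4\<close> in the proof of invariance.\<close>

definition iib_metric :: "'n flatb \<Rightarrow> 'n flatb \<Rightarrow> real" where
  "iib_metric r v = (let t = gt r; h = cubic k t; s = Im (gtau r) in
     - (log_hess k t (gb v) (gb v) + log_hess k t (iib_Y r v) (iib_Y r v) / s\<^sup>2) / 4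
     + (- log_hess k t (gt v) (gt v) / 4 + (2 * (Im (gtau v) / s) + k3 k t t (gt v) / (2 * h))\<^sup>2 / 4
        + (Re (gtau v) / s)\<^sup>2 / 4)
     - (iib_A k r v \<bullet> (hinv t *v iib_A k r v) / 2 - (t \<bullet> iib_A k r v)\<^sup>2 / (4 * h)) / (2 * s\<^sup>2 * h)
     + ((iib_E k r v)\<^sup>2 + ((iib_F k r v - Re (gtau r) * iib_E k r v) / s)\<^sup>2) / (4 * s\<^sup>2 * h\<^sup>2))"

text \<open>With \<open>\<rho> = (Im \<tau>)^2 h / 2\<close> the terms in \<open>form_Y\<close>
  assemble to the Hessian of \<open>log h\<close>, the quotient \<open>d\<rho> / \<rho>\<close>
  becomes \<open>2 dIm \<tau> / Im \<tau> + dh / h\<close>, and the contact form becomes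
  \<open>2 (iib_F - Re \<tau> iib_E)\<close>.\<close>

lemma flat_metric_b_to_a:
  assumes r: "r \<in> dom_b"
  shows "flat_metric (b_to_a k r) (d_b_to_a k r v) (d_b_to_a k r v) = iib_metric r v"
proof -
  have t: "gt r \<in> cone H" and s: "0 < Im (gtau r)" using r by (auto simp: dom_b_def)
  have h: "0 < cubic k (gt r)" using cubic_pos[OF t] .
  let ?q = "b_to_a k r" and ?v = "d_b_to_a k r v"
  have fb: "fb ?q = gb r" "ft ?q = gt r" "fr ?q = (Im (gtau r))\<^sup>2 / 2 * cubic k (gt r)"
    "fb ?v = gb v" "ft ?v = gt v"
    "fr ?v = Im (gtau r) * Im (gtau v) * cubic k (gt r) + (Im (gtau r))\<^sup>2 / 2 * (k3 k (gt r) (gt r) (gt v) / 2)"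
    "fw0 ?v = Re (gtau v)"
    by (simp_all add: b_to_a_def d_b_to_a_def Let_def)
  have Y: "form_Y (fb ?q) (fw0 ?v) (fw ?v) = iib_Y r v"
    by (simp add: form_Y_def b_to_a_def d_b_to_a_def Let_def iib_Y_def algebra_simps)
  have A: "form_A k (fb ?q) (fu ?v) (fw0 ?v) (fw ?v) = iib_A k r v"
    unfolding form_A_def Y
    by (rule vec_eq_innerI)
      (simp add: b_to_a_def d_b_to_a_def Let_def iib_A_def iib_Y_def multilinear algebra_simps)
  have E: "form_E k (fb ?q) (fu0 ?v) (fu ?v) (fw0 ?v) (fw ?v) = iib_E k r v"
    unfolding form_E_def Y
    by (simp add: b_to_a_def d_b_to_a_def Let_def iib_E_def iib_Y_def k2_inner k3_linear k3_commute inner_add_right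
        algebra_simps add_divide_distrib diff_divide_distrib)
  have S: "form_S ?q ?v = 2 * (iib_F k r v - Re (gtau r) * iib_E k r v)"
    unfolding form_S_def
    by (simp add: b_to_a_def d_b_to_a_def Let_def iib_F_def iib_E_def k2_inner k2_linear k3_linear k3_commute inner_add_right
        inner_add_left inner_diff_left inner_diff_right inner_commute algebra_simps add_divide_distrib diff_divide_distrib)
  show ?thesis
    unfolding flat_metric_def Let_def A Y E S unfolding fb iib_metric_def Let_def log_hess_def
    using s h by (simp add: field_simps power2_eq_square)
qed

lemma log_hess_diff:
  "log_hess k t (x - x') y = log_hess k t x y - log_hess k t x' y"
  "log_hess k t x (y - y') = log_hess k t x y - log_hess k t x y'"
  by (simp_all add: log_hess_def k3_linear algebra_simps add_divide_distrib diff_divide_distrib)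

lemma log_hess_scale: "0 < l \<Longrightarrow> log_hess k (l *\<^sub>R t) x y = log_hess k t x y / l\<^sup>2"
  by (simp add: log_hess_def k3_linear cubic_scaleR power2_eq_square power3_eq_cube diff_divide_distrib mult_ac)

lemma hinv_scale:
  assumes l: "0 < l" and t: "t \<in> cone H"
  shows "hinv (l *\<^sub>R t) *v x = (1 / l) *\<^sub>R (hinv t *v x)"
proof -
  have "k2 k (l *\<^sub>R t) ((1 / l) *\<^sub>R (hinv t *v x)) = x"
    using l by (simp add: k2_linear hess_inv(1)[OF t])
  then show ?thesis using hess_inv(2)[OF cone_scaleR[OF t l]] by metis
qed

lemma iib_metric_invariant:
  assumes m: "det m = 1" and r: "r \<in> dom_b"
  shows "iib_metric (slb m r) (d_slb m r v) = iib_metric r v"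
proof -
  have t: "gt r \<in> cone H" and s: "0 < Im (gtau r)" using r by (auto simp: dom_b_def)
  define h where "h = cubic k (gt r)"
  have h: "0 < h" using cubic_pos[OF t] by (simp add: h_def)
  define p q a c where "p = m$1$1" and "q = m$1$2" and "a = m$2$1" and "c = m$2$2"
  have det: "p * c - q * a = 1" using m by (simp add: det_2 p_def q_def a_def c_def)
  define x1 x2 where "x1 = Re (gtau r)" and "x2 = Im (gtau r)"
  define y1 y2 where "y1 = Re (gtau v)" and "y2 = Im (gtau v)"
  define j1 j2 where "j1 = a * x1 + c" and "j2 = a * x2"
  let ?j = "of_real (m$2$1) * gtau r + of_real (m$2$2)"
  have j: "?j = Complex j1 j2" by (simp add: complex_eq_iff j1_def j2_def x1_def x2_def a_def c_def)
  define l where "l = cmod ?j"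
  have l: "0 < l" using slb_denominator[OF m s] by (simp add: l_def)
  have l2: "l\<^sup>2 = j1\<^sup>2 + j2\<^sup>2" by (simp add: l_def j cmod_power2)
  have x2: "0 < x2" using s by (simp add: x2_def)
  let ?r = "slb m r" and ?v = "d_slb m r v"
  \<comment> \<open>The logarithmic derivative of \<open>l\<close> along \<open>v\<close>; it adds a
    radial part to \<open>dt\<close>.\<close>
  define \<kappa> where "\<kappa> = a * (j1 * y1 + j2 * y2) / l\<^sup>2"
  have t': "gt ?r = l *\<^sub>R gt r" by (simp add: slb_def l_def)
  have vt': "gt ?v = l *\<^sub>R (gt v + \<kappa> *\<^sub>R gt r)"
    using l by (simp add: d_slb_def Let_def l_def[symmetric] \<kappa>_def a_def y1_def y2_def scaleR_right_distrib power2_eq_square)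
      (simp add: j1_def j2_def a_def c_def x1_def x2_def)
  have h': "cubic k (l *\<^sub>R gt r) = l ^ 3 * h" by (simp add: cubic_scaleR h_def)
  have h6: "k3 k (gt r) (gt r) (gt r) = 6 * h" by (simp add: h_def cubic_k3)
  have x2': "Im (gtau ?r) = x2 / l\<^sup>2"
    by (simp add: slb_def Im_moebius[OF m] x2_def l_def)
  have x1': "Re (gtau ?r) = ((p * x1 + q) * j1 + p * x2 * j2) / l\<^sup>2"
    by (simp add: slb_def Re_divide j l2) (simp add: p_def q_def x1_def x2_def algebra_simps)
  have v': "gtau ?v = Complex (y1 * (j1\<^sup>2 - j2\<^sup>2) + 2 * y2 * j1 * j2) (y2 * (j1\<^sup>2 - j2\<^sup>2) - 2 * y1 * j1 * j2) / of_real ((l\<^sup>2)\<^sup>2)"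
  proof -
    have "gtau v / ?j\<^sup>2 = gtau v * (cnj ?j)\<^sup>2 / of_real ((l\<^sup>2)\<^sup>2)"
      using l by (simp add: l_def complex_div_cnj[of "gtau v" "?j\<^sup>2"] norm_power power_mult_distrib)
    moreover have "gtau v * (cnj ?j)\<^sup>2 = Complex (y1 * (j1\<^sup>2 - j2\<^sup>2) + 2 * y2 * j1 * j2) (y2 * (j1\<^sup>2 - j2\<^sup>2) - 2 * y1 * j1 * j2)"
      unfolding j by (simp add: complex_eq_iff power2_eq_square y1_def y2_def algebra_simps)
    ultimately show ?thesis by (simp add: d_slb_def Let_def)
  qed
  have y1': "Re (gtau ?v) = (y1 * (j1\<^sup>2 - j2\<^sup>2) + 2 * y2 * j1 * j2) / (l\<^sup>2)\<^sup>2"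
    and y2': "Im (gtau ?v) = (y2 * (j1\<^sup>2 - j2\<^sup>2) - 2 * y1 * j1 * j2) / (l\<^sup>2)\<^sup>2"
    unfolding v' Re_divide_of_real Im_divide_of_real by simp_all
  text \<open>The action on the upper half plane is isometric, and its effect on \<open>Im \<tau>\<close> is a rescaling
    by \<open>l\<^sup>-\<^sup>2\<close> with logarithmic derivative \<open>- 2 \<kappa>\<close>.\<close>
  have th: "Im (gtau ?v) / Im (gtau ?r) = y2 / x2 - 2 * \<kappa>"
  proof -
    have eq: "y2 * (j1\<^sup>2 - j2\<^sup>2) - 2 * y1 * j1 * j2 = y2 * l\<^sup>2 - 2 * x2 * (a * (j1 * y1 + j2 * y2))"
      unfolding l2 by (simp add: j2_def power2_eq_square algebra_simps)
    show ?thesis unfolding y2' x2' \<kappa>_def eq using l x2 by (simp add: field_simps power2_eq_square)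
  qed
  have hyp: "(Re (gtau ?v) / Im (gtau ?r))\<^sup>2 = (y1 / x2)\<^sup>2 + (y2 / x2)\<^sup>2 - (y2 / x2 - 2 * \<kappa>)\<^sup>2"
  proof -
    have "(y1 * (j1\<^sup>2 - j2\<^sup>2) + 2 * y2 * j1 * j2)\<^sup>2 + (y2 * (j1\<^sup>2 - j2\<^sup>2) - 2 * y1 * j1 * j2)\<^sup>2 = (y1\<^sup>2 + y2\<^sup>2) * (l\<^sup>2)\<^sup>2"
      unfolding l2 by (simp add: power2_eq_square algebra_simps)
    then have "((y1 * (j1\<^sup>2 - j2\<^sup>2) + 2 * y2 * j1 * j2) / (x2 * l\<^sup>2))\<^sup>2 + ((y2 * (j1\<^sup>2 - j2\<^sup>2) - 2 * y1 * j1 * j2) / (x2 * l\<^sup>2))\<^sup>2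
        = (y1\<^sup>2 + y2\<^sup>2) * (l\<^sup>2)\<^sup>2 / (x2 * l\<^sup>2)\<^sup>2"
      by (simp add: power_divide add_divide_distrib[symmetric])
    also have "\<dots> = (y1 / x2)\<^sup>2 + (y2 / x2)\<^sup>2"
      using l x2 by (simp add: power_divide power_mult_distrib add_divide_distrib)
    finally have *: "((y1 * (j1\<^sup>2 - j2\<^sup>2) + 2 * y2 * j1 * j2) / (x2 * l\<^sup>2))\<^sup>2 + ((y2 * (j1\<^sup>2 - j2\<^sup>2) - 2 * y1 * j1 * j2) / (x2 * l\<^sup>2))\<^sup>2
        = (y1 / x2)\<^sup>2 + (y2 / x2)\<^sup>2" .
    have d: "X / (l\<^sup>2)\<^sup>2 / (x2 / l\<^sup>2) = X / (x2 * l\<^sup>2)" for X using l x2 by (simp add: field_simps power2_eq_square)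
    show ?thesis
      using * unfolding th[symmetric] unfolding y1' y2' x2' d by linarith
  qed
  have T2: "- log_hess k (gt ?r) (gt ?v) (gt ?v) / 4
      + (2 * (Im (gtau ?v) / Im (gtau ?r)) + k3 k (gt ?r) (gt ?r) (gt ?v) / (2 * cubic k (gt ?r)))\<^sup>2 / 4
      + (Re (gtau ?v) / Im (gtau ?r))\<^sup>2 / 4
    = - log_hess k (gt r) (gt v) (gt v) / 4 + (2 * (y2 / x2) + k3 k (gt r) (gt r) (gt v) / (2 * h))\<^sup>2 / 4 + (y1 / x2)\<^sup>2 / 4"
  proof -
    have lt: "log_hess k (gt r) (gt v) (gt r) = - (k3 k (gt r) (gt r) (gt v) / (2 * h))" "log_hess k (gt r) (gt r) (gt r) = - 3"
      using h unfolding log_hess_def by (simp_all add: h6 h_def[symmetric] k3_commute field_simps power2_eq_square)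
    have sc: "log_hess k (l *\<^sub>R gt r) (l *\<^sub>R x) (l *\<^sub>R y) = log_hess k (gt r) x y" for x y
      using l by (simp add: log_hess_scale log_hess_linear(3,4) power2_eq_square)
    have "log_hess k (gt ?r) (gt ?v) (gt ?v) = log_hess k (gt r) (gt v) (gt v) - 2 * \<kappa> * (k3 k (gt r) (gt r) (gt v) / (2 * h)) - 3 * \<kappa>\<^sup>2"
      unfolding t' vt' sc
      by (simp add: log_hess_linear log_hess_commute[of "gt r" "gt r" "gt v"] lt power2_eq_square algebra_simps)
    moreover have "k3 k (gt ?r) (gt ?r) (gt ?v) / (2 * cubic k (gt ?r)) = k3 k (gt r) (gt r) (gt v) / (2 * h) + 3 * \<kappa>"
      unfolding t' vt' h' using l h by (simp add: k3_linear h6 field_simps power2_eq_square power3_eq_cube)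
    \<comment> \<open>\<open>\<kappa>\<close> enters through the radial part of \<open>dt\<close>,
      through \<open>dIm \<tau>\<close> and, by the hyperbolic isometry, through
      \<open>dRe \<tau>\<close>. The relative weights of the three terms are such that it
      cancels.\<close>
    moreover have "- (L - 2 * \<kappa> * m - 3 * \<kappa>\<^sup>2) / 4 + (2 * (u - 2 * \<kappa>) + (m + 3 * \<kappa>))\<^sup>2 / 4
        + (w\<^sup>2 + u\<^sup>2 - (u - 2 * \<kappa>)\<^sup>2) / 4 = - L / 4 + (2 * u + m)\<^sup>2 / 4 + w\<^sup>2 / 4" for L m u w :: real
      by (simp add: power2_eq_square algebra_simps add_divide_distrib diff_divide_distrib)
    ultimately show ?thesis unfolding th hyp by (simp only:)
  qed
  \<comment> \<open>With \<open>db\<close> scaled by \<open>Im \<tau>\<close>, the pair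
    \<open>(Y, B)\<close> is rotated by the phase of \<open>j1 + i j2\<close>, up to the scale
    \<open>1 / l\<close>. A sum of equal quadratic forms in \<open>Y\<close> and \<open>B\<close>
    sees this scale only, and \<open>log_hess_scale\<close> absorbs it.\<close>
  define Y B where "Y = iib_Y r v" and "B = x2 *\<^sub>R gb v"
  have Y': "iib_Y ?r ?v = (1 / l\<^sup>2) *\<^sub>R (j1 *\<^sub>R Y + j2 *\<^sub>R B)"
  proof -
    have 1: "((p * x1 + q) * j1 + p * x2 * j2) * a - p * l\<^sup>2 = - j1"
    proof -
      have "((p * x1 + q) * j1 + p * x2 * j2) * a - p * l\<^sup>2 = - j1 * (p * c - q * a)"
        unfolding l2 j1_def j2_def by (simp add: algebra_simps power2_eq_square)
      then show ?thesis by (simp add: det)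
    qed
    have 2: "((p * x1 + q) * j1 + p * x2 * j2) * c - q * l\<^sup>2 = j1 * x1 + j2 * x2"
    proof -
      have "((p * x1 + q) * j1 + p * x2 * j2) * c - q * l\<^sup>2 = (j1 * x1 + j2 * x2) * (p * c - q * a)"
        unfolding l2 j1_def j2_def by (simp add: algebra_simps power2_eq_square)
      then show ?thesis by (simp add: det)
    qed
    have "l\<^sup>2 *\<^sub>R iib_Y ?r ?v = (((p * x1 + q) * j1 + p * x2 * j2) * a - p * l\<^sup>2) *\<^sub>R gc v
        + (((p * x1 + q) * j1 + p * x2 * j2) * c - q * l\<^sup>2) *\<^sub>R gb v"
      unfolding iib_Y_def x1' using l
      by (simp add: d_slb_def Let_def p_def q_def a_def c_def scaleR_right_diff_distrib scaleR_add_right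
          scaleR_left_diff_distrib mult.commute[of "l\<^sup>2"])
    also have "\<dots> = j1 *\<^sub>R Y + j2 *\<^sub>R B"
      unfolding 1 2 by (simp add: Y_def B_def iib_Y_def x1_def algebra_simps)
    finally have "l\<^sup>2 *\<^sub>R iib_Y ?r ?v = j1 *\<^sub>R Y + j2 *\<^sub>R B" .
    then have "(1 / l\<^sup>2) *\<^sub>R l\<^sup>2 *\<^sub>R iib_Y ?r ?v = (1 / l\<^sup>2) *\<^sub>R (j1 *\<^sub>R Y + j2 *\<^sub>R B)" by (rule arg_cong)
    then show ?thesis using l by simp
  qed
  have B': "gb ?v = (1 / x2) *\<^sub>R (j1 *\<^sub>R B - j2 *\<^sub>R Y)"
  proof -
    have "j1 *\<^sub>R B - j2 *\<^sub>R Y = x2 *\<^sub>R gb ?v"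
      by (simp add: d_slb_def Let_def B_def Y_def iib_Y_def j1_def j2_def a_def c_def x1_def algebra_simps)
    then show ?thesis using x2 by simp
  qed
  have T1: "log_hess k (gt ?r) (gb ?v) (gb ?v) + log_hess k (gt ?r) (iib_Y ?r ?v) (iib_Y ?r ?v) / (Im (gtau ?r))\<^sup>2
     = log_hess k (gt r) (gb v) (gb v) + log_hess k (gt r) Y Y / x2\<^sup>2"
  proof -
    define LYY LYB LBB where "LYY = log_hess k (gt r) Y Y" and "LYB = log_hess k (gt r) Y B"
      and "LBB = log_hess k (gt r) B B"
    have e1: "log_hess k (gt r) (j1 *\<^sub>R B - j2 *\<^sub>R Y) (j1 *\<^sub>R B - j2 *\<^sub>R Y) = j1\<^sup>2 * LBB - 2 * j1 * j2 * LYB + j2\<^sup>2 * LYY"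
      by (simp add: log_hess_diff log_hess_linear LYY_def LYB_def LBB_def log_hess_commute[of "gt r" B Y] power2_eq_square
          algebra_simps)
    have e2: "log_hess k (gt r) (j1 *\<^sub>R Y + j2 *\<^sub>R B) (j1 *\<^sub>R Y + j2 *\<^sub>R B) = j1\<^sup>2 * LYY + 2 * j1 * j2 * LYB + j2\<^sup>2 * LBB"
      by (simp add: log_hess_linear LYY_def LYB_def LBB_def log_hess_commute[of "gt r" B Y] power2_eq_square algebra_simps)
    have e3: "log_hess k (gt r) (gb v) (gb v) = LBB / x2\<^sup>2"
      using x2 by (simp add: LBB_def B_def log_hess_linear power2_eq_square)
    have "log_hess k (gt ?r) (gb ?v) (gb ?v) + log_hess k (gt ?r) (iib_Y ?r ?v) (iib_Y ?r ?v) / (Im (gtau ?r))\<^sup>2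
        = (j1\<^sup>2 * LBB - 2 * j1 * j2 * LYB + j2\<^sup>2 * LYY + (j1\<^sup>2 * LYY + 2 * j1 * j2 * LYB + j2\<^sup>2 * LBB)) / (l\<^sup>2 * x2\<^sup>2)"
      unfolding t' Y' B' log_hess_scale[OF l] log_hess_linear(3,4) e1 e2 x2'
      using l x2 by (simp add: field_simps power2_eq_square)
    also have "\<dots> = (j1\<^sup>2 + j2\<^sup>2) * (LYY + LBB) / (l\<^sup>2 * x2\<^sup>2)"
      by (simp add: algebra_simps)
    also have "\<dots> = log_hess k (gt r) (gb v) (gb v) + log_hess k (gt r) Y Y / x2\<^sup>2"
      unfolding l2[symmetric] e3 LYY_def[symmetric] using l by (simp add: add_divide_distrib add.commute)
    finally show ?thesis .
  qed
  have A: "iib_A k ?r ?v = iib_A k r v"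
  proof -
    have "k2 k (gc ?r) (gb ?v) - k2 k (gb ?r) (gc ?v) = (p * c - q * a) *\<^sub>R (k2 k (gc r) (gb v) - k2 k (gb r) (gc v))"
      by (rule vec_eq_innerI)
        (simp add: slb_def d_slb_def Let_def p_def q_def a_def c_def k2_inner k3_linear inner_diff_left k3_commute algebra_simps)
    then show ?thesis unfolding iib_A_def by (simp add: det) (simp add: d_slb_def Let_def)
  qed
  have T3: "(iib_A k ?r ?v \<bullet> (hinv (gt ?r) *v iib_A k ?r ?v) / 2 - (gt ?r \<bullet> iib_A k ?r ?v)\<^sup>2 / (4 * cubic k (gt ?r)))
        / (2 * (Im (gtau ?r))\<^sup>2 * cubic k (gt ?r))
     = (iib_A k r v \<bullet> (hinv (gt r) *v iib_A k r v) / 2 - (gt r \<bullet> iib_A k r v)\<^sup>2 / (4 * h)) / (2 * x2\<^sup>2 * h)"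
    unfolding A x2' t' h' hinv_scale[OF l t]
    using l x2 h by (simp add: field_simps power2_eq_square power3_eq_cube)
  define E F where "E = iib_E k r v" and "F = iib_F k r v"
  have inv3: "k3 k x (gc ?r) (gb ?v) - k3 k x (gb ?r) (gc ?v) = k3 k x (gc r) (gb v) - k3 k x (gb r) (gc v)" for x
  proof -
    have "k3 k x (gc ?r) (gb ?v) - k3 k x (gb ?r) (gc ?v) = (p * c - q * a) * (k3 k x (gc r) (gb v) - k3 k x (gb r) (gc v))"
      by (simp add: slb_def d_slb_def Let_def p_def q_def a_def c_def k3_linear algebra_simps)
    then show ?thesis by (simp add: det)
  qed
  have E': "iib_E k ?r ?v = c * E + a * F"
    unfolding iib_E_def inv3 by (simp add: E_def F_def iib_E_def iib_F_def slb_def d_slb_def Let_def a_def c_def k3_linear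
        inner_add_left algebra_simps add_divide_distrib diff_divide_distrib)
  have F': "iib_F k ?r ?v = q * E + p * F"
    unfolding iib_F_def inv3 by (simp add: E_def F_def iib_E_def iib_F_def slb_def d_slb_def Let_def p_def q_def k3_linear
        inner_add_left algebra_simps add_divide_distrib diff_divide_distrib)
  have T4: "((iib_E k ?r ?v)\<^sup>2 + ((iib_F k ?r ?v - Re (gtau ?r) * iib_E k ?r ?v) / Im (gtau ?r))\<^sup>2)
       / (4 * (Im (gtau ?r))\<^sup>2 * (cubic k (gt ?r))\<^sup>2)
     = (E\<^sup>2 + ((F - x1 * E) / x2)\<^sup>2) / (4 * x2\<^sup>2 * h\<^sup>2)"
  proof -
    \<comment> \<open>The pair \<open>(x2 * E, G)\<close> undergoes the same rotation by
      \<open>j1 + i j2\<close> up to scale, so the sum of squares picks up a power of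
      \<open>l\<close> that the prefactor compensates.\<close>
    define G where "G = F - x1 * E"
    have 1: "iib_E k ?r ?v = (j1 * (x2 * E) + j2 * G) / x2"
      unfolding E' G_def j1_def j2_def using x2 by (simp add: field_simps)
    have 2: "(iib_F k ?r ?v - Re (gtau ?r) * iib_E k ?r ?v) / Im (gtau ?r) = (j1 * G - j2 * (x2 * E)) / x2"
    proof -
      have "l\<^sup>2 * (q * E + p * F) - ((p * x1 + q) * j1 + p * x2 * j2) * (c * E + a * F)
          = (j1 * G - j2 * (x2 * E)) * (p * c - q * a)"
        unfolding l2 j1_def j2_def G_def by (simp add: algebra_simps power2_eq_square)
      then have "l\<^sup>2 * (q * E + p * F) - ((p * x1 + q) * j1 + p * x2 * j2) * (c * E + a * F) = j1 * G - j2 * (x2 * E)"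
        by (simp add: det)
      moreover have "(P - X / l\<^sup>2 * Q) / (x2 / l\<^sup>2) = (l\<^sup>2 * P - X * Q) / x2" for P X Q
        using l x2 by (simp add: field_simps)
      ultimately show ?thesis unfolding E' F' x1' x2' by (simp only:)
    qed
    have "((j1 * (x2 * E) + j2 * G) / x2)\<^sup>2 + ((j1 * G - j2 * (x2 * E)) / x2)\<^sup>2 = l\<^sup>2 * ((x2 * E)\<^sup>2 + G\<^sup>2) / x2\<^sup>2"
      unfolding l2 power_divide add_divide_distrib[symmetric] by (simp add: power2_eq_square algebra_simps)
    also have "\<dots> = l\<^sup>2 * (E\<^sup>2 + (G / x2)\<^sup>2)" using x2 by (simp add: field_simps power2_eq_square)
    finally have sq: "((j1 * (x2 * E) + j2 * G) / x2)\<^sup>2 + ((j1 * G - j2 * (x2 * E)) / x2)\<^sup>2 = l\<^sup>2 * (E\<^sup>2 + (G / x2)\<^sup>2)" .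
    have "l\<^sup>2 * P / (4 * (x2 / l\<^sup>2)\<^sup>2 * (l ^ 3 * h)\<^sup>2) = P / (4 * x2\<^sup>2 * h\<^sup>2)" for P
      using l x2 h by (simp add: field_simps power2_eq_square power3_eq_cube)
    then show ?thesis
      unfolding 2 unfolding 1 sq G_def[symmetric] x2' t' h' by (simp only:)
  qed
  show ?thesis
    unfolding iib_metric_def Let_def T1 T2 T3 T4
    unfolding h_def[symmetric] E_def[symmetric] F_def[symmetric] Y_def[symmetric]
      x1_def[symmetric] x2_def[symmetric] y1_def[symmetric] y2_def[symmetric] ..
qed

text \<open>The derivative of \<open>a_to_b\<close> stays abstract: differentiating
  \<open>b_to_a k (a_to_b k q) = q\<close> shows that \<open>d_b_to_a\<close> undoes it. So the
  metric in type IIB coordinates is \<open>iib_metric\<close>, whose invariance carries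
  over.\<close>

lemma sl_isometry:
  assumes m: "det m = 1"
  shows "lift (sl k m) \<in> carrier (q_iso k H)"
proof -
  have "invertible m" using m by (simp add: invertible_det_nz)
  note mi = matrix_inv_works[OF this]
  have m': "det (matrix_inv m) = 1"
    using arg_cong[OF mi(1), of det] m by (simp add: det_mul)
  have da: "(a_to_b k has_derivative frechet_derivative (a_to_b k) (at q)) (at q)" if "q \<in> flat_dom" for q
    using smooth_on_imp_differentiable[OF smooth_a_to_b that] frechet_works by blast
  let ?D = "\<lambda>q v. d_b_to_a k (slb m (a_to_b k q)) (d_slb m (a_to_b k q) (frechet_derivative (a_to_b k) (at q) v))"
  show ?thesis
  proof (rule lift_isometry[where f' = "sl k (matrix_inv m)" and D = ?D])
    fix q :: "'n flat" assume q: "q \<in> flat_dom"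
    let ?a = "frechet_derivative (a_to_b k) (at q)"
    show "sl k m q \<in> flat_dom" "sl k (matrix_inv m) q \<in> flat_dom" using sl_dom m m' q by blast+
    show "sl k (matrix_inv m) (sl k m q) = q" "sl k m (sl k (matrix_inv m) q) = q"
      by (simp_all add: sl_mult m m' q mi sl_one)
    show "(sl k m has_derivative ?D q) (at q)"
      unfolding sl_def[abs_def]
      by (rule has_derivative_compose[OF has_derivative_compose[OF da[OF q] has_derivative_slb[OF m a_to_b_dom[OF q]]]
            has_derivative_b_to_a])
    show "flat_metric (sl k m q) (?D q v) (?D q v) = flat_metric q v v" for v
    proof -
      have 1: "((\<lambda>q. b_to_a k (a_to_b k q)) has_derivative (\<lambda>v. d_b_to_a k (a_to_b k q) (?a v))) (at q)"
        by (rule has_derivative_compose[OF da[OF q] has_derivative_b_to_a])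
      have 2: "((\<lambda>q. b_to_a k (a_to_b k q)) has_derivative (\<lambda>v. v)) (at q)"
        by (rule has_derivative_cong_open[OF open_flat_dom q _ has_derivative_ident]) (simp add: b_to_a_to_b)
      have "d_b_to_a k (a_to_b k q) (?a v) = v" using has_derivative_unique[OF 1 2] by metis
      then have "flat_metric q v v = iib_metric (a_to_b k q) (?a v)"
        using flat_metric_b_to_a[OF a_to_b_dom[OF q], of "?a v"] by (simp add: b_to_a_to_b q)
      then show ?thesis
        unfolding sl_def flat_metric_b_to_a[OF slb_dom[OF m a_to_b_dom[OF q]]] iib_metric_invariant[OF m a_to_b_dom[OF q]] by simp
    qed
  qed (use smooth_sl m m' in blast)+
qed

end

section \<open>The Lie algebra\<close>

text \<open>Coefficients \<open>((d, z), (p0, p), (x0, x), v, h, f)\<close> of a linear combination of the fields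
  \<open>D\<close>, \<open>Z\<close>, \<open>P\<close>, \<open>X\<close>, \<open>V\<close>, \<open>X_h\<close> and \<open>X_f\<close>. All but the last of these fields are affine.\<close>

type_synonym 'n par = "(real \<times> real) \<times> (real \<times> (real ^ 'n)) \<times> (real \<times> (real ^ 'n)) \<times> (real ^ 'n) \<times> real \<times> real"

abbreviation "pd \<equiv> \<lambda>c :: 'n::finite par. fst (fst c)"
abbreviation "pz \<equiv> \<lambda>c :: 'n::finite par. snd (fst c)"
abbreviation "pp0 \<equiv> \<lambda>c :: 'n::finite par. fst (fst (snd c))"
abbreviation "pp \<equiv> \<lambda>c :: 'n::finite par. snd (fst (snd c))"
abbreviation "px0 \<equiv> \<lambda>c :: 'n::finite par. fst (fst (snd (snd c)))"
abbreviation "px \<equiv> \<lambda>c :: 'n::finite par. snd (fst (snd (snd c)))"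
abbreviation "pv \<equiv> \<lambda>c :: 'n::finite par. fst (snd (snd (snd c)))"
abbreviation "ph \<equiv> \<lambda>c :: 'n::finite par. fst (snd (snd (snd (snd c))))"
abbreviation "pf \<equiv> \<lambda>c :: 'n::finite par. snd (snd (snd (snd (snd c))))"

text \<open>The factors built from \<open>pd\<close> and \<open>ph\<close> are the weights of the
  coordinates under \<open>D\<close> and \<open>X_h\<close>; \<open>pv\<close> acts nilpotently, and
  \<open>pp\<close>, \<open>px\<close> produce the Heisenberg terms in the last coordinate.
  \<open>X_e\<close> has no parameter of its own, being \<open>P_0\<close>.\<close>

definition aff_lin :: "'n::finite coeffs \<Rightarrow> 'n par \<Rightarrow> 'n flat \<Rightarrow> 'n flat" where
  "aff_lin k c q = (((- ph c) *\<^sub>R fb q, (- ph c) *\<^sub>R ft q), (pd c + ph c) * fr q,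
     ((pd c / 2 - ph c) * fu0 q - fu q \<bullet> pv c, (pd c / 2) *\<^sub>R fu q - k2 k (pv c) (fw q)),
     ((pd c / 2 + 2 * ph c) * fw0 q, (pd c / 2 + ph c) *\<^sub>R fw q + fw0 q *\<^sub>R pv c),
     (pd c + ph c) * fs q + fu0 q * pp0 c + fu q \<bullet> pp c - fw0 q * px0 c - fw q \<bullet> px c)"

definition aff_field :: "'n::finite coeffs \<Rightarrow> 'n par \<Rightarrow> 'n flat \<Rightarrow> 'n flat" where
  "aff_field k c q = aff_lin k c q + ((pv c, 0), 0, (px0 c, px c), (pp0 c, pp c), pz c)"

text \<open>The function \<open>2 \<rho> / h(t)\<close> is \<open>(Im \<tau>)\<^sup>2\<close> in type IIB coordinates.\<close>

definition f_field :: "'n::finite coeffs \<Rightarrow> 'n flat \<Rightarrow> 'n flat" where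
  "f_field k q = (let b = fb q; t = ft q; u0 = fu0 q; u = fu q; w0 = fw0 q; w = fw q; R = 2 * fr q / cubic k t in
     ((w0 *\<^sub>R b - w, w0 *\<^sub>R t), - w0 * fr q,
      ((fs q + w0 * u0 + w \<bullet> u) / 2 + R * k3 k b b b / 6, (1/2) *\<^sub>R k2 k w w - (R / 2) *\<^sub>R k2 k b b),
      (R - w0\<^sup>2, R *\<^sub>R b - w0 *\<^sub>R w),
      R * (- u0 - b \<bullet> u + w0 * k3 k b b b / 6 - k3 k b b w / 2) - w0 * (fs q - w0 * u0 - w \<bullet> u) / 2 + k3 k w w w / 6))"

definition d_f_field :: "'n::finite coeffs \<Rightarrow> 'n flat \<Rightarrow> 'n flat \<Rightarrow> 'n flat" where
  "d_f_field k q d = (let b = fb q; t = ft q; u0 = fu0 q; u = fu q; w0 = fw0 q; w = fw q; R = 2 * fr q / cubic k t;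
       R' = 2 * fr d / cubic k t - fr q * k3 k t t (ft d) / (cubic k t)\<^sup>2 in
     ((fw0 d *\<^sub>R b + w0 *\<^sub>R fb d - fw d, fw0 d *\<^sub>R t + w0 *\<^sub>R ft d), - fw0 d * fr q - w0 * fr d,
      ((fs d + fw0 d * u0 + w0 * fu0 d + fw d \<bullet> u + w \<bullet> fu d) / 2 + R' * k3 k b b b / 6 + R * k3 k b b (fb d) / 2,
       k2 k w (fw d) - (R' / 2) *\<^sub>R k2 k b b - R *\<^sub>R k2 k b (fb d)),
      (R' - 2 * w0 * fw0 d, R' *\<^sub>R b + R *\<^sub>R fb d - fw0 d *\<^sub>R w - w0 *\<^sub>R fw d),
      R' * (- u0 - b \<bullet> u + w0 * k3 k b b b / 6 - k3 k b b w / 2)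
      + R * (- fu0 d - fb d \<bullet> u - b \<bullet> fu d + fw0 d * k3 k b b b / 6 + w0 * k3 k b b (fb d) / 2
          - k3 k b (fb d) w - k3 k b b (fw d) / 2)
      - fw0 d * (fs q - w0 * u0 - w \<bullet> u) / 2
      - w0 * (fs d - fw0 d * u0 - w0 * fu0 d - fw d \<bullet> u - w \<bullet> fu d) / 2 + k3 k w w (fw d) / 2))"

definition par_field :: "'n::finite coeffs \<Rightarrow> 'n par \<Rightarrow> 'n flat \<Rightarrow> 'n flat" where
  "par_field k c q = aff_field k c q + pf c *\<^sub>R f_field k q"

text \<open>The structure constants of the affine fields. Their brackets lie in the span of
  \<open>Z\<close>, \<open>P\<close>, \<open>X\<close> and \<open>V\<close>; the factor
  \<open>2\<close> in the coefficient of \<open>Z\<close> is the Heisenberg commutator.\<close>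

definition aff_bracket :: "'n::finite coeffs \<Rightarrow> 'n par \<Rightarrow> 'n par \<Rightarrow> 'n par" where
  "aff_bracket k c c' =
    ((0, (pd c' + ph c') * pz c - (pd c + ph c) * pz c'
        + 2 * (px0 c * pp0 c' + px c \<bullet> pp c' - pp0 c * px0 c' - pp c \<bullet> px c')),
     ((pd c' / 2 + 2 * ph c') * pp0 c - (pd c / 2 + 2 * ph c) * pp0 c',
      (pd c' / 2 + ph c') *\<^sub>R pp c - (pd c / 2 + ph c) *\<^sub>R pp c' + pp0 c *\<^sub>R pv c' - pp0 c' *\<^sub>R pv c),
     ((pd c' / 2 - ph c') * px0 c - (pd c / 2 - ph c) * px0 c' - px c \<bullet> pv c' + px c' \<bullet> pv c,
      (pd c' / 2) *\<^sub>R px c - (pd c / 2) *\<^sub>R px c' - k2 k (pv c') (pp c) + k2 k (pv c) (pp c')),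
     ph c *\<^sub>R pv c' - ph c' *\<^sub>R pv c, 0, 0)"

text \<open>The brackets of the affine fields with \<open>X_f\<close>. The entry
  \<open>- pp0 c\<close> is the relation between \<open>e\<close>, \<open>f\<close> and
  \<open>h\<close> in \<open>sl(2)\<close>, as \<open>P_0 = X_e\<close>. Up to factors
  \<open>Z\<close> goes to \<open>X^0\<close>, \<open>P_a\<close> to \<open>V_a\<close>, and the
  weights of \<open>X_f\<close> under \<open>D\<close> and \<open>X_h\<close> make up the last
  entry.\<close>

definition f_bracket :: "'n::finite par \<Rightarrow> 'n par" where
  "f_bracket c = ((0, 0), (0, 0), (pz c / 2, 0), - pp c, - pp0 c, pd c / 2 + 2 * ph c)"

lemma linear_aff_lin: "linear (aff_lin k c)"
  by (rule linearI; simp add: aff_lin_def prod_eq_iff k2_linear inner_add_left algebra_simps)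

lemma par_field_linear:
  "par_field k (c + c') q = par_field k c q + par_field k c' q"
  "par_field k (r *\<^sub>R c) q = r *\<^sub>R par_field k c q"
  by (simp_all add: par_field_def aff_field_def aff_lin_def prod_eq_iff k2_linear inner_add_right algebra_simps
      add_divide_distrib)

section \<open>Brackets and independence of the generating fields\<close>

context psr
begin

lemma has_derivative_f_field:
  assumes q: "q \<in> flat_dom"
  shows "(f_field k has_derivative d_f_field k q) (at q)"
proof -
  have h: "cubic k (ft q) \<noteq> 0" using q cubic_pos by (force simp: flat_dom_def)
  have dh: "((\<lambda>q. cubic k (ft q)) has_derivative (\<lambda>d. k3 k (ft q) (ft q) (ft d) / 2)) (at q)"
    by (rule derivative_intros)+
  have dR: "((\<lambda>q. 2 * fr q / cubic k (ft q)) has_derivative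
      (\<lambda>d. 2 * fr d / cubic k (ft q) - fr q * k3 k (ft q) (ft q) (ft d) / (cubic k (ft q))\<^sup>2)) (at q)"
    by (rule has_derivative_eq_rhs[OF has_derivative_divide'[OF _ dh h]], (rule derivative_intros)+)
      (use h in \<open>auto simp: field_simps power2_eq_square\<close>)
  note const = bounded_linear.has_derivative[OF bounded_linear_divide]
  show ?thesis
    unfolding f_field_def[abs_def] Let_def power2_eq_square
    by (rule has_derivative_eq_rhs, (rule dR const derivative_intros)+)
      (auto simp: d_f_field_def Let_def k3_commute k2_commute algebra_simps inner_commute power2_eq_square
         add_divide_distrib diff_divide_distrib scaleR_2[symmetric])
qed

lemma has_derivative_aff_field: "(aff_field k c has_derivative aff_lin k c) (at q)"
proof -
  have "bounded_linear (aff_lin k c)" using linear_aff_lin linear_conv_bounded_linear by blast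
  from has_derivative_add[OF bounded_linear_imp_has_derivative[OF this] has_derivative_const]
  show ?thesis by (simp add: aff_field_def[abs_def])
qed

lemma has_derivative_par_field:
  assumes "q \<in> flat_dom"
  shows "(par_field k c has_derivative (\<lambda>d. aff_lin k c d + pf c *\<^sub>R d_f_field k q d)) (at q)"
  unfolding par_field_def[abs_def]
  by (rule has_derivative_add[OF has_derivative_aff_field has_derivative_scaleR_right[OF has_derivative_f_field[OF assms]]])

lemma aff_bracket:
  "aff_lin k c' (aff_field k c q) - aff_lin k c (aff_field k c' q) = aff_field k (aff_bracket k c c') q"
proof -
  have u: "fu (aff_lin k c' (aff_field k c q) - aff_lin k c (aff_field k c' q)) = fu (aff_field k (aff_bracket k c c') q)"
    by (rule vec_eq_innerI)
      (simp add: aff_lin_def aff_field_def aff_bracket_def multilinear algebra_simps)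
  have w: "fw (aff_lin k c' (aff_field k c q) - aff_lin k c (aff_field k c' q)) = fw (aff_field k (aff_bracket k c c') q)"
    by (rule vec_eq_innerI)
      (simp add: aff_lin_def aff_field_def aff_bracket_def inner_add_left inner_diff_left algebra_simps)
  show ?thesis
    by (intro prod_eqI u w)
      (simp_all add: aff_lin_def aff_field_def aff_bracket_def multilinear
        inner_add_right inner_diff_right inner_commute algebra_simps)
qed

lemma f_bracket:
  assumes q: "q \<in> flat_dom"
  shows "d_f_field k q (aff_field k c q) - aff_lin k c (f_field k q) = par_field k (f_bracket c) q"
proof -
  have h: "cubic k (ft q) \<noteq> 0" using q cubic_pos by (force simp: flat_dom_def)
  define R where "R = 2 * fr q / cubic k (ft q)"
  let ?d = "aff_field k c q"
  have "k3 k (ft q) (ft q) (ft ?d) = - 6 * ph c * cubic k (ft q)"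
    by (simp add: aff_field_def aff_lin_def k3_linear cubic_k3)
  \<comment> \<open>\<open>R = 2 \<rho> / h(t)\<close> has weight \<open>1\<close> under
    \<open>D\<close>. Under \<open>X_h\<close> its weight is \<open>1 + 3\<close>, because
    \<open>t\<close> has weight \<open>-1\<close> there and \<open>h\<close> is cubic.\<close>
  then have R': "2 * fr ?d / cubic k (ft q) - fr q * k3 k (ft q) (ft q) (ft ?d) / (cubic k (ft q))\<^sup>2 = (pd c + 4 * ph c) * R"
    using h by (simp add: R_def aff_field_def aff_lin_def field_simps power2_eq_square)
  note defs = d_f_field_def par_field_def f_field_def Let_def R' R_def[symmetric]
  note simps = aff_lin_def aff_field_def f_bracket_def
  have b: "fb (d_f_field k q ?d - aff_lin k c (f_field k q)) = fb (par_field k (f_bracket c) q)"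
    unfolding defs by (simp add: vec_eq_iff simps algebra_simps)
  have t: "ft (d_f_field k q ?d - aff_lin k c (f_field k q)) = ft (par_field k (f_bracket c) q)"
    unfolding defs by (simp add: vec_eq_iff simps algebra_simps)
  have u: "fu (d_f_field k q ?d - aff_lin k c (f_field k q)) = fu (par_field k (f_bracket c) q)"
    unfolding defs
    by (rule vec_eq_innerI) (simp add: simps multilinear
        algebra_simps add_divide_distrib diff_divide_distrib)
  have w: "fw (d_f_field k q ?d - aff_lin k c (f_field k q)) = fw (par_field k (f_bracket c) q)"
    unfolding defs
    by (simp add: vec_eq_iff simps algebra_simps add_divide_distrib power2_eq_square)
  have u0: "fu0 (d_f_field k q ?d - aff_lin k c (f_field k q)) = fu0 (par_field k (f_bracket c) q)"
    unfolding defs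
    by (simp add: simps multilinear inner_add_right inner_diff_right
        inner_commute algebra_simps add_divide_distrib diff_divide_distrib)
  have w0: "fw0 (d_f_field k q ?d - aff_lin k c (f_field k q)) = fw0 (par_field k (f_bracket c) q)"
    unfolding defs by (simp add: simps algebra_simps power2_eq_square)
  have s: "fs (d_f_field k q ?d - aff_lin k c (f_field k q)) = fs (par_field k (f_bracket c) q)"
    unfolding defs
    by (simp add: simps multilinear inner_add_right inner_diff_right
        inner_commute algebra_simps add_divide_distrib diff_divide_distrib power2_eq_square)
  have r: "fr (d_f_field k q ?d - aff_lin k c (f_field k q)) = fr (par_field k (f_bracket c) q)"
    unfolding defs by (simp add: simps algebra_simps)
  show ?thesis
    by (intro prod_eqI b t u w u0 w0 s r)
qed

definition vlift :: "('n flat \<Rightarrow> 'n flat) \<Rightarrow> 'n iia \<Rightarrow> 'n iia" where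
  "vlift X = field_on (N_bar H) (\<lambda>p. to_iia (X (of_iia p)))"

lemma has_derivative_vlift:
  assumes "(X has_derivative X') (at (of_iia p))" "p \<in> N_bar H"
  shows "(vlift X has_derivative (\<lambda>v. to_iia (X' (of_iia v)))) (at p)"
proof (rule has_derivative_cong_open[OF open_N_bar assms(2)])
  show "((\<lambda>p. to_iia (X (of_iia p))) has_derivative (\<lambda>v. to_iia (X' (of_iia v)))) (at p)"
    by (rule bounded_linear.has_derivative[OF bounded_linear_to_iia],
        rule has_derivative_compose[OF bounded_linear_imp_has_derivative[OF bounded_linear_of_iia] assms(1)])
qed (simp add: vlift_def field_on_def)

text \<open>By bilinearity the bracket splits into affine brackets and brackets with
  \<open>X_f\<close>; the bracket of \<open>X_f\<close> with itself drops out.\<close>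

lemma lie_bracket_par_field:
  "\<exists>c''. lie_bracket (N_bar H) (vlift (par_field k c)) (vlift (par_field k c')) = vlift (par_field k c'')"
proof (intro exI ext)
  fix p
  show "lie_bracket (N_bar H) (vlift (par_field k c)) (vlift (par_field k c')) p =
    vlift (par_field k (aff_bracket k c c' + pf c' *\<^sub>R f_bracket c + (- pf c) *\<^sub>R f_bracket c')) p"
  proof (cases "p \<in> N_bar H")
    case True
    let ?q = "of_iia p"
    have q: "?q \<in> flat_dom" using True by simp
    note D = frechet_eqI[OF has_derivative_vlift[OF has_derivative_par_field[OF q] True]]
    have val: "of_iia (vlift X p) = X ?q" for X using True by (simp add: vlift_def field_on_def)
    have lin: "linear (d_f_field k ?q)" using has_derivative_f_field[OF q] has_derivative_linear by blast
    have "lie_bracket (N_bar H) (vlift (par_field k c)) (vlift (par_field k c')) p =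
      to_iia ((aff_lin k c' (par_field k c ?q) + pf c' *\<^sub>R d_f_field k ?q (par_field k c ?q))
        - (aff_lin k c (par_field k c' ?q) + pf c *\<^sub>R d_f_field k ?q (par_field k c' ?q)))"
      using True by (simp add: lie_bracket_def field_on_def D val linear_diff[OF linear_to_iia])
    also have "(aff_lin k c' (par_field k c ?q) + pf c' *\<^sub>R d_f_field k ?q (par_field k c ?q))
        - (aff_lin k c (par_field k c' ?q) + pf c *\<^sub>R d_f_field k ?q (par_field k c' ?q))
      = (aff_lin k c' (aff_field k c ?q) - aff_lin k c (aff_field k c' ?q))
        + pf c' *\<^sub>R (d_f_field k ?q (aff_field k c ?q) - aff_lin k c (f_field k ?q))
        + (- pf c) *\<^sub>R (d_f_field k ?q (aff_field k c' ?q) - aff_lin k c' (f_field k ?q))"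
      unfolding par_field_def
      by (simp add: linear_add[OF lin] linear_scale[OF lin] linear_add[OF linear_aff_lin] linear_scale[OF linear_aff_lin]
          algebra_simps)
    also have "\<dots> = par_field k (aff_bracket k c c' + pf c' *\<^sub>R f_bracket c + (- pf c) *\<^sub>R f_bracket c') ?q"
      unfolding aff_bracket f_bracket[OF q] par_field_linear
      by (simp add: par_field_def aff_bracket_def)
    finally show ?thesis using True by (simp add: vlift_def field_on_def)
  qed (simp add: lie_bracket_def vlift_def field_on_def)
qed

text \<open>A few values separate the parameters of a vanishing field: the
  \<open>b\<close>-component, with \<open>b\<close> and \<open>w\<close> varied, gives
  \<open>pv\<close>, \<open>pf\<close> and \<open>ph\<close>; then a point with all coordinates but
  \<open>t\<close> and \<open>\<rho>\<close> equal to \<open>0\<close> gives the rest.\<close>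

lemma vlift_par_field_inj:
  assumes "vlift (par_field k c) = vlift (par_field k c')"
  shows "c = c'"
proof -
  define e where "e = c - c'"
  have zero: "par_field k e q = 0" if "q \<in> flat_dom" for q
  proof -
    have "to_iia q \<in> N_bar H" using that by simp
    then have "par_field k c q = par_field k c' q"
      using fun_cong[OF assms, of "to_iia q"] by (simp add: vlift_def field_on_def)
    moreover have "par_field k e q = par_field k c q + (-1) *\<^sub>R par_field k c' q"
      unfolding par_field_linear[symmetric] by (simp add: e_def)
    ultimately show ?thesis by simp
  qed
  obtain p where p: "p \<in> H" using H_nonempty by blast
  have at: "par_field k e ((b, p), 1, (u0, u), (w0, w), s) = 0" for b u0 u w0 w s
    by (rule zero) (simp add: flat_dom_def H_subset_cone[OF p])
  note expand = par_field_def aff_field_def aff_lin_def f_field_def Let_def prod_eq_iff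
  have 1: "pv e - ph e *\<^sub>R b + pf e *\<^sub>R (w0 *\<^sub>R b - w) = 0" for b w0 w
    using at[of b 0 0 w0 w 0] by (simp add: expand algebra_simps)
  have v: "pv e = 0" using 1[of 0 0 0] by simp
  obtain b :: "real ^ 'n" where b: "b \<noteq> 0" using ex_card[of 1 "UNIV :: (real^'n) set"]
    by (metis axis_eq_0_iff zero_neq_one)
  have f: "pf e = 0" using 1[of 0 0 b] v b by simp
  have h: "ph e = 0" using 1[of b 0 0] v b f by simp
  have rest: "pd e = 0" "px0 e = 0" "px e = 0" "pp0 e = 0" "pp e = 0" "pz e = 0"
    using at[of 0 0 0 0 0 0] by (simp_all add: expand v f h k2_linear)
  have "e = 0" using v f h rest by (simp add: prod_eq_iff)
  then show ?thesis by (simp add: e_def)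
qed

lemma smooth_par_field: "smooth_on (par_field k c) flat_dom"
proof -
  have "smooth_on (f_field k) flat_dom"
    unfolding f_field_def[abs_def] Let_def power2_eq_square
    by (intro smooth_intros open_flat_dom) (auto simp: flat_dom_def cubic_pos)
  moreover have "smooth_on (aff_lin k c) flat_dom"
    using linear_aff_lin linear_conv_bounded_linear by (intro smooth_on_bounded_linear open_flat_dom) blast
  ultimately show ?thesis
    unfolding par_field_def[abs_def] aff_field_def by (intro smooth_intros open_flat_dom)
qed

lemma smooth_vlift:
  assumes "smooth_on X flat_dom"
  shows "smooth_on (vlift X) (N_bar H)"
proof -
  have "smooth_on (\<lambda>p. to_iia (X (of_iia p))) (N_bar H)"
    by (rule smooth_on_linear_compose[OF bounded_linear_to_iia open_N_bar],
        rule smooth_on_compose[OF open_N_bar open_flat_dom _ smooth_on_bounded_linear[OF open_N_bar bounded_linear_of_iia] assms])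
      auto
  then show ?thesis by (rule smooth_on_cong[OF open_N_bar, rotated]) (simp add: vlift_def field_on_def)
qed

end

section \<open>Flows\<close>

lemma det_exp: "det (exp_e s) = 1" "det (exp_f s) = 1" "det (exp_h s) = 1"
  by (simp_all add: det_2 exp_e_def exp_f_def exp_h_def exp_minus)

lemma exp_mat_add:
  "exp_e (s + r) = exp_e r ** exp_e s" "exp_f (s + r) = exp_f r ** exp_f s" "exp_h (s + r) = exp_h r ** exp_h s"
  by (simp_all add: vec_eq_iff forall_2 matrix_matrix_mult_def sum_2 exp_e_def exp_f_def exp_h_def exp_add[symmetric] add.commute)

lemma exp_mat_zero: "exp_e 0 = mat 1" "exp_f 0 = mat 1" "exp_h 0 = mat 1"
  by (simp_all add: vec_eq_iff forall_2 mat_def exp_e_def exp_f_def exp_h_def)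

section \<open>Explicit one-parameter groups\<close>

context psr
begin

text \<open>The group law transports the derivative at time \<open>0\<close> to all times, so a
  single derivative has to be computed for each generator.\<close>

definition flat_flow :: "('n flat \<Rightarrow> 'n flat) \<Rightarrow> (real \<Rightarrow> 'n flat \<Rightarrow> 'n flat) \<Rightarrow> bool" where
  "flat_flow X \<Phi> \<longleftrightarrow> (\<forall>q\<in>flat_dom. \<Phi> 0 q = q \<and> (\<forall>s. \<Phi> s q \<in> flat_dom) \<and> (\<forall>s r. \<Phi> (s + r) q = \<Phi> r (\<Phi> s q))
     \<and> ((\<lambda>s. \<Phi> s q) has_vector_derivative X q) (at 0))"

lemma flat_flow_is_flow:
  assumes "flat_flow X \<Phi>"
  shows "is_flow (N_bar H) (vlift X) (\<lambda>s. lift (\<Phi> s))"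
  unfolding is_flow_def
proof (intro ballI conjI allI)
  fix p s assume p: "p \<in> N_bar H"
  then have q: "of_iia p \<in> flat_dom" by simp
  have \<Phi>: "\<Phi> 0 q = q" "\<Phi> s q \<in> flat_dom" "\<Phi> (s + r) q = \<Phi> r (\<Phi> s q)"
    "((\<lambda>s. \<Phi> s q) has_vector_derivative X q) (at 0)" if "q \<in> flat_dom" for q s r
    using assms that unfolding flat_flow_def by blast+
  show "lift (\<Phi> 0) p = p" using p q by (simp add: lift_def \<Phi>(1))
  show dom: "lift (\<Phi> s) p \<in> N_bar H" using p q by (simp add: lift_def \<Phi>(2))
  let ?q = "of_iia p"
  have "((\<lambda>r. r - s) has_derivative (\<lambda>r. r)) (at s)"
    by (rule has_derivative_eq_rhs, (rule derivative_intros)+) simp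
  moreover have "((\<lambda>r. \<Phi> r (\<Phi> s ?q)) has_derivative (\<lambda>r. r *\<^sub>R X (\<Phi> s ?q))) (at (s - s))"
    using \<Phi>(4)[OF \<Phi>(2)[OF q]] by (simp add: has_vector_derivative_def)
  ultimately have "((\<lambda>r. \<Phi> (r - s) (\<Phi> s ?q)) has_derivative (\<lambda>r. r *\<^sub>R X (\<Phi> s ?q))) (at s)"
    by (rule has_derivative_compose)
  moreover have "\<Phi> (r - s) (\<Phi> s ?q) = \<Phi> r ?q" for r
    using \<Phi>(3)[OF q, of s "r - s"] by simp
  ultimately have "((\<lambda>r. \<Phi> r ?q) has_derivative (\<lambda>r. r *\<^sub>R X (\<Phi> s ?q))) (at s)" by simp
  from bounded_linear.has_derivative[OF bounded_linear_to_iia this]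
  have "((\<lambda>r. to_iia (\<Phi> r ?q)) has_vector_derivative to_iia (X (\<Phi> s ?q))) (at s)"
    by (simp add: has_vector_derivative_def linear_scale[OF linear_to_iia])
  moreover have "vlift X (lift (\<Phi> s) p) = to_iia (X (\<Phi> s ?q))"
    using p dom q by (simp add: vlift_def field_on_def lift_def \<Phi>(2))
  moreover have "lift (\<Phi> r) p = to_iia (\<Phi> r ?q)" for r using p by (simp add: lift_def)
  ultimately show "((\<lambda>r. lift (\<Phi> r) p) has_vector_derivative vlift X (lift (\<Phi> s) p)) (at s)" by simp
qed

definition ax :: "'n option \<Rightarrow> real \<times> (real ^ 'n)" where
  "ax i = (case i of None \<Rightarrow> (1, 0) | Some a \<Rightarrow> (0, axis a 1))"

text \<open>Each generating field is recorded by its coefficients together with an explicit flow.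
  The coefficients of \<open>P_0\<close> occur with two flows, the Heisenberg translation and the
  action of \<open>exp_e\<close>.\<close>

definition basic :: "('n par \<times> (real \<Rightarrow> 'n flat \<Rightarrow> 'n flat)) set" where
  "basic = {(((1, 0), 0, 0, 0, 0, 0), \<lambda>s. lin_act (exp (s / 2)) (mat 1)), (((0, 1), 0, 0, 0, 0, 0), heis 0 0)}
     \<union> range (\<lambda>i. ((0, ax i, 0, 0, 0, 0), \<lambda>s. heis 0 (s *\<^sub>R ax i) 0))
     \<union> range (\<lambda>i. ((0, 0, ax i, 0, 0, 0), \<lambda>s. heis (s *\<^sub>R ax i) 0 0))
     \<union> range (\<lambda>a. ((0, 0, 0, axis a 1, 0, 0), \<lambda>s. b_shift k (s *\<^sub>R axis a 1)))
     \<union> {((0, ax None, 0, 0, 0, 0), \<lambda>s. sl k (exp_e s)), ((0, 0, 0, 0, 0, 1), \<lambda>s. sl k (exp_f s)),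
        ((0, 0, 0, 0, 1, 0), \<lambda>s. sl k (exp_h s))}"

lemma heis_add:
  "heis 0 p 0 (heis 0 p' 0 q) = heis 0 (p + p') 0 q"
  "heis x 0 0 (heis x' 0 0 q) = heis (x + x') 0 0 q"
  "heis 0 0 s (heis 0 0 s' q) = heis 0 0 (s + s') q"
  by (simp_all add: heis_def algebra_simps inner_add_right)

lemma heis_zero: "heis 0 0 0 q = q"
  by (simp add: heis_def)

lemma heis_dom: "heis x p s q \<in> flat_dom \<longleftrightarrow> q \<in> flat_dom"
  by (simp add: heis_def flat_dom_def)

lemma b_shift_dom: "b_shift k v q \<in> flat_dom \<longleftrightarrow> q \<in> flat_dom"
  by (simp add: b_shift_def flat_dom_def)

lemma flat_flow_D: "flat_flow (par_field k ((1, 0), 0, 0, 0, 0, 0)) (\<lambda>s. lin_act (exp (s / 2)) (mat 1))"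
  unfolding flat_flow_def
proof (intro ballI conjI allI)
  fix q :: "'n flat" and s r assume q: "q \<in> flat_dom"
  have m: "invertible (mat 1 :: real ^ 'n ^ 'n)" by (rule Aut_H_invertible[OF Aut_H_one])
  show "lin_act (exp (0 / 2)) (mat 1) q = q" by (simp add: lin_act_one)
  show "lin_act (exp (s / 2)) (mat 1) q \<in> flat_dom" using q by (simp add: flat_dom_def lin_act_def)
  show "lin_act (exp ((s + r) / 2)) (mat 1) q = lin_act (exp (r / 2)) (mat 1) (lin_act (exp (s / 2)) (mat 1) q)"
    by (simp add: lin_act_mult m exp_add add_divide_distrib mult.commute)
  have d: "dual (mat 1) x = x" for x :: "real ^ 'n" by (rule dual_eqI[OF m]) simp
  have sq: "(exp (s / 2))\<^sup>2 = exp s" for s :: real by (simp add: power2_eq_square flip: exp_add)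
  note const = bounded_linear.has_derivative[OF bounded_linear_divide]
  show "((\<lambda>s. lin_act (exp (s / 2)) (mat 1) q) has_vector_derivative par_field k ((1, 0), 0, 0, 0, 0, 0) q) (at 0)"
    unfolding lin_act_def sq d matrix_vector_mul_lid has_vector_derivative_def
    by (rule has_derivative_eq_rhs, (rule const derivative_intros)+)
      (auto simp: par_field_def aff_field_def aff_lin_def k2_linear prod_eq_iff)
qed

lemma flat_flow_heis:
  "flat_flow (par_field k ((0, 1), 0, 0, 0, 0, 0)) (heis 0 0)"
  "flat_flow (par_field k (0, p, 0, 0, 0, 0)) (\<lambda>s. heis 0 (s *\<^sub>R p) 0)"
  "flat_flow (par_field k (0, 0, p, 0, 0, 0)) (\<lambda>s. heis (s *\<^sub>R p) 0 0)"
proof -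
  have 1: "((\<lambda>s. heis 0 0 s q) has_vector_derivative par_field k ((0, 1), 0, 0, 0, 0, 0) q) (at 0)"
    "((\<lambda>s. heis 0 (s *\<^sub>R p) 0 q) has_vector_derivative par_field k (0, p, 0, 0, 0, 0) q) (at 0)"
    "((\<lambda>s. heis (s *\<^sub>R p) 0 0 q) has_vector_derivative par_field k (0, 0, p, 0, 0, 0) q) (at 0)" for q
    unfolding heis_def has_vector_derivative_def fst_scaleR snd_scaleR
    by ((rule has_derivative_eq_rhs, (rule derivative_intros)+),
      auto simp: par_field_def aff_field_def aff_lin_def k2_linear prod_eq_iff algebra_simps)+
  show "flat_flow (par_field k ((0, 1), 0, 0, 0, 0, 0)) (heis 0 0)"
    using 1(1) unfolding flat_flow_def by (simp add: heis_dom heis_zero heis_add add.commute)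
  show "flat_flow (par_field k (0, p, 0, 0, 0, 0)) (\<lambda>s. heis 0 (s *\<^sub>R p) 0)"
    using 1(2) unfolding flat_flow_def by (simp add: heis_dom heis_zero heis_add scaleR_left_distrib add.commute)
  show "flat_flow (par_field k (0, 0, p, 0, 0, 0)) (\<lambda>s. heis (s *\<^sub>R p) 0 0)"
    using 1(3) unfolding flat_flow_def by (simp add: heis_dom heis_zero heis_add scaleR_left_distrib add.commute)
qed

lemma flat_flow_b_shift: "flat_flow (par_field k (0, 0, 0, v, 0, 0)) (\<lambda>s. b_shift k (s *\<^sub>R v))"
proof -
  note const = bounded_linear.has_derivative[OF bounded_linear_divide]
  have "((\<lambda>s. b_shift k (s *\<^sub>R v) q) has_vector_derivative par_field k (0, 0, 0, v, 0, 0) q) (at 0)" for q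
    unfolding b_shift_def has_vector_derivative_def
    by (rule has_derivative_eq_rhs, (rule const derivative_intros)+)
      (auto simp: par_field_def aff_field_def aff_lin_def k2_linear k3_linear prod_eq_iff algebra_simps)
  then show ?thesis
    unfolding flat_flow_def by (simp add: b_shift_dom b_shift_zero b_shift_add scaleR_left_distrib add.commute)
qed

text \<open>In type IIB coordinates the velocity \<open>\<delta>\<close> of the action is read off
  directly; \<open>d_b_to_a\<close> pushes it forward to the field in type IIA coordinates.\<close>

lemma flat_flow_sl:
  assumes \<gamma>: "\<And>s. det (\<gamma> s) = 1" "\<And>s r. \<gamma> (s + r) = \<gamma> r ** \<gamma> s" "\<gamma> 0 = mat 1"
    and d: "\<And>r. r \<in> dom_b \<Longrightarrow> ((\<lambda>s. slb (\<gamma> s) r) has_vector_derivative \<delta> r) (at 0)"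
    and X: "\<And>r. r \<in> dom_b \<Longrightarrow> d_b_to_a k r (\<delta> r) = X (b_to_a k r)"
  shows "flat_flow X (\<lambda>s. sl k (\<gamma> s))"
  unfolding flat_flow_def
proof (intro ballI conjI allI)
  fix q :: "'n flat" and s r assume q: "q \<in> flat_dom"
  show "sl k (\<gamma> 0) q = q" using q by (simp add: \<gamma>(3) sl_one)
  show "sl k (\<gamma> s) q \<in> flat_dom" using q \<gamma>(1) by (rule sl_dom[rotated])
  show "sl k (\<gamma> (s + r)) q = sl k (\<gamma> r) (sl k (\<gamma> s) q)" using q by (simp add: sl_mult \<gamma>(1,2))
  let ?r = "a_to_b k q"
  have r: "?r \<in> dom_b" using a_to_b_dom[OF q] .
  have "((\<lambda>s. slb (\<gamma> s) ?r) has_derivative (\<lambda>s. s *\<^sub>R \<delta> ?r)) (at 0)"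
    using d[OF r] by (simp add: has_vector_derivative_def)
  moreover have D: "(b_to_a k has_derivative d_b_to_a k ?r) (at (slb (\<gamma> 0) ?r))"
    unfolding \<gamma>(3) slb_one by (rule has_derivative_b_to_a)
  ultimately have "((\<lambda>s. sl k (\<gamma> s) q) has_derivative (\<lambda>s. d_b_to_a k ?r (s *\<^sub>R \<delta> ?r))) (at 0)"
    unfolding sl_def by (rule has_derivative_compose)
  moreover have "d_b_to_a k ?r (s *\<^sub>R \<delta> ?r) = s *\<^sub>R X q" for s
    using linear_scale[OF has_derivative_linear[OF D]] X[OF r] by (simp add: b_to_a_to_b[OF q])
  ultimately show "((\<lambda>s. sl k (\<gamma> s) q) has_vector_derivative X q) (at 0)"
    by (simp add: has_vector_derivative_def)
qed

text \<open>This is the identity \<open>X_e = P_0\<close>: the shift of \<open>\<tau>\<close> moves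
  \<open>c\<close> along \<open>b\<close> in such a way that \<open>c - Re \<tau> b\<close> is
  fixed, so only \<open>\<zeta>^0\<close> and \<open>\<sigma>\<close> change.\<close>

lemma flat_flow_e: "flat_flow (par_field k (0, ax None, 0, 0, 0, 0)) (\<lambda>s. sl k (exp_e s))"
proof (rule flat_flow_sl[where \<delta> = "\<lambda>r. ((0, 0), 1, gb r, 0, 0, - gc0 r)"])
  show "((\<lambda>s. slb (exp_e s) r) has_vector_derivative ((0, 0), 1, gb r, 0, 0, - gc0 r)) (at 0)" for r :: "'n flatb"
  proof -
    have "((\<lambda>s. of_real s) has_derivative (\<lambda>s. of_real s)) (at (0::real) within UNIV)" for s
      using bounded_linear_imp_has_derivative[OF bounded_linear_of_real] .
    then have "((\<lambda>s. (fst r, gtau r + of_real s, gc r + s *\<^sub>R gb r, gd r, gc0 r, - s * gc0 r + gp r)) has_vector_derivative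
        ((0, 0), 1, gb r, 0, 0, - gc0 r)) (at 0)"
      unfolding has_vector_derivative_def
      by - (rule has_derivative_eq_rhs, (rule derivative_intros bounded_linear_imp_has_derivative[OF bounded_linear_of_real])+,
        auto simp: prod_eq_iff scaleR_conv_of_real)
    moreover have "slb (exp_e s) r = (fst r, gtau r + of_real s, gc r + s *\<^sub>R gb r, gd r, gc0 r, - s * gc0 r + gp r)" for s
      by (simp add: slb_def exp_e_def prod_eq_iff)
    ultimately show ?thesis by simp
  qed
  show "d_b_to_a k r ((0, 0), 1, gb r, 0, 0, - gc0 r) = par_field k (0, ax None, 0, 0, 0, 0) (b_to_a k r)" for r
    by (simp add: d_b_to_a_def b_to_a_def Let_def par_field_def aff_field_def aff_lin_def ax_def prod_eq_iff k2_linear k3_linear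
       k3_commute algebra_simps add_divide_distrib diff_divide_distrib)
qed (simp_all add: det_exp exp_mat_add exp_mat_zero)

lemma flat_flow_h: "flat_flow (par_field k (0, 0, 0, 0, 1, 0)) (\<lambda>s. sl k (exp_h s))"
proof (rule flat_flow_sl[where \<delta> = "\<lambda>r. ((- gb r, - gt r), 2 * gtau r, gc r, 0, - gc0 r, gp r)"])
  show "((\<lambda>s. slb (exp_h s) r) has_vector_derivative ((- gb r, - gt r), 2 * gtau r, gc r, 0, - gc0 r, gp r)) (at 0)" for r :: "'n flatb"
  proof -
    have "((\<lambda>s. ((exp (- s) *\<^sub>R gb r, exp (- s) *\<^sub>R gt r), exp (2 * s) *\<^sub>R gtau r, exp s *\<^sub>R gc r, gd r, exp (- s) * gc0 r, exp s * gp r))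
      has_vector_derivative ((- gb r, - gt r), 2 * gtau r, gc r, 0, - gc0 r, gp r)) (at 0)"
      unfolding has_vector_derivative_def
      by (rule has_derivative_eq_rhs, (rule derivative_intros)+) (auto simp: prod_eq_iff scaleR_conv_of_real)
    moreover have "slb (exp_h s) r = ((exp (- s) *\<^sub>R gb r, exp (- s) *\<^sub>R gt r), exp (2 * s) *\<^sub>R gtau r, exp s *\<^sub>R gc r, gd r,
        exp (- s) * gc0 r, exp s * gp r)" for s
    proof -
      have "of_real (exp s) / of_real (exp (- s)) = complex_of_real (exp (2 * s))"
        unfolding of_real_divide[symmetric] by (simp flip: exp_diff)
      then have "of_real (exp s) * gtau r / of_real (exp (- s)) = of_real (exp (2 * s)) * gtau r"
        by (metis times_divide_eq_left)
      then show ?thesis by (simp add: slb_def exp_h_def prod_eq_iff scaleR_conv_of_real)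
    qed
    ultimately show ?thesis by simp
  qed
  show "d_b_to_a k r ((- gb r, - gt r), 2 * gtau r, gc r, 0, - gc0 r, gp r) = par_field k (0, 0, 0, 0, 1, 0) (b_to_a k r)" for r
  proof -
    have "k3 k (gt r) (gt r) (gt r) = 6 * cubic k (gt r)" by (simp add: cubic_k3)
    then show ?thesis
      by (simp add: d_b_to_a_def b_to_a_def Let_def par_field_def aff_field_def aff_lin_def prod_eq_iff k2_linear k3_linear
         k3_commute inner_diff_right algebra_simps add_divide_distrib diff_divide_distrib power2_eq_square)
        (simp add: vec_eq_iff)
  qed
qed (simp_all add: det_exp exp_mat_add exp_mat_zero)

text \<open>The velocity comes from differentiating \<open>\<tau> / (s \<tau> + 1)\<close> and the
  modulus of \<open>s \<tau> + 1\<close> at \<open>s = 0\<close>, which gives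
  \<open>- \<tau>^2\<close> and \<open>Re \<tau>\<close>.\<close>

lemma flat_flow_f: "flat_flow (par_field k (0, 0, 0, 0, 0, 1)) (\<lambda>s. sl k (exp_f s))"
proof (rule flat_flow_sl[where \<delta> = "\<lambda>r. ((gc r, Re (gtau r) *\<^sub>R gt r), - (gtau r)\<^sup>2, 0, 0, - gp r, 0)"])
  show "((\<lambda>s. slb (exp_f s) r) has_vector_derivative ((gc r, Re (gtau r) *\<^sub>R gt r), - (gtau r)\<^sup>2, 0, 0, - gp r, 0)) (at 0)"
    for r :: "'n flatb"
  proof -
    have dj: "((\<lambda>s. of_real s * gtau r + 1) has_derivative (\<lambda>s. of_real s * gtau r)) (at 0)"
      by (rule has_derivative_eq_rhs, (rule derivative_intros bounded_linear_imp_has_derivative[OF bounded_linear_of_real])+) simp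
    have dn: "((\<lambda>s. cmod (of_real s * gtau r + 1)) has_derivative (\<lambda>s. s * Re (gtau r))) (at 0)"
      by (rule has_derivative_eq_rhs[OF has_derivative_compose[OF dj has_derivative_norm]])
        (auto simp: inner_complex_def sgn_eq)
    have dd: "((\<lambda>s. gtau r / (of_real s * gtau r + 1)) has_derivative (\<lambda>s. s *\<^sub>R (- (gtau r)\<^sup>2))) (at 0)"
      by (rule has_derivative_eq_rhs[OF has_derivative_divide'[OF has_derivative_const dj]])
        (auto simp: power2_eq_square scaleR_conv_of_real)
    have "((\<lambda>s. ((s *\<^sub>R gc r + gb r, cmod (of_real s * gtau r + 1) *\<^sub>R gt r), gtau r / (of_real s * gtau r + 1),
        gc r, gd r, gc0 r - s * gp r, gp r))
      has_vector_derivative ((gc r, Re (gtau r) *\<^sub>R gt r), - (gtau r)\<^sup>2, 0, 0, - gp r, 0)) (at 0)"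
      unfolding has_vector_derivative_def
      by (rule has_derivative_eq_rhs, (rule dn dd derivative_intros)+) (auto simp: prod_eq_iff)
    moreover have "slb (exp_f s) r = ((s *\<^sub>R gc r + gb r, cmod (of_real s * gtau r + 1) *\<^sub>R gt r), gtau r / (of_real s * gtau r + 1),
        gc r, gd r, gc0 r - s * gp r, gp r)" for s
      by (simp add: slb_def exp_f_def prod_eq_iff)
    ultimately show ?thesis by simp
  qed
  show "d_b_to_a k r ((gc r, Re (gtau r) *\<^sub>R gt r), - (gtau r)\<^sup>2, 0, 0, - gp r, 0) = par_field k (0, 0, 0, 0, 0, 1) (b_to_a k r)"
    if r: "r \<in> dom_b" for r
  proof -
    have h: "0 < cubic k (gt r)" using r cubic_pos by (simp add: dom_b_def)
    have h6: "k3 k (gt r) (gt r) (gt r) = 6 * cubic k (gt r)" by (simp add: cubic_k3)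
    have R: "2 * ((Im (gtau r))\<^sup>2 / 2 * cubic k (gt r)) / cubic k (gt r) = (Im (gtau r))\<^sup>2" using h by simp
    let ?l = "d_b_to_a k r ((gc r, Re (gtau r) *\<^sub>R gt r), - (gtau r)\<^sup>2, 0, 0, - gp r, 0)"
      and ?r = "par_field k (0, 0, 0, 0, 0, 1) (b_to_a k r)"
    have fr: "fr ?l = fr ?r"
      by (simp add: d_b_to_a_def b_to_a_def Let_def par_field_def aff_field_def aff_lin_def f_field_def k3_linear h6 power2_eq_square algebra_simps)
    have fu: "fu ?l = fu ?r"
      unfolding par_field_def aff_field_def aff_lin_def f_field_def b_to_a_def Let_def fst_conv snd_conv R
      by (rule vec_eq_innerI) (simp add: d_b_to_a_def Let_def multilinear
          power2_eq_square algebra_simps add_divide_distrib diff_divide_distrib)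
    have fw: "fw ?l = fw ?r"
      unfolding par_field_def aff_field_def aff_lin_def f_field_def b_to_a_def Let_def fst_conv snd_conv R
      by (simp add: d_b_to_a_def Let_def vec_eq_iff power2_eq_square algebra_simps)
    have fs: "fs ?l = fs ?r"
      unfolding par_field_def aff_field_def aff_lin_def f_field_def b_to_a_def Let_def snd_add fst_add snd_scaleR fst_scaleR fst_conv snd_conv R
      by (simp add: d_b_to_a_def Let_def multilinear inner_add_right
          inner_diff_right inner_commute power2_eq_square algebra_simps add_divide_distrib diff_divide_distrib)
    have fu0: "fu0 ?l = fu0 ?r"
      unfolding par_field_def aff_field_def aff_lin_def f_field_def b_to_a_def Let_def snd_add fst_add snd_scaleR fst_scaleR fst_conv snd_conv R
      by (simp add: d_b_to_a_def Let_def multilinear inner_add_right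
          inner_diff_right inner_commute power2_eq_square algebra_simps add_divide_distrib diff_divide_distrib)
    have fw0: "fw0 ?l = fw0 ?r"
      unfolding par_field_def aff_field_def aff_lin_def f_field_def b_to_a_def Let_def snd_add fst_add snd_scaleR fst_scaleR fst_conv snd_conv R
      by (simp add: d_b_to_a_def Let_def power2_eq_square)
    have fb: "fst ?l = fst ?r"
      by (simp add: d_b_to_a_def b_to_a_def Let_def par_field_def aff_field_def aff_lin_def f_field_def)
    show ?thesis by (intro prod_eqI fb[unfolded prod_eq_iff, THEN conjunct1] fb[unfolded prod_eq_iff, THEN conjunct2] fr fu fw fs fu0 fw0)
  qed
qed (simp_all add: det_exp exp_mat_add exp_mat_zero)

lemma basic_flat_flow: "(c, \<Psi>) \<in> basic \<Longrightarrow> flat_flow (par_field k c) \<Psi>"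
  unfolding basic_def
  using flat_flow_D flat_flow_heis flat_flow_b_shift flat_flow_e flat_flow_f flat_flow_h by blast

lemma basic_isometry: "(c, \<Psi>) \<in> basic \<Longrightarrow> lift (\<Psi> s) \<in> carrier (q_iso k H)"
proof -
  have "lift (lin_act (exp (s / 2)) (mat 1)) \<in> carrier (q_iso k H)" by (rule lin_act_isometry[OF _ Aut_H_one]) simp
  then show "(c, \<Psi>) \<in> basic \<Longrightarrow> lift (\<Psi> s) \<in> carrier (q_iso k H)"
    unfolding basic_def
    by (auto simp: heis_isometry b_shift_isometry sl_isometry det_exp)
qed

section \<open>The generating fields and their flows in real coordinates\<close>

lemma field_on_eq_vlift:
  assumes "\<And>q. q \<in> flat_dom \<Longrightarrow> F (to_iia q) = to_iia (X q)"
  shows "field_on (N_bar H) F = vlift X"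
proof
  fix p show "field_on (N_bar H) F p = vlift X p"
    using assms[of "of_iia p"] by (simp add: field_on_def vlift_def)
qed

lemma s_fundamental_eq:
  assumes "flat_flow X (\<lambda>s. sl k (\<gamma> s))" "q \<in> flat_dom"
  shows "s_fundamental k H \<gamma> (to_iia q) = to_iia (X q)"
proof -
  have "((\<lambda>s. sl k (\<gamma> s) q) has_derivative (\<lambda>s. s *\<^sub>R X q)) (at 0)"
    using assms unfolding flat_flow_def has_vector_derivative_def by blast
  from bounded_linear.has_derivative[OF bounded_linear_to_iia this]
  have "((\<lambda>s. s_duality k H (\<gamma> s) (to_iia q)) has_vector_derivative to_iia (X q)) (at 0)"
    by (simp add: has_vector_derivative_def linear_scale[OF linear_to_iia] s_duality_to_iia[OF assms(2)])
  then show ?thesis unfolding s_fundamental_def by (rule vector_derivative_at)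
qed

lemma ext_axis: "axis None 1 = ext 1 0" "axis (Some a) 1 = ext 0 (axis a (1::real))"
  by (simp_all add: vec_option_eq_iff axis_def)

lemma ext_zero: "ext 0 0 = (0 :: real ^ 'm::finite option)"
  by (simp add: vec_option_eq_iff)

lemma cplx_zero: "cplx 0 0 = 0"
  by (simp add: vec_eq_iff complex_eq_iff)

lemma G_fields_eq: "G_fields k H = (\<lambda>(c, \<Psi>). vlift (par_field k c)) ` basic"
proof -
  note expand = par_field_def aff_field_def aff_lin_def to_iia_def
  have D: "field_on (N_bar H) field_D = vlift (par_field k ((1, 0), 0, 0, 0, 0, 0))"
    by (rule field_on_eq_vlift) (simp add: expand k2_linear cplx_zero flip: ext_linear(2))
  have Z: "field_on (N_bar H) field_Z = vlift (par_field k ((0, 1), 0, 0, 0, 0, 0))"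
    by (rule field_on_eq_vlift) (simp add: expand k2_linear cplx_zero ext_zero)
  have P: "field_on (N_bar H) (field_P i) = vlift (par_field k (0, ax i, 0, 0, 0, 0))" for i
    by (rule field_on_eq_vlift)
      (cases i; simp add: expand k2_linear cplx_zero ext_zero ax_def ext_axis inner_axis)
  have X: "field_on (N_bar H) (field_X i) = vlift (par_field k (0, 0, ax i, 0, 0, 0))" for i
    by (rule field_on_eq_vlift)
      (cases i; simp add: expand k2_linear cplx_zero ext_zero ax_def ext_axis inner_axis)
  have V: "field_on (N_bar H) (field_V k a) = vlift (par_field k (0, 0, 0, axis a 1, 0, 0))" for a
  proof (rule field_on_eq_vlift)
    fix q :: "'n flat"
    have 1: "(\<chi> b. - (\<Sum>c\<in>UNIV. k a b c * fw q $ c)) = - k2 k (axis a 1) (fw q)"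
    proof -
      have kk: "k x y c = k x c y" for x y c using sym unfolding symmetric3_def by blast
      have "k2 k (axis a 1) (fw q) $ b = (\<Sum>x\<in>UNIV. \<Sum>c\<in>UNIV. if x = a then k a c b * fw q $ c else 0)" for b
        unfolding k2_def vec_lambda_beta by (intro sum.cong refl) (simp add: axis_def)
      also have "\<dots> b = (\<Sum>c\<in>UNIV. k a c b * fw q $ c)" for b
        by (subst sum.swap) simp
      finally show ?thesis by (simp add: vec_eq_iff kk[of a])
    qed
    have 2: "axis a 1 = cplx (axis a 1) 0" by (rule axis_cplx)
    show "field_V k a (to_iia q) = to_iia (par_field k (0, 0, 0, axis a 1, 0, 0) q)"
      by (simp add: expand 1 2 inner_axis) (simp add: vec_option_eq_iff axis_def)
  qed
  have e: "field_on (N_bar H) (s_fundamental k H exp_e) = vlift (par_field k (0, ax None, 0, 0, 0, 0))"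
    by (rule field_on_eq_vlift) (rule s_fundamental_eq[OF flat_flow_e])
  have f: "field_on (N_bar H) (s_fundamental k H exp_f) = vlift (par_field k (0, 0, 0, 0, 0, 1))"
    by (rule field_on_eq_vlift) (rule s_fundamental_eq[OF flat_flow_f])
  have h: "field_on (N_bar H) (s_fundamental k H exp_h) = vlift (par_field k (0, 0, 0, 0, 1, 0))"
    by (rule field_on_eq_vlift) (rule s_fundamental_eq[OF flat_flow_h])
  show ?thesis
    unfolding G_fields_def basic_def
    by (simp add: image_Un image_image D Z P X V e f h)
qed

lemma in_Basis_prod_iff:
  "b \<in> Basis \<longleftrightarrow> (\<exists>u\<in>Basis. b = (u, 0)) \<or> (\<exists>v\<in>Basis. b = (0, v))"
  for b :: "'a::euclidean_space \<times> 'b::euclidean_space"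
  by (auto simp: Basis_prod_def)

lemma Basis_subset_basic: "(Basis :: 'n par set) \<subseteq> fst ` basic"
proof
  let ?F = "fst ` basic :: 'n par set"
  have F: "fst x \<in> ?F" if "x \<in> basic" for x using that by (rule imageI)
  have mem: "((1, 0), 0, 0, 0, 0, 0) \<in> ?F" "((0, 1), 0, 0, 0, 0, 0) \<in> ?F"
    "(0, ax i, 0, 0, 0, 0) \<in> ?F" "(0, 0, ax i, 0, 0, 0) \<in> ?F" "(0, 0, 0, axis a 1, 0, 0) \<in> ?F"
    "(0, 0, 0, 0, 0, 1) \<in> ?F" "(0, 0, 0, 0, 1, 0) \<in> ?F" for i a
    unfolding basic_def image_Un image_insert image_image fst_conv by blast+
  have mem': "(0, (1, 0), 0, 0, 0, 0) \<in> ?F" "(0, (0, axis a 1), 0, 0, 0, 0) \<in> ?F"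
    "(0, 0, (1, 0), 0, 0, 0) \<in> ?F" "(0, 0, (0, axis a 1), 0, 0, 0) \<in> ?F" for a
    using mem(3)[of None] mem(3)[of "Some a"] mem(4)[of None] mem(4)[of "Some a"] by (simp_all add: ax_def)
  have vec: "b \<in> Basis \<longleftrightarrow> (\<exists>a. b = axis a 1)" for b :: "real ^ 'n"
    by (auto simp: Basis_vec_def)
  fix b :: "'n par" assume "b \<in> Basis"
  then consider "b = ((1, 0), 0)" | "b = ((0, 1), 0)" | "b = (0, (1, 0), 0)" | a where "b = (0, (0, axis a 1), 0)"
    | "b = (0, 0, (1, 0), 0)" | a where "b = (0, 0, (0, axis a 1), 0)" | a where "b = (0, 0, 0, axis a 1, 0)"
    | "b = (0, 0, 0, 0, 1, 0)" | "b = (0, 0, 0, 0, 0, 1)"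
    unfolding Bex_def in_Basis_prod_iff vec Basis_real_def by blast
  then show "b \<in> ?F"
    by cases (use mem mem' in \<open>simp_all only: zero_prod_def\<close>)
qed

lemma complete_G_fields: "X \<in> G_fields k H \<Longrightarrow> complete_field (N_bar H) X"
  unfolding G_fields_eq complete_field_def using flat_flow_is_flow[OF basic_flat_flow] by fast

text \<open>Uniqueness of integral curves and restriction to the domain remove all freedom in the
  choice of a flow, so each field contributes exactly one map per time.\<close>

lemma generators_eq:
  "{restrict (\<Phi> s) (N_bar H) | \<Phi> s. \<exists>X\<in>G_fields k H. is_flow (N_bar H) X \<Phi>} = {lift (\<Psi> s) | c \<Psi> s. (c, \<Psi>) \<in> basic}"
proof (intro equalityI subsetI)
  fix g assume "g \<in> {restrict (\<Phi> s) (N_bar H) | \<Phi> s. \<exists>X\<in>G_fields k H. is_flow (N_bar H) X \<Phi>}"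
  then obtain \<Phi> s c \<Psi> where g: "g = restrict (\<Phi> s) (N_bar H)" "(c, \<Psi>) \<in> basic"
    "is_flow (N_bar H) (vlift (par_field k c)) \<Phi>"
    unfolding G_fields_eq by fast
  have "\<Phi> s p = lift (\<Psi> s) p" if "p \<in> N_bar H" for p
    using is_flow_unique[OF open_N_bar smooth_vlift[OF smooth_par_field] g(3) flat_flow_is_flow[OF basic_flat_flow[OF g(2)]] that] .
  then have "g = lift (\<Psi> s)" unfolding g(1) by (intro ext) (simp add: lift_def restrict_def)
  then show "g \<in> {lift (\<Psi> s) | c \<Psi> s. (c, \<Psi>) \<in> basic}" using g(2) by blast
next
  fix g assume "g \<in> {lift (\<Psi> s) | c \<Psi> s. (c, \<Psi>) \<in> basic}"
  then obtain c \<Psi> s where g: "g = lift (\<Psi> s)" "(c, \<Psi>) \<in> basic" by blast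
  have "g = restrict (lift (\<Psi> s)) (N_bar H)" unfolding g(1) by (intro ext) (simp add: lift_def restrict_def)
  moreover have "is_flow (N_bar H) (vlift (par_field k c)) (\<lambda>s. lift (\<Psi> s))"
    by (rule flat_flow_is_flow[OF basic_flat_flow[OF g(2)]])
  moreover have "vlift (par_field k c) \<in> G_fields k H" unfolding G_fields_eq using g(2) by force
  ultimately show "g \<in> {restrict (\<Phi> s) (N_bar H) | \<Phi> s. \<exists>X\<in>G_fields k H. is_flow (N_bar H) X \<Phi>}"
    unfolding mem_Collect_eq
    by (intro exI[of _ "\<lambda>s. lift (\<Psi> s)"] exI[of _ s] conjI bexI[of _ "vlift (par_field k c)"])
qed

end

section \<open>Dimension\<close>

lemma vector_space_scale_field: "vector_space (scale_field :: real \<Rightarrow> ('e \<Rightarrow> 'e::real_vector) \<Rightarrow> _)"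
  by unfold_locales (simp_all add: scale_field_def fun_eq_iff algebra_simps)

context psr
begin

text \<open>The coefficients in \<open>basic\<close> contain the standard basis of the parameter
  space, so all parameters occur. The map from parameters to fields is linear and injective, and the
  dimension is \<open>2 + (n + 1) + (n + 1) + n + 1 + 1\<close>.\<close>

lemma G_lie_algebra_eq: "G_lie_algebra k H = range (\<lambda>c. vlift (par_field k c))"
  and dim_G_lie_algebra: "vector_space.dim scale_field (G_lie_algebra k H) = 3 * CARD('n) + 6"
proof -
  interpret vs: vector_space "scale_field :: real \<Rightarrow> ('n iia \<Rightarrow> 'n iia) \<Rightarrow> _" by (rule vector_space_scale_field)
  interpret vp: finite_dimensional_vector_space_pair_1 "scaleR :: real \<Rightarrow> 'n par \<Rightarrow> 'n par" Basis
    "scale_field :: real \<Rightarrow> ('n iia \<Rightarrow> 'n iia) \<Rightarrow> _"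
    by unfold_locales
  let ?L = "\<lambda>c :: 'n par. vlift (par_field k c)"
  have lin: "Vector_Spaces.linear scaleR scale_field ?L"
    by unfold_locales
      (simp_all add: fun_eq_iff vlift_def field_on_def par_field_linear scale_field_def linear_add[OF linear_to_iia] linear_scale[OF linear_to_iia])
  have "G_fields k H = ?L ` (fst ` basic)"
    unfolding G_fields_eq image_image by (intro image_cong refl) (simp add: case_prod_beta)
  then have "G_lie_algebra k H = ?L ` span (fst ` basic)"
    unfolding G_lie_algebra_def by (simp add: vp.linear_span_image[OF lin] span_raw_def)
  moreover have "span (fst ` basic :: 'n par set) = UNIV"
    using span_mono[OF Basis_subset_basic] by auto
  ultimately show eq: "G_lie_algebra k H = range ?L" by simp
  have "inj_on ?L (module.span scaleR (UNIV :: 'n par set))" by (intro inj_onI vlift_par_field_inj)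
  from vp.dim_image_eq[OF lin this]
  show "vector_space.dim scale_field (G_lie_algebra k H) = 3 * CARD('n) + 6"
    unfolding eq by (simp add: dim_raw_def[symmetric])
qed

lemma lie_bracket_closed:
  "X \<in> G_lie_algebra k H \<Longrightarrow> Y \<in> G_lie_algebra k H \<Longrightarrow> lie_bracket (N_bar H) X Y \<in> G_lie_algebra k H"
proof -
  assume "X \<in> G_lie_algebra k H" "Y \<in> G_lie_algebra k H"
  then obtain c c' where "X = vlift (par_field k c)" "Y = vlift (par_field k c')"
    unfolding G_lie_algebra_eq by blast
  moreover obtain c'' where "lie_bracket (N_bar H) (vlift (par_field k c)) (vlift (par_field k c')) = vlift (par_field k c'')"
    using lie_bracket_par_field by blast
  ultimately show ?thesis unfolding G_lie_algebra_eq by simp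
qed

end

section \<open>The semi-direct product\<close>

lemma (in group) conj_hom_AutoGroup:
  assumes N: "subgroup N G" and K: "group K" and a: "a \<in> hom K G"
    and norm: "\<And>x. x \<in> carrier K \<Longrightarrow> (\<lambda>g. a x \<otimes> g \<otimes> inv (a x)) ` N = N"
  shows "(\<lambda>x. \<lambda>g\<in>N. a x \<otimes> g \<otimes> inv (a x)) \<in> hom K (AutoGroup (G\<lparr>carrier := N\<rparr>))"
proof -
  let ?c = "\<lambda>x. \<lambda>g\<in>N. a x \<otimes> g \<otimes> inv (a x)"
  have a_closed: "a x \<in> carrier G" if "x \<in> carrier K" for x using hom_in_carrier[OF a that] .
  have NG: "g \<in> carrier G" if "g \<in> N" for g using subgroup.mem_carrier[OF N that] .
  have img: "a x \<otimes> g \<otimes> inv (a x) \<in> N" if "x \<in> carrier K" "g \<in> N" for x g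
    using norm[OF that(1)] that(2) by blast
  have Bij: "?c x \<in> Bij N" if x: "x \<in> carrier K" for x
  proof -
    have "inj_on (\<lambda>g. a x \<otimes> g \<otimes> inv (a x)) N"
      using a_closed[OF x] NG by (intro inj_onI) simp
    then have "bij_betw (\<lambda>g. a x \<otimes> g \<otimes> inv (a x)) N N"
      using norm[OF x] by (simp add: bij_betw_def)
    then show ?thesis by (simp add: Bij_def bij_betw_restrict_eq)
  qed
  have conj_mult: "(a x \<otimes> g \<otimes> inv (a x)) \<otimes> (a x \<otimes> h \<otimes> inv (a x)) = a x \<otimes> (g \<otimes> h) \<otimes> inv (a x)"
    if "x \<in> carrier K" "g \<in> N" "h \<in> N" for x g h
    using a_closed[OF that(1)] NG[OF that(2)] NG[OF that(3)] by (simp add: m_assoc inv_solve_left' flip: m_assoc[of "inv (a x)" "a x"])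
  have auto: "?c x \<in> auto (G\<lparr>carrier := N\<rparr>)" if x: "x \<in> carrier K" for x
    unfolding auto_def hom_def using Bij[OF x] img[OF x] conj_mult[OF x] subgroup.m_closed[OF N]
    by (auto simp: Pi_def)
  show ?thesis
  proof (rule homI)
    fix x assume "x \<in> carrier K"
    then show "?c x \<in> carrier (AutoGroup (G\<lparr>carrier := N\<rparr>))" using auto by (simp add: AutoGroup_def)
  next
    fix x y assume x: "x \<in> carrier K" and y: "y \<in> carrier K"
    have "?c (x \<otimes>\<^bsub>K\<^esub> y) = compose N (?c x) (?c y)"
    proof (rule ext)
      fix g
      show "?c (x \<otimes>\<^bsub>K\<^esub> y) g = compose N (?c x) (?c y) g"
      proof (cases "g \<in> N")
        case True
        then show ?thesis
          using a_closed[OF x] a_closed[OF y] NG[OF True] img[OF y True]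
          by (simp add: compose_def hom_mult[OF a x y] inv_mult_group m_assoc)
      qed (simp add: compose_def)
    qed
    then show "?c (x \<otimes>\<^bsub>K\<^esub> y) = ?c x \<otimes>\<^bsub>AutoGroup (G\<lparr>carrier := N\<rparr>)\<^esub> ?c y"
      using Bij[OF x] Bij[OF y] by (simp add: AutoGroup_def BijGroup_def)
  qed
qed

text \<open>Moving \<open>a x\<close> past \<open>h\<close> in
  \<open>(g \<otimes> a x) \<otimes> (h \<otimes> a y)\<close> produces exactly the twisted
  multiplication. If \<open>g \<otimes> a x = h \<otimes> a y\<close>, then the image under
  \<open>a\<close> of \<open>x\<close> times the inverse of \<open>y\<close> is
  \<open>inv g \<otimes> h\<close>, an element of \<open>N\<close>, so the trivial intersection
  yields injectivity.\<close>

lemma (in group) semidirect_mon: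
  assumes N: "subgroup N G" and K: "group K" and a: "a \<in> hom K G"
    and norm: "\<And>x. x \<in> carrier K \<Longrightarrow> (\<lambda>g. a x \<otimes> g \<otimes> inv (a x)) ` N = N"
    and triv: "\<And>x. x \<in> carrier K \<Longrightarrow> a x \<in> N \<Longrightarrow> x = \<one>\<^bsub>K\<^esub>"
  shows "(\<lambda>(x, g). g \<otimes> a x) \<in> mon (semidirect K (G\<lparr>carrier := N\<rparr>) (\<lambda>x. \<lambda>g\<in>N. a x \<otimes> g \<otimes> inv (a x))) G"
proof -
  interpret K: group K by fact
  have a_closed: "a x \<in> carrier G" if "x \<in> carrier K" for x using hom_in_carrier[OF a that] .
  have NG: "g \<in> carrier G" if "g \<in> N" for g using subgroup.mem_carrier[OF N that] .
  have mult: "g \<otimes> (a x \<otimes> h \<otimes> inv (a x)) \<otimes> a (x \<otimes>\<^bsub>K\<^esub> y) = (g \<otimes> a x) \<otimes> (h \<otimes> a y)"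
    if "x \<in> carrier K" "y \<in> carrier K" "g \<in> N" "h \<in> N" for x y g h
    using a_closed[OF that(1)] a_closed[OF that(2)] NG[OF that(3)] NG[OF that(4)]
    by (simp add: hom_mult[OF a that(1,2)] m_assoc flip: m_assoc[of "inv (a x)" "a x"])
  have inj: "x = y \<and> g = h"
    if "x \<in> carrier K" "y \<in> carrier K" "g \<in> N" "h \<in> N" "g \<otimes> a x = h \<otimes> a y" for x y g h
  proof -
    note cl = a_closed[OF that(1)] a_closed[OF that(2)] NG[OF that(3)] NG[OF that(4)]
    have "a (x \<otimes>\<^bsub>K\<^esub> inv\<^bsub>K\<^esub> y) = a x \<otimes> inv (a y)"
      using that(1,2) a group_hom.hom_inv[of K G a y] K
      by (simp add: hom_mult[OF a] group_hom_def group_hom_axioms_def is_group)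
    also have "\<dots> = inv g \<otimes> h"
    proof -
      have "a x = inv g \<otimes> (h \<otimes> a y)" using that(5) cl by (metis inv_solve_left m_closed)
      then show ?thesis using cl by (simp add: m_assoc)
    qed
    also have "\<dots> \<in> N"
      using subgroup.m_closed[OF N] subgroup.m_inv_closed[OF N] that(3,4) by blast
    finally have "x \<otimes>\<^bsub>K\<^esub> inv\<^bsub>K\<^esub> y = \<one>\<^bsub>K\<^esub>" using triv that(1,2) by simp
    then have "x = y" using that(1,2) by (metis K.inv_equality K.inv_closed K.inv_inv)
    then show ?thesis using that(5) cl by simp
  qed
  show ?thesis
    unfolding mon_def
  proof (intro CollectI conjI homI)
    show "inj_on (\<lambda>(x, g). g \<otimes> a x) (carrier (semidirect K (G\<lparr>carrier := N\<rparr>) (\<lambda>x. \<lambda>g\<in>N. a x \<otimes> g \<otimes> inv (a x))))"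
      using inj by (auto simp: semidirect_def inj_on_def)
  qed (auto simp: semidirect_def a_closed NG mult)
qed

section \<open>Composition of lifts and the automorphism action\<close>

context psr
begin

abbreviation "Q \<equiv> q_iso k H"

lemma group_q_iso: "group Q"
  unfolding q_iso_def by (rule group_Iso_group[OF open_N_bar])

lemma q_iso_Bij: "f \<in> carrier Q \<Longrightarrow> f \<in> Bij (N_bar H)"
  by (simp add: q_iso_def Iso_group_def isometries_def)

lemma q_iso_mult: "f \<in> carrier Q \<Longrightarrow> g \<in> carrier Q \<Longrightarrow> f \<otimes>\<^bsub>Q\<^esub> g = compose (N_bar H) f g"
proof -
  assume "f \<in> carrier Q" "g \<in> carrier Q"
  then have "f \<in> Bij (N_bar H)" "g \<in> Bij (N_bar H)" by (simp_all only: q_iso_Bij)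
  then show ?thesis by (simp add: q_iso_def Iso_group_def BijGroup_def)
qed

lemma q_iso_one: "\<one>\<^bsub>Q\<^esub> = (\<lambda>p\<in>N_bar H. p)"
  by (simp add: q_iso_def Iso_group_def BijGroup_def)

lemma lift_cong: "(\<And>q. q \<in> flat_dom \<Longrightarrow> f q = g q) \<Longrightarrow> lift f = lift g"
  unfolding lift_def by (intro restrict_ext) simp

lemma lift_mult:
  assumes "lift f \<in> carrier Q" "lift g \<in> carrier Q"
  shows "lift f \<otimes>\<^bsub>Q\<^esub> lift g = lift (\<lambda>q. f (g q))"
proof -
  have "to_iia (g (of_iia p)) \<in> N_bar H" if "p \<in> N_bar H" for p
    using funcset_mem[OF Bij_imp_funcset[OF q_iso_Bij[OF assms(2)]] that] that by (simp only: lift_def restrict_apply')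
  then show ?thesis
    unfolding q_iso_mult[OF assms] unfolding compose_def lift_def by (intro restrict_ext) simp
qed

lemma lift_id: "lift (\<lambda>q. q) = \<one>\<^bsub>Q\<^esub>"
  unfolding q_iso_one lift_def by (intro restrict_ext) simp

lemma Aut_act_lift: "Aut_act H A = lift (lin_act 1 A)"
proof
  fix p
  have 1: "(\<chi> a. \<Sum>b\<in>UNIV. of_real (A$a$b) * z$b) = cplx (A *v re_vec z) (A *v im_vec z)" for z :: "complex ^ 'n"
    by (simp add: vec_eq_iff complex_eq_iff matrix_vector_mult_def re_vec_def im_vec_def)
  show "Aut_act H A p = lift (lin_act 1 A) p"
    by (cases p) (auto simp: Aut_act_def lift_def lin_act_def to_iia_def of_iia_def 1 dual_def)
qed

lemma Aut_act_closed: "A \<in> Aut_H H \<Longrightarrow> Aut_act H A \<in> carrier Q"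
  unfolding Aut_act_lift by (rule lin_act_isometry) simp_all

lemma Aut_act_hom: "Aut_act H \<in> hom (Aut_H_group H) Q"
proof (rule homI)
  fix A B assume "A \<in> carrier (Aut_H_group H)" "B \<in> carrier (Aut_H_group H)"
  then have A: "A \<in> Aut_H H" "B \<in> Aut_H H" by (simp_all add: Aut_H_group_def)
  have "Aut_act H A \<otimes>\<^bsub>Q\<^esub> Aut_act H B = lift (\<lambda>q. lin_act 1 A (lin_act 1 B q))"
    using Aut_act_closed[OF A(1)] Aut_act_closed[OF A(2)] unfolding Aut_act_lift by (rule lift_mult)
  also have "\<dots> = Aut_act H (A ** B)"
    unfolding Aut_act_lift by (simp add: lin_act_mult Aut_H_invertible A)
  finally show "Aut_act H (A \<otimes>\<^bsub>Aut_H_group H\<^esub> B) = Aut_act H A \<otimes>\<^bsub>Q\<^esub> Aut_act H B"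
    by (simp add: Aut_H_group_def)
qed (simp add: Aut_H_group_def Aut_act_closed)

lemma inv_Aut_act: "A \<in> Aut_H H \<Longrightarrow> inv\<^bsub>Q\<^esub> (Aut_act H A) = Aut_act H (matrix_inv A)"
proof -
  assume A: "A \<in> Aut_H H"
  interpret Q: group Q by (rule group_q_iso)
  have "Aut_act H (matrix_inv A) \<otimes>\<^bsub>Q\<^esub> Aut_act H A = Aut_act H (matrix_inv A ** A)"
    using hom_mult[OF Aut_act_hom, of "matrix_inv A" A] A Aut_H_inv[OF A] by (simp add: Aut_H_group_def)
  also have "\<dots> = \<one>\<^bsub>Q\<^esub>"
    unfolding matrix_inv_works(2)[OF Aut_H_invertible[OF A]] Aut_act_lift lift_id[symmetric]
    by (rule lift_cong) (rule lin_act_one)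
  finally show ?thesis
    using Q.inv_equality Aut_act_closed[OF A] Aut_act_closed[OF Aut_H_inv[OF A]] by blast
qed

definition "gens = {lift (\<Psi> s) | c \<Psi> s. (c, \<Psi>) \<in> basic}"

lemma gens_closed: "gens \<subseteq> carrier Q"
  unfolding gens_def using basic_isometry by blast

text \<open>\<open>G_set\<close> is generated among all bijections of the domain; as the generators
  lie in the subgroup of isometries, generation inside \<open>Q\<close> gives the same set.\<close>

lemma G_set_generate: "G_set k H = generate Q gens"
proof -
  interpret B: group "BijGroup (N_bar H)" by (rule group_BijGroup)
  have "gens \<subseteq> isometries (N_bar H) (q_metric k)"
    using gens_closed by (simp add: q_iso_def Iso_group_def)
  from B.generate_consistent[OF this subgroup_isometries[OF open_N_bar]]
  show ?thesis unfolding G_set_def generators_eq gens_def[symmetric] q_iso_def Iso_group_def by simp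
qed

lemma subgroup_G_set: "subgroup (G_set k H) Q"
  unfolding G_set_generate by (rule group.generate_is_subgroup[OF group_q_iso gens_closed])

lemma gens_in_G: "(c, \<Psi>) \<in> basic \<Longrightarrow> lift (\<Psi> s) \<in> G_set k H"
  unfolding G_set_generate gens_def by (rule generate.incl) blast

text \<open>Membership is known for multiples of the axes \<open>e i\<close> only. A family that is
  additive in its vector parameter reaches every combination of axes by products in
  \<open>G\<close>.\<close>

lemma one_parameter_sum_in_G:
  assumes add: "\<And>x y q. f (x + y) q = f x (f y q)" and zero: "\<And>q. f 0 q = q"
    and closed: "\<And>x. lift (f x) \<in> carrier Q"
    and e: "\<And>i s. lift (f (s *\<^sub>R e i)) \<in> G_set k H"
  shows "finite I \<Longrightarrow> lift (f (\<Sum>i\<in>I. c i *\<^sub>R e i)) \<in> G_set k H"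
proof (induction I rule: finite_induct)
  case empty
  have "lift (f 0) = \<one>\<^bsub>Q\<^esub>" unfolding lift_id[symmetric] by (rule lift_cong) (rule zero)
  then show ?case using subgroup.one_closed[OF subgroup_G_set] by simp
next
  case (insert i I)
  have "lift (f (\<Sum>i\<in>insert i I. c i *\<^sub>R e i)) = lift (f (c i *\<^sub>R e i)) \<otimes>\<^bsub>Q\<^esub> lift (f (\<Sum>i\<in>I. c i *\<^sub>R e i))"
    unfolding lift_mult[OF closed closed] sum.insert[OF insert.hyps] add ..
  then show ?case using subgroup.m_closed[OF subgroup_G_set e insert.IH] by simp
qed

lemma ax_expand: "(\<Sum>i\<in>UNIV. (case i of None \<Rightarrow> fst x | Some a \<Rightarrow> snd x $ a) *\<^sub>R ax i) = x"
proof -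
  have "(\<Sum>a\<in>UNIV. (snd x $ a) *\<^sub>R (0::real, axis a (1::real))) = (0, snd x)"
    using sum_axis_real[of "snd x"] by (simp add: sum_prod)
  then show ?thesis by (simp add: sum_UNIV_option ax_def prod_eq_iff)
qed

lemma heis_in_G: "lift (heis 0 p 0) \<in> G_set k H" "lift (heis p 0 0) \<in> G_set k H"
proof -
  have b: "lift (heis 0 (s *\<^sub>R ax i) 0) \<in> G_set k H" "lift (heis (s *\<^sub>R ax i) 0 0) \<in> G_set k H" for i s
  proof -
    have b: "((0, ax i, 0, 0, 0, 0), \<lambda>s. heis 0 (s *\<^sub>R ax i) 0) \<in> basic"
      "((0, 0, ax i, 0, 0, 0), \<lambda>s. heis (s *\<^sub>R ax i) 0 0) \<in> basic" unfolding basic_def by blast+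
    show "lift (heis 0 (s *\<^sub>R ax i) 0) \<in> G_set k H" "lift (heis (s *\<^sub>R ax i) 0 0) \<in> G_set k H"
      by (rule gens_in_G[OF b(1)], rule gens_in_G[OF b(2)])
  qed
  let ?c = "\<lambda>i. case i of None \<Rightarrow> fst p | Some a \<Rightarrow> snd p $ a"
  show "lift (heis 0 p 0) \<in> G_set k H"
    using one_parameter_sum_in_G[of "\<lambda>p. heis 0 p 0" ax UNIV ?c, OF _ heis_zero heis_isometry b(1)]
    by (simp add: heis_add ax_expand)
  show "lift (heis p 0 0) \<in> G_set k H"
    using one_parameter_sum_in_G[of "\<lambda>p. heis p 0 0" ax UNIV ?c, OF _ heis_zero heis_isometry b(2)]
    by (simp add: heis_add ax_expand)
qed

lemma b_shift_in_G: "lift (b_shift k v) \<in> G_set k H"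
proof -
  have b: "lift (b_shift k (s *\<^sub>R axis a 1)) \<in> G_set k H" for a s
  proof -
    have "((0, 0, 0, axis a 1, 0, 0), \<lambda>s. b_shift k (s *\<^sub>R axis a 1)) \<in> basic" unfolding basic_def by blast
    then show ?thesis by (rule gens_in_G)
  qed
  show ?thesis
    using one_parameter_sum_in_G[of "b_shift k" "\<lambda>a. axis a 1" UNIV "\<lambda>a. v $ a", OF b_shift_add[symmetric] b_shift_zero b_shift_isometry b]
    by (simp add: sum_axis_real)
qed

section \<open>Conjugation by automorphisms\<close>

definition iib_act :: "real ^ 'n ^ 'n \<Rightarrow> 'n flatb \<Rightarrow> 'n flatb" where
  "iib_act A r = ((A *v gb r, A *v gt r), gtau r, A *v gc r, dual A (gd r), gc0 r, gp r)"

text \<open>All formulas contract upper with lower indices. For S-duality the claim is visible in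
  type IIB coordinates: there \<open>A\<close> acts by \<open>iib_act\<close> on the vector
  components, which \<open>slb\<close> combines linearly with scalars depending on \<open>m\<close>
  and \<open>\<tau>\<close>, and \<open>A\<close> fixes \<open>\<tau>\<close>.\<close>

lemma lin_act_commute:
  assumes A: "A \<in> Aut_H H"
  shows "lin_act 1 A (heis x p s q) = heis (fst x, dual A (snd x)) (fst p, A *v snd p) s (lin_act 1 A q)"
    "lin_act 1 A (b_shift k v q) = b_shift k (A *v v) (lin_act 1 A q)"
    "lin_act 1 A (sl k m q) = sl k m (lin_act 1 A q)"
proof -
  have i: "invertible A" using Aut_H_invertible[OF A] .
  have dd: "dual A (x - y) = dual A x - dual A y" for x y :: "real ^ 'n"
    by (simp add: dual_def matrix_vector_mult_diff_distrib)
  show "lin_act 1 A (heis x p s q) = heis (fst x, dual A (snd x)) (fst p, A *v snd p) s (lin_act 1 A q)"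
    by (simp add: lin_act_def heis_def dual_inner[OF i] dual_linear matrix_vector_right_distrib)
  show "lin_act 1 A (b_shift k v q) = b_shift k (A *v v) (lin_act 1 A q)"
    by (simp add: lin_act_def b_shift_def dual_inner[OF i] dual_linear dd matrix_vector_right_distrib matrix_vector_mult_scaleR
        Aut_H_k2[OF A] Aut_H_k3[OF A])
  have 1: "b_to_a k (iib_act A r) = lin_act 1 A (b_to_a k r)" for r
  proof -
    have e: "A *v gc r - Re (gtau r) *\<^sub>R (A *v gb r) = A *v (gc r - Re (gtau r) *\<^sub>R gb r)"
      by (simp add: matrix_vector_mult_diff_distrib matrix_vector_mult_scaleR)
    have m: "- (A *v x) = A *v (- x)" for x
      using matrix_vector_mult_scaleR[of A "-1" x] by simp
    show ?thesis
      unfolding b_to_a_def iib_act_def fst_conv snd_conv e m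
      by (simp only: lin_act_def fst_conv snd_conv Aut_H_k3[OF A] Aut_H_k2[OF A] Aut_H_cubic[OF A] dual_inner[OF i] dual_linear[symmetric])
        (simp add: Aut_H_k3[OF A])
  qed
  have 2: "slb m (iib_act A r) = iib_act A (slb m r)" for r
    by (simp add: slb_def iib_act_def matrix_vector_right_distrib matrix_vector_mult_scaleR)
  have 3: "a_to_b k (lin_act 1 A q) = iib_act A (a_to_b k q)"
    by (simp add: a_to_b_def lin_act_def iib_act_def Aut_H_k3[OF A] Aut_H_k2[OF A] Aut_H_cubic[OF A] dual_inner[OF i]
        dual_linear matrix_vector_mult_diff_distrib matrix_vector_mult_scaleR)
  show "lin_act 1 A (sl k m q) = sl k m (lin_act 1 A q)"
    unfolding sl_def 3 2 1 ..
qed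

abbreviation "conjQ A g \<equiv> Aut_act H A \<otimes>\<^bsub>Q\<^esub> g \<otimes>\<^bsub>Q\<^esub> inv\<^bsub>Q\<^esub> (Aut_act H A)"

lemma conj_lift:
  assumes A: "A \<in> Aut_H H" and f: "lift f \<in> carrier Q" "lift g \<in> carrier Q"
    and eq: "\<And>q. q \<in> flat_dom \<Longrightarrow> lin_act 1 A (f q) = g (lin_act 1 A q)"
  shows "conjQ A (lift f) = lift g"
proof -
  interpret Q: group Q by (rule group_q_iso)
  have a: "lift (lin_act 1 A) \<in> carrier Q" using Aut_act_closed[OF A] by (simp add: Aut_act_lift)
  have "lift (lin_act 1 A) \<otimes>\<^bsub>Q\<^esub> lift f = lift g \<otimes>\<^bsub>Q\<^esub> lift (lin_act 1 A)"
    unfolding lift_mult[OF a f(1)] lift_mult[OF f(2) a] by (rule lift_cong) (rule eq)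
  then show ?thesis unfolding Aut_act_lift using a f by (simp add: Q.m_assoc)
qed

text \<open>The dilation, the translation of \<open>\<sigma>\<close> and S-duality commute with
  \<open>A\<close>. The other generators go to the translation by the transformed vector, under
  \<open>A\<close> for \<open>P\<close> and \<open>V\<close> and under its contragredient for
  \<open>X\<close>.\<close>

lemma conj_basic:
  assumes A: "A \<in> Aut_H H" and b: "(c, \<Psi>) \<in> basic"
  shows "conjQ A (lift (\<Psi> s)) \<in> G_set k H"
proof -
  have closed: "lift (\<Psi> s) \<in> carrier Q" using basic_isometry[OF b] .
  have self: "lift (\<Psi> s) \<in> G_set k H" using gens_in_G[OF b] .
  note i = Aut_H_invertible[OF A] Aut_H_invertible[OF Aut_H_one]
  note cm = conj_lift[OF A]
  have fixed: ?thesis if "\<And>q. q \<in> flat_dom \<Longrightarrow> lin_act 1 A (\<Psi> s q) = \<Psi> s (lin_act 1 A q)"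
    using cm[OF closed closed that] self by simp
  consider "\<Psi> = (\<lambda>s. lin_act (exp (s / 2)) (mat 1))" | "\<Psi> = heis 0 0" | i where "\<Psi> = (\<lambda>s. heis 0 (s *\<^sub>R ax i) 0)"
    | i where "\<Psi> = (\<lambda>s. heis (s *\<^sub>R ax i) 0 0)" | a where "\<Psi> = (\<lambda>s. b_shift k (s *\<^sub>R axis a 1))"
    | \<gamma> where "\<Psi> = (\<lambda>s. sl k (\<gamma> s))"
    using b unfolding basic_def by blast
  then show ?thesis
  proof cases
    case 1
    then show ?thesis by (intro fixed) (simp add: lin_act_mult i)
  next
    case 2
    then show ?thesis by (intro fixed) (simp add: lin_act_commute[OF A] dual_def zero_prod_def)
  next
    case (3 j)
    define p where "p = (fst (s *\<^sub>R ax j), A *v snd (s *\<^sub>R ax j))"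
    have "conjQ A (lift (\<Psi> s)) = lift (heis 0 p 0)"
      by (rule cm[OF closed heis_isometry]) (simp add: 3 lin_act_commute[OF A] dual_def zero_prod_def p_def)
    then show ?thesis using heis_in_G(1) by simp
  next
    case (4 j)
    define p where "p = (fst (s *\<^sub>R ax j), dual A (snd (s *\<^sub>R ax j)))"
    have "conjQ A (lift (\<Psi> s)) = lift (heis p 0 0)"
      by (rule cm[OF closed heis_isometry]) (simp add: 4 lin_act_commute[OF A] zero_prod_def p_def)
    then show ?thesis using heis_in_G(2) by simp
  next
    case (5 a)
    have "conjQ A (lift (\<Psi> s)) = lift (b_shift k (A *v (s *\<^sub>R axis a 1)))"
      by (rule cm[OF closed b_shift_isometry]) (simp add: 5 lin_act_commute[OF A])
    then show ?thesis using b_shift_in_G by simp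
  next
    case 6
    then show ?thesis by (intro fixed) (simp add: lin_act_commute[OF A])
  qed
qed

lemma conj_G_subset:
  assumes A: "A \<in> Aut_H H" and g: "g \<in> G_set k H"
  shows "conjQ A g \<in> G_set k H"
proof -
  interpret Q: group Q by (rule group_q_iso)
  note a = Aut_act_closed[OF A]
  note sub = subgroup_G_set
  have gc: "x \<in> carrier Q" if "x \<in> generate Q gens" for x
    using Q.generate_in_carrier[OF gens_closed that] .
  have basic: "conjQ A x \<in> G_set k H" if "x \<in> gens" for x
    using that conj_basic[OF A] unfolding gens_def by blast
  have "g \<in> generate Q gens" using g by (simp add: G_set_generate)
  then show ?thesis
  proof (induction rule: generate.induct)
    case one
    then show ?case using a subgroup.one_closed[OF sub] by simp
  next
    case (incl x)
    then show ?case by (rule basic)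
  next
    case (inv x)
    have x: "x \<in> carrier Q" using inv gens_closed by blast
    have "conjQ A (inv\<^bsub>Q\<^esub> x) =
        inv\<^bsub>Q\<^esub> (conjQ A x)"
      using a x by (simp add: Q.inv_mult_group Q.m_assoc)
    then show ?case using subgroup.m_inv_closed[OF sub basic[OF inv]] by simp
  next
    case (eng x y)
    have xy: "x \<in> carrier Q" "y \<in> carrier Q" using eng.hyps gc by blast+
    have "conjQ A (x \<otimes>\<^bsub>Q\<^esub> y) =
       conjQ A x \<otimes>\<^bsub>Q\<^esub> conjQ A y"
      using a xy by (simp add: Q.m_assoc flip: Q.m_assoc[of "inv\<^bsub>Q\<^esub> (Aut_act H A)" "Aut_act H A"])
    then show ?case using subgroup.m_closed[OF sub eng.IH] by simp
  qed
qed

lemma conj_G: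
  assumes A: "A \<in> Aut_H H"
  shows "conjQ A ` G_set k H = G_set k H"
proof
  interpret Q: group Q by (rule group_q_iso)
  show "conjQ A ` G_set k H \<subseteq> G_set k H"
    using conj_G_subset[OF A] by blast
  note a = Aut_act_closed[OF A]
  show "G_set k H \<subseteq> conjQ A ` G_set k H"
  proof
    fix g assume g: "g \<in> G_set k H"
    have gc: "g \<in> carrier Q" using subgroup.mem_carrier[OF subgroup_G_set g] .
    \<comment> \<open>The preimage of \<open>g\<close> is its conjugate by the inverse automorphism,
      to which the inclusion already proved applies.\<close>
    define g' where "g' = inv\<^bsub>Q\<^esub> (Aut_act H A) \<otimes>\<^bsub>Q\<^esub> g \<otimes>\<^bsub>Q\<^esub> Aut_act H A"
    have "g' \<in> G_set k H"
      using conj_G_subset[OF Aut_H_inv[OF A] g] a by (simp add: g'_def inv_Aut_act[OF A, symmetric])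
    moreover have "g = conjQ A g'"
      unfolding g'_def using a gc by (simp add: Q.m_assoc flip: Q.m_assoc[of "Aut_act H A" "inv\<^bsub>Q\<^esub> (Aut_act H A)"])
    ultimately show "g \<in> conjQ A ` G_set k H" by blast
  qed
qed

section \<open>Trivial intersection of \<open>G\<close> with the automorphisms\<close>

lemma basic_scales_t:
  assumes "(c, \<Psi>) \<in> basic" "q \<in> flat_dom"
  shows "\<exists>l>0. ft (\<Psi> s q) = l *\<^sub>R ft q"
proof -
  \<comment> \<open>S-duality rescales \<open>t\<close> by the modulus of the Moebius denominator;
    the remaining generators fix \<open>t\<close>.\<close>
  have sl: "\<exists>l>0. ft (sl k m q) = l *\<^sub>R ft q" if "det m = 1" for m
    using slb_denominator[OF that, of "gtau (a_to_b k q)"] a_to_b_dom[OF assms(2)]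
    by (intro exI[of _ "cmod (of_real (m$2$1) * gtau (a_to_b k q) + of_real (m$2$2))"])
      (simp add: sl_def b_to_a_def slb_def dom_b_def, simp add: a_to_b_def)
  have one: "\<exists>l>0. ft q = l *\<^sub>R ft q" by (rule exI[of _ 1]) simp
  show ?thesis
    using assms(1) one unfolding basic_def
    by (auto simp: lin_act_def heis_def b_shift_def intro: sl det_exp)
qed

lemma G_scales_t:
  assumes "g \<in> G_set k H"
  shows "\<forall>p\<in>N_bar H. \<exists>l>0. im_vec (fst (g p)) = l *\<^sub>R im_vec (fst p)"
proof -
  interpret Q: group Q by (rule group_q_iso)
  have gen: "\<forall>p\<in>N_bar H. \<exists>l>0. im_vec (fst (x p)) = l *\<^sub>R im_vec (fst p)" if "x \<in> gens" for x
  proof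
    fix p assume p: "p \<in> N_bar H"
    obtain c \<Psi> s where x: "x = lift (\<Psi> s)" "(c, \<Psi>) \<in> basic" using \<open>x \<in> gens\<close> by (auto simp: gens_def)
    have "of_iia p \<in> flat_dom" using p by simp
    from basic_scales_t[OF x(2) this]
    show "\<exists>l>0. im_vec (fst (x p)) = l *\<^sub>R im_vec (fst p)"
      using p by (simp add: x(1) lift_def to_iia_def of_iia_def)
  qed
  have "g \<in> generate Q gens" using assms by (simp add: G_set_generate)
  then show ?thesis
  proof (induction rule: generate.induct)
    case one
    show ?case by (auto simp: q_iso_one intro: exI[of _ 1])
  next
    case (incl x)
    then show ?case by (rule gen)
  next
    case (inv x)
    have x: "x \<in> carrier Q" and ix: "inv\<^bsub>Q\<^esub> x \<in> carrier Q" using inv gens_closed by auto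
    show ?case
    proof
      fix p assume p: "p \<in> N_bar H"
      let ?p = "(inv\<^bsub>Q\<^esub> x) p"
      have p': "?p \<in> N_bar H" using Bij_imp_funcset[OF q_iso_Bij[OF ix]] p by blast
      have "(x \<otimes>\<^bsub>Q\<^esub> inv\<^bsub>Q\<^esub> x) p = \<one>\<^bsub>Q\<^esub> p" using Q.r_inv[OF x] by (rule fun_cong)
      \<comment> \<open>The scaling of \<open>x\<close> at the image point \<open>?p\<close>, read
        backwards, is that of the inverse at \<open>p\<close>.\<close>
      then have "x ?p = p"
        unfolding q_iso_mult[OF x ix] q_iso_one compose_eq[OF p] by (simp only: restrict_apply'[OF p])
      then obtain l where l: "l > 0" "im_vec (fst p) = l *\<^sub>R im_vec (fst ?p)" using gen[OF inv] p' by metis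
      then show "\<exists>l>0. im_vec (fst ?p) = l *\<^sub>R im_vec (fst p)" by (intro exI[of _ "1 / l"]) simp
    qed
  next
    case (eng x y)
    have xy: "x \<in> carrier Q" "y \<in> carrier Q" using eng.hyps Q.generate_in_carrier[OF gens_closed] by blast+
    show ?case
    proof
      fix p assume p: "p \<in> N_bar H"
      have p': "y p \<in> N_bar H" using Bij_imp_funcset[OF q_iso_Bij[OF xy(2)]] p by blast
      obtain l l' where l: "l > 0" "im_vec (fst (y p)) = l *\<^sub>R im_vec (fst p)"
        "l' > 0" "im_vec (fst (x (y p))) = l' *\<^sub>R im_vec (fst (y p))"
        using eng.IH p p' by metis
      then show "\<exists>l>0. im_vec (fst ((x \<otimes>\<^bsub>Q\<^esub> y) p)) = l *\<^sub>R im_vec (fst p)"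
        using p by (intro exI[of _ "l' * l"]) (simp add: q_iso_mult[OF xy] compose_eq)
    qed
  qed
qed

lemma Aut_act_in_G:
  assumes A: "A \<in> Aut_H H" and g: "Aut_act H A \<in> G_set k H"
  shows "A = mat 1"
proof -
  have cone: "A *v t = t" if t: "t \<in> cone H" for t
  proof -
    let ?q = "((0, t), 1, 0, 0, 0) :: 'n flat"
    have q: "?q \<in> flat_dom" using t by (simp add: flat_dom_def)
    then have "to_iia ?q \<in> N_bar H" by simp
    then obtain l where l: "l > 0" "im_vec (fst (Aut_act H A (to_iia ?q))) = l *\<^sub>R im_vec (fst (to_iia ?q))"
      using G_scales_t[OF g] by blast
    then have At: "A *v t = l *\<^sub>R t"
      using q by (simp add: Aut_act_lift lift_def) (simp add: to_iia_def lin_act_def)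
    have "l ^ 3 * cubic k t = cubic k t"
      using Aut_H_cubic[OF A, of t] unfolding At cubic_scaleR .
    then have "l ^ 3 = 1 ^ 3" using cubic_pos[OF t] by simp
    then have "l = 1" using l(1) power_eq_imp_eq_base[of l 3 1] by simp
    then show ?thesis using At by simp
  qed
  have "A *v x = x" for x
  proof -
    obtain p where p: "p \<in> cone H" using H_nonempty H_subset_cone by blast
    obtain e where e: "0 < e" "\<And>s. \<bar>s\<bar> < e \<Longrightarrow> p + s *\<^sub>R x \<in> cone H"
      using cone_segment[OF p] by blast
    \<comment> \<open>\<open>A\<close> fixes the cone pointwise. The cone is open, so it contains
      \<open>p\<close> together with a small displacement along \<open>x\<close>, and by linearity
      \<open>A\<close> fixes \<open>x\<close>.\<close>
    then have "p + (e / 2) *\<^sub>R x \<in> cone H" by simp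
    from cone[OF this] cone[OF p] have "(e / 2) *\<^sub>R (A *v x) = (e / 2) *\<^sub>R x"
      by (simp add: matrix_vector_right_distrib matrix_vector_mult_scaleR)
    then show ?thesis using e(1) by simp
  qed
  then show ?thesis by (simp add: matrix_eq)
qed

end

theorem corollary3p20:
  fixes k :: "'n::finite \<Rightarrow> 'n \<Rightarrow> 'n \<Rightarrow> real" and H :: "(real ^ 'n) set"
  assumes psr: "psr_manifold k H"
  shows "Aut_H H \<subseteq> Aut_h k
    \<and> group (Aut_H_group H)
    \<and> group (q_iso k H)
    \<and> Aut_act H \<in> hom (Aut_H_group H) (q_iso k H)
    \<and> (\<forall>V\<in>G_fields k H. complete_field (N_bar H) V)
    \<and> (\<forall>V\<in>G_lie_algebra k H. \<forall>W\<in>G_lie_algebra k H. lie_bracket (N_bar H) V W \<in> G_lie_algebra k H)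
    \<and> vector_space.dim scale_field (G_lie_algebra k H) = 3 * CARD('n) + 6
    \<and> subgroup (G_set k H) (q_iso k H)
    \<and> (\<forall>A\<in>Aut_H H.
           (\<lambda>g. Aut_act H A \<otimes>\<^bsub>q_iso k H\<^esub> g \<otimes>\<^bsub>q_iso k H\<^esub> inv\<^bsub>q_iso k H\<^esub> (Aut_act H A)) ` G_set k H = G_set k H)
    \<and> conj_act k H \<in> hom (Aut_H_group H) (AutoGroup (G_group k H))
    \<and> (\<lambda>(A, g). g \<otimes>\<^bsub>q_iso k H\<^esub> Aut_act H A)
           \<in> mon (semidirect (Aut_H_group H) (G_group k H) (conj_act k H)) (q_iso k H)"
proof -
  interpret psr k H
    by unfold_locales (use psr in \<open>auto simp: psr_manifold_def\<close>)
  interpret Q: group "q_iso k H" by (rule group_q_iso)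
  \<comment> \<open>Written out as conjugation in \<open>q_iso k H\<close>, the action has the form
    to which the abstract lemmas on normalizing actions apply.\<close>
  have conj: "conj_act k H = (\<lambda>A. \<lambda>g\<in>G_set k H. Aut_act H A \<otimes>\<^bsub>q_iso k H\<^esub> g \<otimes>\<^bsub>q_iso k H\<^esub> inv\<^bsub>q_iso k H\<^esub> (Aut_act H A))"
    by (rule ext) (simp add: conj_act_def)
  have norm: "(\<lambda>g. Aut_act H A \<otimes>\<^bsub>q_iso k H\<^esub> g \<otimes>\<^bsub>q_iso k H\<^esub> inv\<^bsub>q_iso k H\<^esub> (Aut_act H A)) ` G_set k H = G_set k H"
    if "A \<in> carrier (Aut_H_group H)" for A
    using conj_G that by (simp add: Aut_H_group_def)
  have triv: "A = \<one>\<^bsub>Aut_H_group H\<^esub>" if "A \<in> carrier (Aut_H_group H)" "Aut_act H A \<in> G_set k H" for A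
    using Aut_act_in_G that by (simp add: Aut_H_group_def)
  show ?thesis
    unfolding conj G_group_def
    using Aut_H_subset_Aut_h group_Aut_H group_q_iso Aut_act_hom complete_G_fields lie_bracket_closed dim_G_lie_algebra
      subgroup_G_set conj_G Q.conj_hom_AutoGroup[OF subgroup_G_set group_Aut_H Aut_act_hom norm]
      Q.semidirect_mon[OF subgroup_G_set group_Aut_H Aut_act_hom norm triv]
    by blast
qed

end
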